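(* Let $H$ be a Lie group with Lie algebra $\mathfrak h$ and let $G\subset H$ be a reductive Lie subgroup with Lie algebra $\mathfrak g$, such that $\mathfrak h=V\oplus\mathfrak g$, $[\mathfrak g,V]\subset V$ is the reductive decomposition of $\mathfrak h$ (with $V=\mathbb R^n$ as a vector space, invariant under $\mathrm{Ad}(G)$), and assume that the adjoint representation of $G$ in $V$ is faithful, so that $G$ is identified with a subgroup of $GL(V)$. Let $p:P\to M$ be a principal $G$-bundle over an $n$-dimensional manifold $M$. (i) Let $\kappa:TP\to\mathfrak h=V\oplus\mathfrak g$ be a principal Cartan connection of type $\mathfrak h/\mathfrak g$ on $p:P\to M$, and let $\theta=\mathrm{pr}_V\circ\kappa$ and $\omega=\mathrm{pr}_{\mathfrak g}\circ\kappa$ be its components in $V$ and $\mathfrak g$. Then $\theta$ is a displacement form and $\omega$ is a principal connection form on $p:P\to M$, so that $(p:P\to M,\theta)$ is a $G$-structure with connection form $\omega$. (ii) Conversely, if $(p:P\to M,\theta)$ is a $G$-structure with a principal connection form $\omega$, then $\kappa=\theta+\omega$ is a principal Cartan connection of type $\mathfrak h/\mathfrak g$ for the principal $G$-bundle $p:P\to M$.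
   Context: For a principal $G$-bundle $P\to M$ with right action $r^g(u)=u.g$, the fundamental vector field of $X\in\mathfrak g$ is $\zeta_X(u)=\frac{d}{dt}|_0\,u.\exp(tX)$; the vertical parallelism $\kappa_G:VP\to\mathfrak g$ on the vertical bundle is determined by $\kappa_G(\zeta_X(u))=X$. A principal connection form is a $G$-equivariant $\omega\in\Omega^1(P;\mathfrak g)$ with $\omega(\zeta_X)=X$. $G$-structure: for a linear Lie group $G\subset GL(V)$, $V=\mathbb R^n$, a $G$-structure on an $n$-dimensional manifold $M$ is a principal $G$-bundle $p:P\to M$ together with a displacement form $\theta:TP\to V$, i.e. a $V$-valued 1-form which is $G$-equivariant ($(r^g)^*\theta=g^{-1}\circ\theta$) and strictly horizontal, i.e. $\ker\theta=VP$. Principal Cartan connection of type $\mathfrak h/\mathfrak g$ on $P\to M$ (with $\dim P=\dim\mathfrak h$): a 1-form $\kappa\in\Omega^1(P;\mathfrak h)$ such that $\kappa_x:T_xP\to\mathfrak h$ is a linear isomorphism for every $x$; the vector fields $\zeta_X(x):=(\kappa_x)^{-1}(X)$, $X\in\mathfrak h$, satisfy $[\zeta_X,\zeta_Y]=\zeta_{[X,Y]}$ for $X\in\mathfrak h$, $Y\in\mathfrak g$; $\kappa|_{VP}=\kappa_G$; and $\kappa\circ T(r^g)=\mathrm{Ad}(g^{-1})\circ\kappa$ for all $g\in G$. *)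

theory Defs
  imports "HOL-Analysis.Analysis" "HOL-Algebra.Group"
begin

section \<open>Smooth manifolds\<close>

text \<open>
  Manifolds are modelled on finite-dimensional real normed spaces rather than on
  \<^class>\<open>euclidean_space\<close>, because the latter excludes dimension 0 (for instance, discrete
  structure groups). Requiring \<^class>\<open>banach\<close> is no restriction: finite-dimensional normed
  spaces are complete.
\<close>

class finite_dim_normed = banach +
  assumes finite_dimensional: "\<exists>B::'a set. finite B \<and> (\<forall>x. \<exists>c. x = (\<Sum>b\<in>B. c b *\<^sub>R b))"

instance euclidean_space \<subseteq> finite_dim_normed
  by intro_classes (metis finite_Basis euclidean_representation)

text \<open>Meant for open \<open>S\<close> in a finite-dimensional space; all directional derivatives of
  order \<open>n\<close> being continuous then means \<open>C\<^sup>n\<close>.\<close>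

primrec higher_differentiable_on ::
    "nat \<Rightarrow> 'a::real_normed_vector set \<Rightarrow> ('a \<Rightarrow> 'b::real_normed_vector) \<Rightarrow> bool" where
  "higher_differentiable_on 0 S f \<longleftrightarrow> continuous_on S f"
| "higher_differentiable_on (Suc n) S f \<longleftrightarrow>
     (\<forall>x\<in>S. f differentiable (at x)) \<and>
     (\<forall>v. higher_differentiable_on n S (\<lambda>x. frechet_derivative f (at x) v))"

definition smooth_on ::
    "'a::real_normed_vector set \<Rightarrow> ('a \<Rightarrow> 'b::real_normed_vector) \<Rightarrow> bool" where
  "smooth_on S f \<longleftrightarrow> (\<forall>n. higher_differentiable_on n S f)"

type_synonym ('a, 'e) chart = "'a set \<times> ('a \<Rightarrow> 'e)"

record ('a, 'e) manifold =
  mtop :: "'a topology"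
  atlas :: "('a, 'e) chart set"

abbreviation points :: "('a, 'e, 'z) manifold_scheme \<Rightarrow> 'a set" where
  "points M \<equiv> topspace (mtop M)"

abbreviation chart_inv :: "('a, 'e) chart \<Rightarrow> 'e \<Rightarrow> 'a" where
  "chart_inv c \<equiv> inv_into (fst c) (snd c)"

definition is_chart :: "'a topology \<Rightarrow> ('a, 'e::real_normed_vector) chart \<Rightarrow> bool" where
  "is_chart T c \<longleftrightarrow>
     openin T (fst c) \<and> open (snd c ` fst c) \<and>
     homeomorphic_map (subtopology T (fst c)) (top_of_set (snd c ` fst c)) (snd c)"

text \<open>The atlas need not be maximal.\<close>

definition smooth_manifold :: "('a, 'e::finite_dim_normed) manifold \<Rightarrow> bool" where
  "smooth_manifold M \<longleftrightarrow>
     Hausdorff_space (mtop M) \<and> second_countable (mtop M) \<and>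
     (\<forall>c\<in>atlas M. is_chart (mtop M) c) \<and>
     (\<Union>c\<in>atlas M. fst c) = points M \<and>
     (\<forall>c\<in>atlas M. \<forall>d\<in>atlas M. smooth_on (snd c ` (fst c \<inter> fst d)) (snd d \<circ> chart_inv c))"

definition smooth_map ::
    "('a, 'e::real_normed_vector) manifold \<Rightarrow> ('b, 'f::real_normed_vector) manifold
      \<Rightarrow> ('a \<Rightarrow> 'b) \<Rightarrow> bool" where
  "smooth_map M N f \<longleftrightarrow>
     continuous_map (mtop M) (mtop N) f \<and>
     (\<forall>c\<in>atlas M. \<forall>d\<in>atlas N.
        smooth_on (snd c ` (fst c \<inter> f -` fst d)) (snd d \<circ> f \<circ> chart_inv c))"

definition diffeomorphism ::
    "('a, 'e::real_normed_vector) manifold \<Rightarrow> ('b, 'f::real_normed_vector) manifold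
      \<Rightarrow> ('a \<Rightarrow> 'b) \<Rightarrow> bool" where
  "diffeomorphism M N f \<longleftrightarrow>
     smooth_map M N f \<and> bij_betw f (points M) (points N) \<and>
     smooth_map N M (inv_into (points M) f)"

definition vec_manifold :: "('e::real_normed_vector, 'e) manifold" where
  "vec_manifold = \<lparr>mtop = euclidean, atlas = {(UNIV, \<lambda>x. x)}\<rparr>"

definition prod_manifold ::
    "('a, 'e) manifold \<Rightarrow> ('b, 'f) manifold \<Rightarrow> ('a \<times> 'b, 'e \<times> 'f) manifold" where
  "prod_manifold M N =
     \<lparr>mtop = prod_topology (mtop M) (mtop N),
      atlas = {(fst c \<times> fst d, map_prod (snd c) (snd d)) | c d. c \<in> atlas M \<and> d \<in> atlas N}\<rparr>"

definition open_submanifold :: "('a, 'e) manifold \<Rightarrow> 'a set \<Rightarrow> ('a, 'e) manifold" where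
  "open_submanifold M U =
     \<lparr>mtop = subtopology (mtop M) U, atlas = {(U \<inter> fst c, snd c) | c. c \<in> atlas M}\<rparr>"


section \<open>Tangent vectors and vector fields\<close>

text \<open>
  The tangent space at a point \<open>x\<close> of a manifold with model space \<open>'e\<close> is represented by
  \<open>'e\<close> itself: a tangent vector is identified with its components in a chart at \<open>x\<close> which is
  chosen once and for all (\<open>chart_at M x\<close>). Tangent maps are expressed in these preferred
  charts; in particular, the components of a tangent vector in an arbitrary chart \<open>c\<close> are
  obtained from the tangent map of \<open>snd c\<close>.
\<close>

definition chart_at :: "('a, 'e) manifold \<Rightarrow> 'a \<Rightarrow> ('a, 'e) chart" where
  "chart_at M x = (SOME c. c \<in> atlas M \<and> x \<in> fst c)"

definition tangent_map ::
    "('a, 'e::real_normed_vector) manifold \<Rightarrow> ('b, 'f::real_normed_vector) manifold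
      \<Rightarrow> ('a \<Rightarrow> 'b) \<Rightarrow> 'a \<Rightarrow> 'e \<Rightarrow> 'f" where
  "tangent_map M N f x =
     frechet_derivative (snd (chart_at N (f x)) \<circ> f \<circ> chart_inv (chart_at M x))
       (at (snd (chart_at M x) x))"

definition velocity ::
    "('a, 'e::real_normed_vector) manifold \<Rightarrow> (real \<Rightarrow> 'a) \<Rightarrow> real \<Rightarrow> 'e" where
  "velocity M c t = vector_derivative (snd (chart_at M (c t)) \<circ> c) (at t)"

definition field_in_chart ::
    "('a, 'e::real_normed_vector) manifold \<Rightarrow> ('a, 'e) chart \<Rightarrow> ('a \<Rightarrow> 'e) \<Rightarrow> 'e \<Rightarrow> 'e" where
  "field_in_chart M c X y =
     tangent_map M vec_manifold (snd c) (chart_inv c y) (X (chart_inv c y))"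

text \<open>The coordinate formula \<open>[X,Y] = DY(X) - DX(Y)\<close>, i.e. \<open>[X,Y] f = X(Y f) - Y(X f)\<close>.\<close>

definition vf_bracket ::
    "('a, 'e::real_normed_vector) manifold \<Rightarrow> ('a \<Rightarrow> 'e) \<Rightarrow> ('a \<Rightarrow> 'e) \<Rightarrow> 'a \<Rightarrow> 'e" where
  "vf_bracket M X Y x =
     (let c = chart_at M x; y = snd c x;
          X' = field_in_chart M c X; Y' = field_in_chart M c Y
      in frechet_derivative Y' (at y) (X' y) - frechet_derivative X' (at y) (Y' y))"

text \<open>Smooth 1-forms on \<open>M\<close> with values in a vector space. For \<open>y\<close> in the image of the
  chart \<open>c\<close>, \<open>tangent_map vec_manifold M (chart_inv c) y v\<close> is the tangent vector with
  components \<open>v\<close> in \<open>c\<close>.\<close>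

definition smooth_one_form ::
    "('a, 'e::real_normed_vector) manifold \<Rightarrow> ('a \<Rightarrow> 'e \<Rightarrow> 'w::real_normed_vector) \<Rightarrow> bool" where
  "smooth_one_form M \<alpha> \<longleftrightarrow>
     (\<forall>x\<in>points M. linear (\<alpha> x)) \<and>
     (\<forall>c\<in>atlas M. \<forall>v. smooth_on (snd c ` fst c)
        (\<lambda>y. \<alpha> (chart_inv c y) (tangent_map vec_manifold M (chart_inv c) y v)))"


section \<open>Lie groups\<close>

record ('g, 'e) lie_group_data = "'g monoid" +
  mfd :: "('g, 'e) manifold"

definition lie_group :: "('g, 'e::finite_dim_normed) lie_group_data \<Rightarrow> bool" where
  "lie_group G \<longleftrightarrow>
     group G \<and> smooth_manifold (mfd G) \<and> points (mfd G) = carrier G \<and>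
     smooth_map (prod_manifold (mfd G) (mfd G)) (mfd G) (\<lambda>(x, y). x \<otimes>\<^bsub>G\<^esub> y) \<and>
     smooth_map (mfd G) (mfd G) (m_inv G)"

text \<open>The Lie algebra of \<open>G\<close> is the tangent space at the identity, i.e. the model type,
  with the bracket of left-invariant vector fields.\<close>

definition left_invariant_field ::
    "('g, 'e::real_normed_vector) lie_group_data \<Rightarrow> 'e \<Rightarrow> 'g \<Rightarrow> 'e" where
  "left_invariant_field G X h = tangent_map (mfd G) (mfd G) (\<lambda>x. h \<otimes>\<^bsub>G\<^esub> x) \<one>\<^bsub>G\<^esub> X"

definition lie_algebra_bracket ::
    "('g, 'e::real_normed_vector) lie_group_data \<Rightarrow> 'e \<Rightarrow> 'e \<Rightarrow> 'e" where
  "lie_algebra_bracket G X Y =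
     vf_bracket (mfd G) (left_invariant_field G X) (left_invariant_field G Y) \<one>\<^bsub>G\<^esub>"

definition Ad :: "('g, 'e::real_normed_vector) lie_group_data \<Rightarrow> 'g \<Rightarrow> 'e \<Rightarrow> 'e" where
  "Ad G g = tangent_map (mfd G) (mfd G) (\<lambda>x. g \<otimes>\<^bsub>G\<^esub> x \<otimes>\<^bsub>G\<^esub> m_inv G g) \<one>\<^bsub>G\<^esub>"

definition one_parameter_subgroup ::
    "('g, 'e::real_normed_vector) lie_group_data \<Rightarrow> (real \<Rightarrow> 'g) \<Rightarrow> bool" where
  "one_parameter_subgroup G c \<longleftrightarrow>
     smooth_map vec_manifold (mfd G) c \<and> (\<forall>s t. c (s + t) = c s \<otimes>\<^bsub>G\<^esub> c t)"

definition lie_exp :: "('g, 'e::real_normed_vector) lie_group_data \<Rightarrow> 'e \<Rightarrow> 'g" where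
  "lie_exp G X =
     (THE g. \<exists>c. one_parameter_subgroup G c \<and> velocity (mfd G) c 0 = X \<and> g = c 1)"

text \<open>The tangent map at the identity of the inclusion \<open>G \<subseteq> H\<close>; it identifies the Lie algebra
  of \<open>G\<close> with a subspace of the Lie algebra of \<open>H\<close>, namely its range.\<close>

definition lie_inclusion ::
    "('h, 'eg::real_normed_vector) lie_group_data \<Rightarrow> ('h, 'eh::real_normed_vector) lie_group_data
      \<Rightarrow> 'eg \<Rightarrow> 'eh" where
  "lie_inclusion G H = tangent_map (mfd G) (mfd H) (\<lambda>x. x) \<one>\<^bsub>G\<^esub>"

text \<open>Immersed Lie subgroups: \<open>G\<close> may carry a finer topology than the one induced by \<open>H\<close>.\<close>

definition lie_subgroup ::
    "('h, 'eg::finite_dim_normed) lie_group_data \<Rightarrow> ('h, 'eh::finite_dim_normed) lie_group_data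
      \<Rightarrow> bool" where
  "lie_subgroup G H \<longleftrightarrow>
     lie_group G \<and> lie_group H \<and> subgroup (carrier G) H \<and>
     (\<forall>x\<in>carrier G. \<forall>y\<in>carrier G. x \<otimes>\<^bsub>G\<^esub> y = x \<otimes>\<^bsub>H\<^esub> y) \<and>
     smooth_map (mfd G) (mfd H) (\<lambda>x. x) \<and>
     (\<forall>x\<in>carrier G. inj (tangent_map (mfd G) (mfd H) (\<lambda>x. x) x))"

definition reductive_decomposition ::
    "('h, 'eh::finite_dim_normed) lie_group_data \<Rightarrow> ('h, 'eg::finite_dim_normed) lie_group_data
      \<Rightarrow> 'eh set \<Rightarrow> bool" where
  "reductive_decomposition H G V \<longleftrightarrow>
     (let \<gg> = range (lie_inclusion G H) in
       subspace V \<and> V \<inter> \<gg> = {0} \<and> {v + Y | v Y. v \<in> V \<and> Y \<in> \<gg>} = UNIV \<and>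
       (\<forall>Y\<in>\<gg>. \<forall>v\<in>V. lie_algebra_bracket H Y v \<in> V) \<and>
       (\<forall>g\<in>carrier G. Ad H g ` V \<subseteq> V))"

text \<open>The projection onto \<open>A\<close> along \<open>B\<close>, for complementary subspaces \<open>A\<close> and \<open>B\<close>.\<close>

definition proj_along :: "'a::real_vector set \<Rightarrow> 'a set \<Rightarrow> 'a \<Rightarrow> 'a" where
  "proj_along A B x = (THE a. a \<in> A \<and> x - a \<in> B)"

text \<open>\<open>G\<close> as a linear Lie group: \<open>\<rho>\<close> is the inclusion of \<open>G\<close> into \<open>GL(V)\<close>, for a linear
  subspace \<open>V\<close> of \<open>'v\<close>.\<close>

definition linear_lie_group ::
    "('g, 'e::finite_dim_normed) lie_group_data \<Rightarrow> 'v::finite_dim_normed set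
      \<Rightarrow> ('g \<Rightarrow> 'v \<Rightarrow> 'v) \<Rightarrow> bool" where
  "linear_lie_group G V \<rho> \<longleftrightarrow>
     lie_group G \<and> subspace V \<and>
     (\<forall>g\<in>carrier G. \<rho> g ` V \<subseteq> V \<and>
        (\<forall>v\<in>V. \<forall>w\<in>V. \<forall>a b. \<rho> g (a *\<^sub>R v + b *\<^sub>R w) = a *\<^sub>R \<rho> g v + b *\<^sub>R \<rho> g w)) \<and>
     (\<forall>v\<in>V. \<rho> \<one>\<^bsub>G\<^esub> v = v) \<and>
     (\<forall>g\<in>carrier G. \<forall>h\<in>carrier G. \<forall>v\<in>V. \<rho> (g \<otimes>\<^bsub>G\<^esub> h) v = \<rho> g (\<rho> h v)) \<and>
     (\<forall>v\<in>V. smooth_map (mfd G) vec_manifold (\<lambda>g. \<rho> g v)) \<and>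
     inj_on (\<lambda>g. restrict (\<rho> g) V) (carrier G)"


section \<open>Principal bundles\<close>

record ('p, 'ep, 'm, 'em, 'g) bundle_data =
  total :: "('p, 'ep) manifold"
  base :: "('m, 'em) manifold"
  proj :: "'p \<Rightarrow> 'm"
  act :: "'p \<Rightarrow> 'g \<Rightarrow> 'p"

definition principal_bundle ::
    "('g, 'eg::finite_dim_normed) lie_group_data
      \<Rightarrow> ('p, 'ep::finite_dim_normed, 'm, 'em::finite_dim_normed, 'g) bundle_data \<Rightarrow> bool" where
  "principal_bundle G B \<longleftrightarrow>
     lie_group G \<and> smooth_manifold (total B) \<and> smooth_manifold (base B) \<and>
     smooth_map (total B) (base B) (proj B) \<and> proj B ` points (total B) = points (base B) \<and>
     smooth_map (prod_manifold (total B) (mfd G)) (total B) (\<lambda>(u, g). act B u g) \<and>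
     (\<forall>u\<in>points (total B). act B u \<one>\<^bsub>G\<^esub> = u) \<and>
     (\<forall>u\<in>points (total B). \<forall>g\<in>carrier G. \<forall>h\<in>carrier G.
        act B (act B u g) h = act B u (g \<otimes>\<^bsub>G\<^esub> h)) \<and>
     (\<forall>x\<in>points (base B). \<exists>U \<psi>. openin (mtop (base B)) U \<and> x \<in> U \<and>
        (let E = {u \<in> points (total B). proj B u \<in> U} in
          diffeomorphism (open_submanifold (total B) E)
            (prod_manifold (open_submanifold (base B) U) (mfd G)) \<psi> \<and>
          (\<forall>u\<in>E. fst (\<psi> u) = proj B u) \<and>
          (\<forall>u\<in>E. \<forall>g\<in>carrier G. \<psi> (act B u g) = (fst (\<psi> u), snd (\<psi> u) \<otimes>\<^bsub>G\<^esub> g))))"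

definition vertical_space ::
    "('p, 'ep::real_normed_vector, 'm, 'em::real_normed_vector, 'g) bundle_data \<Rightarrow> 'p \<Rightarrow> 'ep set"
  where "vertical_space B u = {\<xi>. tangent_map (total B) (base B) (proj B) u \<xi> = 0}"

text \<open>\<open>T(r\<^sup>g)\<close> at the point \<open>u\<close>, with values in the tangent space at \<open>u.g\<close>.\<close>

definition tangent_act ::
    "('p, 'ep::real_normed_vector, 'm, 'em, 'g) bundle_data \<Rightarrow> 'g \<Rightarrow> 'p \<Rightarrow> 'ep \<Rightarrow> 'ep" where
  "tangent_act B g u = tangent_map (total B) (total B) (\<lambda>u'. act B u' g) u"

definition fundamental_field ::
    "('g, 'eg::real_normed_vector) lie_group_data
      \<Rightarrow> ('p, 'ep::real_normed_vector, 'm, 'em, 'g) bundle_data \<Rightarrow> 'eg \<Rightarrow> 'p \<Rightarrow> 'ep" where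
  "fundamental_field G B X u = velocity (total B) (\<lambda>t. act B u (lie_exp G (t *\<^sub>R X))) 0"

definition vertical_parallelism ::
    "('g, 'eg::real_normed_vector) lie_group_data
      \<Rightarrow> ('p, 'ep::real_normed_vector, 'm, 'em, 'g) bundle_data \<Rightarrow> 'p \<Rightarrow> 'ep \<Rightarrow> 'eg" where
  "vertical_parallelism G B u \<xi> = (THE X. fundamental_field G B X u = \<xi>)"

definition principal_connection_form ::
    "('g, 'eg::finite_dim_normed) lie_group_data
      \<Rightarrow> ('p, 'ep::finite_dim_normed, 'm, 'em, 'g) bundle_data
      \<Rightarrow> ('p \<Rightarrow> 'ep \<Rightarrow> 'eg) \<Rightarrow> bool" where
  "principal_connection_form G B \<omega> \<longleftrightarrow>
     smooth_one_form (total B) \<omega> \<and>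
     (\<forall>u\<in>points (total B). \<forall>g\<in>carrier G. \<forall>\<xi>.
        \<omega> (act B u g) (tangent_act B g u \<xi>) = Ad G (m_inv G g) (\<omega> u \<xi>)) \<and>
     (\<forall>u\<in>points (total B). \<forall>X. \<omega> u (fundamental_field G B X u) = X)"

definition displacement_form ::
    "('g, 'eg::finite_dim_normed) lie_group_data \<Rightarrow> 'v::finite_dim_normed set
      \<Rightarrow> ('g \<Rightarrow> 'v \<Rightarrow> 'v)
      \<Rightarrow> ('p, 'ep::finite_dim_normed, 'm, 'em::finite_dim_normed, 'g) bundle_data
      \<Rightarrow> ('p \<Rightarrow> 'ep \<Rightarrow> 'v) \<Rightarrow> bool" where
  "displacement_form G V \<rho> B \<theta> \<longleftrightarrow>
     smooth_one_form (total B) \<theta> \<and>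
     (\<forall>u\<in>points (total B). range (\<theta> u) \<subseteq> V) \<and>
     (\<forall>u\<in>points (total B). \<forall>g\<in>carrier G. \<forall>\<xi>.
        \<theta> (act B u g) (tangent_act B g u \<xi>) = \<rho> (m_inv G g) (\<theta> u \<xi>)) \<and>
     (\<forall>u\<in>points (total B). {\<xi>. \<theta> u \<xi> = 0} = vertical_space B u)"

definition G_structure ::
    "('g, 'eg::finite_dim_normed) lie_group_data \<Rightarrow> 'v::finite_dim_normed set
      \<Rightarrow> ('g \<Rightarrow> 'v \<Rightarrow> 'v)
      \<Rightarrow> ('p, 'ep::finite_dim_normed, 'm, 'em::finite_dim_normed, 'g) bundle_data
      \<Rightarrow> ('p \<Rightarrow> 'ep \<Rightarrow> 'v) \<Rightarrow> bool" where
  "G_structure G V \<rho> B \<theta> \<longleftrightarrow>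
     linear_lie_group G V \<rho> \<and> principal_bundle G B \<and>
     dim (UNIV :: 'em set) = dim V \<and> displacement_form G V \<rho> B \<theta>"

definition cartan_field ::
    "('p \<Rightarrow> 'ep \<Rightarrow> 'eh) \<Rightarrow> 'eh \<Rightarrow> 'p \<Rightarrow> 'ep" where
  "cartan_field \<kappa> X u = inv_into UNIV (\<kappa> u) X"

text \<open>The equality of the dimensions of \<open>P\<close> and \<open>H\<close> is not listed separately: it is implied by
  the pointwise isomorphisms, unless \<open>P\<close> is empty. The Lie algebra of \<open>G\<close> enters as a subspace
  of that of \<open>H\<close> through \<open>lie_inclusion\<close>.\<close>

definition principal_cartan_connection ::
    "('g, 'eh::finite_dim_normed) lie_group_data \<Rightarrow> ('g, 'eg::finite_dim_normed) lie_group_data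
      \<Rightarrow> ('p, 'ep::finite_dim_normed, 'm, 'em::finite_dim_normed, 'g) bundle_data
      \<Rightarrow> ('p \<Rightarrow> 'ep \<Rightarrow> 'eh) \<Rightarrow> bool" where
  "principal_cartan_connection H G B \<kappa> \<longleftrightarrow>
     smooth_one_form (total B) \<kappa> \<and>
     (\<forall>u\<in>points (total B). linear (\<kappa> u) \<and> bij (\<kappa> u)) \<and>
     (\<forall>X Y. \<forall>u\<in>points (total B).
        vf_bracket (total B) (cartan_field \<kappa> X) (cartan_field \<kappa> (lie_inclusion G H Y)) u =
        cartan_field \<kappa> (lie_algebra_bracket H X (lie_inclusion G H Y)) u) \<and>
     (\<forall>u\<in>points (total B). \<forall>\<xi>\<in>vertical_space B u.
        \<kappa> u \<xi> = lie_inclusion G H (vertical_parallelism G B u \<xi>)) \<and>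
     (\<forall>u\<in>points (total B). \<forall>g\<in>carrier G. \<forall>\<xi>.
        \<kappa> (act B u g) (tangent_act B g u \<xi>) = Ad H (m_inv H g) (\<kappa> u \<xi>))"

end

(*
  Everything about the fundamental fields of P rests on one-parameter subgroups: they exist by
  Picard iteration and doubling t |-> a(t/2) a(t/2), and they are unique because the quotient
  of two integral curves of a left-invariant field has zero velocity. Hence the fundamental field
  of Y is u |-> T(u.)Y, and a local trivialization shows that these fields span exactly the
  vertical spaces.

  With this, a Cartan connection kappa and a pair (theta, omega) determine each other by linear
  algebra along h = V + g, since Ad(G) respects the decomposition. The only analytic point is
  [zeta_X, zeta_Y] = zeta_[X,Y] for Y in g. Equivariance reads T(r^g) zeta_X(u) = zeta_{Ad(g^-1)X}(u.g);
  differentiating it in g at the identity in the direction Y, and exchanging the two partial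
  derivatives of the action, gives [zeta_X, zeta_Y] = zeta_Z, where Z is the derivative of
  g |-> Ad(g^-1)X in the direction Y. For H acting on itself from the right, the fields zeta are
  the left-invariant ones, so the same computation identifies Z with [X,Y].
*)
theory Submission
  imports Defs
begin

section \<open>Finite-dimensional normed spaces\<close>

text \<open>A tangent vector is stored by its components in the preferred chart
  \<open>chart_at M x\<close>, and that chart jumps with \<open>x\<close>. A vector field is
  therefore not a smooth function into the model space, and it may be differentiated only after
  being read in one fixed chart; hence the recurring form
  \<open>tangent_map M vec_manifold (snd c) u (X u)\<close>. Likewise, smooth dependence of a
  tangent map on a parameter is used at a base point that stays put, such as the identity of a
  group. Smoothness is phrased by directional derivatives in constant directions. Whenever a
  derivative is applied to a vector that itself varies (chain rule, inverse of a linear family,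
  index of a field in the bracket computation), that vector is expanded in a basis, which is where
  finite dimension enters the calculus. In the converse direction, injectivity of
  \<open>\<kappa>\<close> comes from horizontality and the decomposition, whereas surjectivity needs
  the dimension of the base: horizontality alone does not make \<open>\<theta>\<close> fill
  \<open>V\<close>.\<close>

instance prod :: (finite_dim_normed, finite_dim_normed) finite_dim_normed
proof
  obtain A :: "'a set" where A: "finite A" "\<And>x. \<exists>c. x = (\<Sum>b\<in>A. c b *\<^sub>R b)"
    using finite_dimensional by blast
  obtain B :: "'b set" where B: "finite B" "\<And>x. \<exists>c. x = (\<Sum>b\<in>B. c b *\<^sub>R b)"
    using finite_dimensional by blast
  let ?C = "(\<lambda>a. (a, 0)) ` A \<union> Pair 0 ` B"
  have fin: "finite ?C" using A B by auto
  have "x \<in> span ?C" for x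
  proof -
    obtain c where c: "fst x = (\<Sum>b\<in>A. c b *\<^sub>R b)" using A by blast
    obtain d where d: "snd x = (\<Sum>b\<in>B. d b *\<^sub>R b)" using B by blast
    have "x = (\<Sum>b\<in>A. c b *\<^sub>R (b, 0)) + (\<Sum>b\<in>B. d b *\<^sub>R (0, b))"
      by (rule prod_eqI) (simp_all add: fst_sum snd_sum c d)
    also have "\<dots> \<in> span ?C"
      by (intro span_add span_sum span_scale span_base) auto
    finally show ?thesis .
  qed
  then show "\<exists>C::('a \<times> 'b) set. finite C \<and> (\<forall>x. \<exists>c. x = (\<Sum>b\<in>C. c b *\<^sub>R b))"
    using fin by (intro exI[of _ ?C]) (auto simp: span_finite image_iff)
qed

text \<open>The spanning set granted by the class need not be independent. One basis is fixed per
  type, so that coordinates are honest linear functionals, in dimension 0 as well.\<close>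

definition fin_basis :: "'a::finite_dim_normed set" where
  "fin_basis = (SOME B. finite B \<and> independent B \<and> span B = UNIV)"

lemma fin_basis:
  "finite (fin_basis :: 'a::finite_dim_normed set)"
  "independent (fin_basis :: 'a set)" "span (fin_basis :: 'a set) = UNIV"
proof -
  obtain A :: "'a set" where A: "finite A" "\<And>x. \<exists>c. x = (\<Sum>b\<in>A. c b *\<^sub>R b)"
    using finite_dimensional by blast
  have "span A = UNIV" using A by (auto simp: span_finite image_iff)
  moreover obtain B where "B \<subseteq> A" "independent B" "A \<subseteq> span B"
    using maximal_independent_subset[of A] by blast
  ultimately have "finite B \<and> independent B \<and> span B = UNIV"
    using A(1) finite_subset span_minimal[OF \<open>A \<subseteq> span B\<close>] by auto
  then show "finite (fin_basis :: 'a set)" "independent (fin_basis :: 'a set)"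
      "span (fin_basis :: 'a set) = UNIV"
    unfolding fin_basis_def by (metis (mono_tags, lifting) someI_ex)+
qed

definition coord :: "'a::finite_dim_normed \<Rightarrow> 'a \<Rightarrow> real" where
  "coord b x = representation fin_basis x b"

lemma coord_expansion: "x = (\<Sum>b\<in>fin_basis. coord b x *\<^sub>R b)"
  unfolding coord_def
  by (rule sum_representation_eq[symmetric]) (use fin_basis in auto)

section \<open>Equivalence of norms and continuity of linear maps\<close>

text \<open>Coefficient vectors are functions on the whole type, pinned to 0 off \<open>B\<close>.
  The set is a product of compact intervals and points, so Tychonoff gives compactness even when the
  index type is infinite.\<close>

lemma compact_coefficient_box:
  fixes B :: "'a set"
  shows "compact {c :: 'a \<Rightarrow> real. \<forall>b. c b \<in> (if b \<in> B then {-1..1} else {0})}"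
proof -
  have "compactin (product_topology (\<lambda>_::'a. euclidean :: real topology) UNIV)
          (PiE UNIV (\<lambda>b. if b \<in> B then {-1..1} else {0}))"
    by (subst compactin_PiE) auto
  then show ?thesis
    by (simp add: euclidean_product_topology PiE_def Pi_def)
qed

text \<open>The norm has a minimum on the unit sphere of the sum norm of the coefficients,
  independence makes it positive, and scaling carries the bound to all coefficients. This is the
  equivalence of norms in finite dimension, and it makes coordinates continuous.\<close>

lemma coefficient_norm_bound:
  fixes B :: "'a::real_normed_vector set"
  assumes "finite B" "independent B"
  shows "\<exists>m>0. \<forall>c. m * (\<Sum>b\<in>B. \<bar>c b\<bar>) \<le> norm (\<Sum>b\<in>B. c b *\<^sub>R b)"
proof (cases "B = {}")
  case True
  then show ?thesis by (auto intro: exI[of _ 1])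
next
  case False
  define K where "K = {c :: 'a \<Rightarrow> real. \<forall>b. c b \<in> (if b \<in> B then {-1..1} else {0})}
      \<inter> {c. (\<Sum>b\<in>B. \<bar>c b\<bar>) = 1}"
  have "closed {c :: 'a \<Rightarrow> real. (\<Sum>b\<in>B. \<bar>c b\<bar>) = 1}"
    by (intro closed_Collect_eq continuous_intros continuous_on_product_coordinates)
  then have K: "compact K"
    unfolding K_def by (rule compact_Int_closed[OF compact_coefficient_box])
  obtain b0 where b0: "b0 \<in> B" using False by auto
  have "(\<lambda>b. if b = b0 then 1 else 0) \<in> K"
    unfolding K_def using b0 assms by (auto simp: if_distrib[of abs] cong: if_cong)
  then have "K \<noteq> {}" by blast
  moreover have "continuous_on K (\<lambda>c. norm (\<Sum>b\<in>B. c b *\<^sub>R b))"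
    by (intro continuous_intros continuous_on_subset[OF continuous_on_product_coordinates]) auto
  ultimately obtain c0 where c0: "c0 \<in> K"
      "\<And>c. c \<in> K \<Longrightarrow> norm (\<Sum>b\<in>B. c0 b *\<^sub>R b) \<le> norm (\<Sum>b\<in>B. c b *\<^sub>R b)"
    using continuous_attains_inf[OF K] by blast
  define m where "m = norm (\<Sum>b\<in>B. c0 b *\<^sub>R b)"
  have "(\<Sum>b\<in>B. c0 b *\<^sub>R b) \<noteq> 0"
  proof
    assume "(\<Sum>b\<in>B. c0 b *\<^sub>R b) = 0"
    then have "\<forall>b\<in>B. c0 b = 0" using assms independentD by blast
    then show False using c0(1) by (auto simp: K_def)
  qed
  then have m: "m > 0" by (simp add: m_def)
  have "m * (\<Sum>b\<in>B. \<bar>c b\<bar>) \<le> norm (\<Sum>b\<in>B. c b *\<^sub>R b)" for c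
  proof (cases "(\<Sum>b\<in>B. \<bar>c b\<bar>) = 0")
    case False
    define s where "s = (\<Sum>b\<in>B. \<bar>c b\<bar>)"
    have s: "s > 0" using False unfolding s_def by (simp add: order_less_le sum_nonneg)
    \<comment> \<open>Membership in \<open>K\<close> requires the value 0 off \<open>B\<close>,
      where \<open>c\<close> is arbitrary.\<close>
    define d where "d b = (if b \<in> B then c b / s else 0)" for b
    have ds: "(\<Sum>b\<in>B. \<bar>d b\<bar>) = 1"
      using s by (simp add: d_def abs_divide s_def flip: sum_divide_distrib)
    have "\<bar>d b\<bar> \<le> 1" if "b \<in> B" for b
      using member_le_sum[of b B "\<lambda>b. \<bar>d b\<bar>"] assms(1) that ds by auto
    then have "\<forall>b\<in>B. -1 \<le> d b \<and> d b \<le> 1" by (auto simp: abs_le_iff minus_le_iff)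
    moreover have "\<forall>b. b \<notin> B \<longrightarrow> d b = 0" by (simp add: d_def)
    ultimately have "d \<in> K" using ds by (auto simp: K_def)
    then have "m \<le> norm (\<Sum>b\<in>B. d b *\<^sub>R b)" using c0 m_def by auto
    also have "(\<Sum>b\<in>B. d b *\<^sub>R b) = (1 / s) *\<^sub>R (\<Sum>b\<in>B. c b *\<^sub>R b)"
      by (simp add: d_def scaleR_sum_right)
    finally show ?thesis using s by (simp add: s_def[symmetric] field_simps)
  qed simp
  then show ?thesis using m by blast
qed

lemma linear_coord: "linear (coord b)"
  unfolding coord_def
  by (intro linearI) (simp_all add: representation_add representation_scale fin_basis)

lemma bounded_linear_coord: "bounded_linear (coord b)"
proof (cases "b \<in> fin_basis")
  case True
  obtain m where m: "m > 0"
    "\<And>c. m * (\<Sum>b\<in>fin_basis. \<bar>c b\<bar>) \<le> norm (\<Sum>b\<in>fin_basis. c b *\<^sub>R (b::'a))"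
    using coefficient_norm_bound[OF fin_basis(1,2)] by blast
  have "\<bar>coord b x\<bar> \<le> norm x * (1 / m)" for x
  proof -
    have "\<bar>coord b x\<bar> \<le> (\<Sum>b\<in>fin_basis. \<bar>coord b x\<bar>)"
      using member_le_sum[of b fin_basis "\<lambda>b. \<bar>coord b x\<bar>"] fin_basis(1) True by auto
    then have "m * \<bar>coord b x\<bar> \<le> norm x"
      using m(2)[of "\<lambda>b. coord b x"] m(1) coord_expansion[of x]
      by (metis mult_le_cancel_left_pos order_trans)
    then show ?thesis using m(1) by (simp add: field_simps)
  qed
  then show ?thesis
    by (intro bounded_linear_intro[of _ "1 / m"])
      (simp_all add: linear_add linear_scale linear_coord)
next
  case False
  have "coord b = (\<lambda>x. 0)"
    unfolding coord_def using False representation_ne_zero by (metis)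
  then show ?thesis by (simp add: bounded_linear_zero)
qed

lemma linear_coord_expansion:
  fixes f :: "'a::finite_dim_normed \<Rightarrow> 'b::real_vector"
  assumes "linear f"
  shows "f x = (\<Sum>b\<in>fin_basis. coord b x *\<^sub>R f b)"
  by (subst coord_expansion[of x]) (simp add: linear_sum linear_scale assms)

text \<open>Finite dimension of the domain suffices: the map is a finite sum of continuous
  coordinates times fixed vectors. From here on \<open>linear\<close> is enough wherever a bounded
  map on such a space is called for.\<close>

lemma linear_imp_bounded_linear:
  fixes f :: "'a::finite_dim_normed \<Rightarrow> 'b::real_normed_vector"
  assumes "linear f"
  shows "bounded_linear f"
  by (subst linear_coord_expansion[OF assms, abs_def])
    (intro bounded_linear_sum bounded_linear_scaleR_const bounded_linear_coord)

lemma finite_dimensional_vector_space_fin_basis: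
  "finite_dimensional_vector_space scaleR (fin_basis :: 'a::finite_dim_normed set)"
  by unfold_locales (use fin_basis in \<open>auto simp: dependent_raw_def span_raw_def\<close>)

section \<open>Calculus of smooth functions\<close>

text \<open>Openness is essential: the derivative at a point of \<open>S\<close> sees the function
  on a neighbourhood, and the recursion passes to the derivatives on \<open>S\<close>.\<close>

lemma higher_differentiable_on_cong:
  assumes "open S" "\<And>x. x \<in> S \<Longrightarrow> f x = g x"
  shows "higher_differentiable_on n S f \<longleftrightarrow> higher_differentiable_on n S g"
  using assms(2)
proof (induction n arbitrary: f g)
  case 0
  then show ?case by (simp cong: continuous_on_cong)
next
  case (Suc n)
  have *: "f differentiable (at x) \<longleftrightarrow> g differentiable (at x)"
    "frechet_derivative f (at x) = frechet_derivative g (at x)" if "x \<in> S" for x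
  proof -
    have "(f has_derivative D) (at x) \<longleftrightarrow> (g has_derivative D) (at x)" for D
      using has_derivative_transform_within_open[OF _ assms(1) that] Suc.prems by metis
    then show "f differentiable (at x) \<longleftrightarrow> g differentiable (at x)"
      "frechet_derivative f (at x) = frechet_derivative g (at x)"
      unfolding differentiable_def frechet_derivative_def by auto
  qed
  then have "higher_differentiable_on n S (\<lambda>x. frechet_derivative f (at x) v) \<longleftrightarrow>
      higher_differentiable_on n S (\<lambda>x. frechet_derivative g (at x) v)" for v
    by (intro Suc.IH) simp
  then show ?case using * by simp
qed

lemma smooth_on_cong:
  assumes "open S" "\<And>x. x \<in> S \<Longrightarrow> f x = g x"
  shows "smooth_on S f \<longleftrightarrow> smooth_on S g"
  using higher_differentiable_on_cong[OF assms] by (auto simp: smooth_on_def)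

lemma higher_differentiable_on_subset:
  "higher_differentiable_on n S f \<Longrightarrow> T \<subseteq> S \<Longrightarrow> higher_differentiable_on n T f"
  by (induction n arbitrary: f) (auto intro: continuous_on_subset)

lemma smooth_on_subset: "smooth_on S f \<Longrightarrow> T \<subseteq> S \<Longrightarrow> smooth_on T f"
  by (auto simp: smooth_on_def intro: higher_differentiable_on_subset)

lemma higher_differentiable_on_Suc_imp:
  "higher_differentiable_on (Suc n) S f \<Longrightarrow> higher_differentiable_on n S f"
proof (induction n arbitrary: f)
  case 0
  then show ?case
    by (auto intro!: continuous_at_imp_continuous_on differentiable_imp_continuous_within)
next
  case (Suc n)
  then show ?case by (metis higher_differentiable_on.simps(2))
qed

lemma higher_differentiable_on_local:
  assumes "\<And>x. x \<in> S \<Longrightarrow> \<exists>T. open T \<and> x \<in> T \<and> higher_differentiable_on n T f"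
  shows "higher_differentiable_on n S f"
  using assms
proof (induction n arbitrary: f)
  case 0
  then show ?case
    by (force intro!: continuous_at_imp_continuous_on simp: continuous_on_eq_continuous_at)
next
  case (Suc n)
  have "higher_differentiable_on n S (\<lambda>x. frechet_derivative f (at x) v)" for v
  proof (rule Suc.IH)
    fix x assume "x \<in> S"
    then obtain T where "open T" "x \<in> T" "higher_differentiable_on (Suc n) T f"
      using Suc.prems by blast
    then show "\<exists>T. open T \<and> x \<in> T \<and>
        higher_differentiable_on n T (\<lambda>x. frechet_derivative f (at x) v)"
      by (intro exI[of _ T]) simp
  qed
  moreover have "f differentiable (at x)" if "x \<in> S" for x
    using Suc.prems[OF that] unfolding higher_differentiable_on.simps by blast
  ultimately show ?case by simp
qed

lemma smooth_on_local:
  assumes "\<And>x. x \<in> S \<Longrightarrow> \<exists>T. open T \<and> x \<in> T \<and> smooth_on T f"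
  shows "smooth_on S f"
  unfolding smooth_on_def
  by (intro allI higher_differentiable_on_local) (use assms in \<open>force simp: smooth_on_def\<close>)

lemma smooth_on_imp_continuous_on: "smooth_on S f \<Longrightarrow> continuous_on S f"
  by (metis smooth_on_def higher_differentiable_on.simps(1))

lemma smooth_on_imp_differentiable: "smooth_on S f \<Longrightarrow> x \<in> S \<Longrightarrow> f differentiable (at x)"
  by (metis smooth_on_def higher_differentiable_on.simps(2))

lemma smooth_on_has_derivative:
  "smooth_on S f \<Longrightarrow> x \<in> S \<Longrightarrow> (f has_derivative frechet_derivative f (at x)) (at x)"
  using frechet_derivative_works smooth_on_imp_differentiable by blast

lemma smooth_on_frechet_derivative:
  "smooth_on S f \<Longrightarrow> smooth_on S (\<lambda>x. frechet_derivative f (at x) v)"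
  by (metis smooth_on_def higher_differentiable_on.simps(2))

text \<open>Frees inductions from the chosen term \<open>frechet_derivative\<close>: any family
  \<open>D\<close> known to be the derivative may be used. Openness of \<open>S\<close> lets the
  agreement of the two pass to higher derivatives.\<close>

lemma higher_differentiable_on_SucI:
  assumes "open S" "\<And>x. x \<in> S \<Longrightarrow> (f has_derivative D x) (at x)"
    "\<And>v. higher_differentiable_on n S (\<lambda>x. D x v)"
  shows "higher_differentiable_on (Suc n) S f"
proof -
  have "frechet_derivative f (at x) = D x" if "x \<in> S" for x
    using frechet_derivative_at[OF assms(2)[OF that]] by simp
  then have "higher_differentiable_on n S (\<lambda>x. frechet_derivative f (at x) v)" for v
    using assms(3)[of v]
    by (subst higher_differentiable_on_cong[OF assms(1), where g="\<lambda>x. D x v"]) simp_all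
  then show ?thesis using assms(2) by (auto simp: differentiable_def)
qed

lemma higher_differentiable_on_const: "higher_differentiable_on n S (\<lambda>x. c)"
proof (induction n arbitrary: c)
  case (Suc n)
  have "frechet_derivative (\<lambda>x. c) (at x) = (\<lambda>h. 0)" for x :: 'a
    using frechet_derivative_at[OF has_derivative_const[of c "at x"]] by simp
  then show ?case using Suc by simp
qed simp

lemma higher_differentiable_on_bounded_linear:
  assumes "bounded_linear f"
  shows "higher_differentiable_on n S f"
proof (cases n)
  case 0
  then show ?thesis using assms by (auto intro: linear_continuous_on)
next
  case (Suc m)
  have "higher_differentiable_on (Suc m) UNIV f"
    by (rule higher_differentiable_on_SucI[where D="\<lambda>_. f"])
      (auto intro: bounded_linear_imp_has_derivative assms higher_differentiable_on_const)
  then show ?thesis using Suc higher_differentiable_on_subset by blast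
qed

lemma higher_differentiable_on_add:
  assumes "open S" "higher_differentiable_on n S f" "higher_differentiable_on n S g"
  shows "higher_differentiable_on n S (\<lambda>x. f x + g x)"
  using assms(2,3)
proof (induction n arbitrary: f g)
  case 0
  then show ?case by (auto intro: continuous_on_add)
next
  case (Suc n)
  show ?case
    using Suc assms(1)
    by (intro higher_differentiable_on_SucI[where
          D="\<lambda>x v. frechet_derivative f (at x) v + frechet_derivative g (at x) v"])
      (auto intro!: has_derivative_add simp flip: frechet_derivative_works)
qed

lemma higher_differentiable_on_sum:
  assumes "open S" "\<And>i. i \<in> I \<Longrightarrow> higher_differentiable_on n S (f i)"
  shows "higher_differentiable_on n S (\<lambda>x. \<Sum>i\<in>I. f i x)"
  using assms(2)
  by (induction I rule: infinite_finite_induct)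
    (auto intro: higher_differentiable_on_const higher_differentiable_on_add assms(1))

lemma (in bounded_bilinear) higher_differentiable_on:
  assumes "open S" "higher_differentiable_on n S f" "higher_differentiable_on n S g"
  shows "higher_differentiable_on n S (\<lambda>x. prod (f x) (g x))"
  using assms(2,3)
proof (induction n arbitrary: f g)
  case 0
  then show ?case by (auto intro: continuous_on)
next
  case (Suc n)
  have "higher_differentiable_on n S f" "higher_differentiable_on n S g"
    using Suc.prems higher_differentiable_on_Suc_imp by blast+
  then show ?case
    using Suc assms(1)
    by (intro higher_differentiable_on_SucI[where
          D="\<lambda>x v. prod (f x) (frechet_derivative g (at x) v) + prod (frechet_derivative f (at x) v) (g x)"])
      (auto intro!: FDERIV higher_differentiable_on_add simp flip: frechet_derivative_works)
qed

lemma higher_differentiable_on_bounded_linear_compose: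
  assumes "open S" "bounded_linear L" "higher_differentiable_on n S f"
  shows "higher_differentiable_on n S (\<lambda>x. L (f x))"
  using assms(3)
proof (induction n arbitrary: f)
  case 0
  then show ?case using assms(2) by (auto intro: bounded_linear.continuous_on)
next
  case (Suc n)
  show ?case
    using Suc assms(1,2)
    by (intro higher_differentiable_on_SucI[where D="\<lambda>x v. L (frechet_derivative f (at x) v)"])
      (auto intro!: bounded_linear.has_derivative[OF assms(2)] simp flip: frechet_derivative_works)
qed

text \<open>The chain rule applies the derivative of \<open>g\<close> to a moving vector, while the
  induction hypothesis covers derivatives in constant directions only. Expanding the moving vector
  in a basis of the middle space gives sums of products to which the hypothesis applies.\<close>

lemma higher_differentiable_on_compose:
  fixes f :: "'a::real_normed_vector \<Rightarrow> 'b::finite_dim_normed" and g :: "'b \<Rightarrow> 'c::real_normed_vector"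
  assumes "open S" "open T" "higher_differentiable_on n S f" "higher_differentiable_on n T g"
    "\<And>x. x \<in> S \<Longrightarrow> f x \<in> T"
  shows "higher_differentiable_on n S (\<lambda>x. g (f x))"
  using assms(3,4)
proof (induction n arbitrary: g)
  case 0
  then show ?case using assms(5)
    by (auto intro!: continuous_on_compose2[of T g S f])
next
  case (Suc n)
  define f' where "f' x = frechet_derivative f (at x)" for x
  define g' where "g' x = frechet_derivative g (at x)" for x
  have f': "(f has_derivative f' x) (at x)" if "x \<in> S" for x
    using Suc.prems that by (auto simp: f'_def simp flip: frechet_derivative_works)
  have g': "(g has_derivative g' x) (at x)" if "x \<in> T" for x
    using Suc.prems that by (auto simp: g'_def simp flip: frechet_derivative_works)
  have "higher_differentiable_on (Suc n) S (\<lambda>x. g (f x))"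
  proof (rule higher_differentiable_on_SucI[OF assms(1)])
    fix x assume x: "x \<in> S"
    have "linear (g' (f x))" using g'[OF assms(5)[OF x]] has_derivative_linear by blast
    then have "(\<lambda>v. g' (f x) (f' x v)) = (\<lambda>v. \<Sum>b\<in>fin_basis. coord b (f' x v) *\<^sub>R g' (f x) b)"
      using linear_coord_expansion by blast
    then show "((\<lambda>x. g (f x)) has_derivative
        (\<lambda>v. \<Sum>b\<in>fin_basis. coord b (f' x v) *\<^sub>R g' (f x) b)) (at x)"
      using has_derivative_compose[OF f'[OF x] g'[OF assms(5)[OF x]]] by simp
  next
    fix v
    have "higher_differentiable_on n S (\<lambda>x. f' x v)"
      using Suc.prems by (simp add: f'_def)
    then have "higher_differentiable_on n S (\<lambda>x. coord b (f' x v))" for b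
      by (rule higher_differentiable_on_bounded_linear_compose[OF assms(1) bounded_linear_coord])
    moreover have "higher_differentiable_on n S (\<lambda>x. g' (f x) b)" for b
      using Suc.prems higher_differentiable_on_Suc_imp[OF Suc.prems(1)]
      by (intro Suc.IH) (simp_all add: g'_def)
    ultimately show "higher_differentiable_on n S
        (\<lambda>x. \<Sum>b\<in>fin_basis. coord b (f' x v) *\<^sub>R g' (f x) b)"
      by (intro higher_differentiable_on_sum assms(1)
          bounded_bilinear.higher_differentiable_on[OF bounded_bilinear_scaleR])
  qed
  then show ?case .
qed

lemma smooth_on_const: "smooth_on S (\<lambda>x. c)"
  by (simp add: smooth_on_def higher_differentiable_on_const)

lemma smooth_on_bounded_linear: "bounded_linear f \<Longrightarrow> smooth_on S f"
  by (simp add: smooth_on_def higher_differentiable_on_bounded_linear)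

lemma smooth_on_bounded_linear_compose:
  "open S \<Longrightarrow> bounded_linear L \<Longrightarrow> smooth_on S f \<Longrightarrow> smooth_on S (\<lambda>x. L (f x))"
  by (simp add: smooth_on_def higher_differentiable_on_bounded_linear_compose)

lemma smooth_on_add:
  "open S \<Longrightarrow> smooth_on S f \<Longrightarrow> smooth_on S g \<Longrightarrow> smooth_on S (\<lambda>x. f x + g x)"
  by (simp add: smooth_on_def higher_differentiable_on_add)

lemma smooth_on_scaleR:
  "open S \<Longrightarrow> smooth_on S f \<Longrightarrow> smooth_on S g \<Longrightarrow> smooth_on S (\<lambda>x. f x *\<^sub>R g x)"
  by (simp add: smooth_on_def bounded_bilinear.higher_differentiable_on[OF bounded_bilinear_scaleR])

lemma smooth_on_Pair:
  assumes "open S" "smooth_on S f" "smooth_on S g"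
  shows "smooth_on S (\<lambda>x. (f x, g x))"
proof -
  have "smooth_on S (\<lambda>x. (f x, 0) + (0, g x))"
    by (intro smooth_on_add assms smooth_on_bounded_linear_compose[OF assms(1) _ assms(2)]
        smooth_on_bounded_linear_compose[OF assms(1) _ assms(3)]
        bounded_linear_Pair bounded_linear_ident bounded_linear_zero)
  then show ?thesis by simp
qed

lemma smooth_on_compose:
  fixes f :: "'a::real_normed_vector \<Rightarrow> 'b::finite_dim_normed" and g :: "'b \<Rightarrow> 'c::real_normed_vector"
  assumes "open S" "open T" "smooth_on S f" "smooth_on T g" "\<And>x. x \<in> S \<Longrightarrow> f x \<in> T"
  shows "smooth_on S (\<lambda>x. g (f x))"
  using assms by (simp add: smooth_on_def higher_differentiable_on_compose)

section \<open>Smooth inversion of a family of linear isomorphisms\<close>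

text \<open>A product rule with one factor merely continuous: since both factors vanish at
  \<open>x\<close>, the product is of smaller order than the increment. It serves where
  differentiability of the scalar factor is still to be shown.\<close>

lemma has_derivative_scaleR_vanishing:
  fixes f :: "'a::real_normed_vector \<Rightarrow> 'b::real_normed_vector" and g :: "'a \<Rightarrow> real"
  assumes f: "(f has_derivative f') (at x)" "f x = 0" and g: "isCont g x" "g x = 0"
  shows "((\<lambda>y. g y *\<^sub>R f y) has_derivative (\<lambda>_. 0)) (at x)"
  unfolding has_derivative_at_alt
proof (intro conjI allI impI)
  fix e :: real assume e: "e > 0"
  obtain K where K: "K > 0" "\<And>v. norm (f' v) \<le> norm v * K"
    using bounded_linear.pos_bounded[OF has_derivative_bounded_linear[OF f(1)]] by blast
  obtain d1 where d1: "d1 > 0"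
    "\<And>y. norm (y - x) < d1 \<Longrightarrow> norm (f y - f x - f' (y - x)) \<le> 1 * norm (y - x)"
    using f(1) unfolding has_derivative_at_alt by (metis zero_less_one)
  \<comment> \<open>\<open>f y\<close> is at most \<open>K + 1\<close> times the increment, where
    \<open>K\<close> bounds the derivative and the extra 1 is the error allowed in
    \<open>d1\<close>; hence this bound on \<open>g\<close>.\<close>
  obtain d2 where d2: "d2 > 0" "\<And>y. dist y x < d2 \<Longrightarrow> dist (g y) (g x) < e / (K + 1)"
    using g(1) e K unfolding continuous_at_eps_delta by (metis add_pos_pos divide_pos_pos zero_less_one)
  have "norm (g y *\<^sub>R f y - g x *\<^sub>R f x - 0) \<le> e * norm (y - x)"
    if y: "norm (y - x) < min d1 d2" for y
  proof -
    have "norm (f y) \<le> norm (f y - f' (y - x)) + norm (f' (y - x))"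
      by (metis diff_add_cancel norm_triangle_ineq)
    also have "\<dots> \<le> (K + 1) * norm (y - x)"
      using d1(2)[of y] K(2)[of "y - x"] y f(2) by (simp add: algebra_simps)
    finally have 1: "norm (f y) \<le> (K + 1) * norm (y - x)" .
    have 2: "\<bar>g y\<bar> \<le> e / (K + 1)"
      using d2(2)[of y] y g(2) by (simp add: dist_norm)
    have "\<bar>g y\<bar> * norm (f y) \<le> e / (K + 1) * ((K + 1) * norm (y - x))"
      by (rule mult_mono[OF 2 1]) (use e K in auto)
    then show ?thesis using K f(2) by simp
  qed
  then show "\<exists>d>0. \<forall>y. norm (y - x) < d \<longrightarrow>
      norm (g y *\<^sub>R f y - g x *\<^sub>R f x - 0) \<le> e * norm (y - x)"
    using d1(1) d2(1) by (intro exI[of _ "min d1 d2"]) auto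
qed (simp add: bounded_linear_zero)

lemma linear_inv:
  assumes "linear f" "bij f"
  shows "linear (inv_into UNIV f)"
proof (rule linearI)
  show "inv_into UNIV f (x + y) = inv_into UNIV f x + inv_into UNIV f y" for x y
    using assms by (intro inv_f_eq) (auto simp: linear_add bij_is_inj surj_f_inv_f bij_is_surj)
  show "inv_into UNIV f (c *\<^sub>R x) = c *\<^sub>R inv_into UNIV f x" for c x
    using assms by (intro inv_f_eq) (auto simp: linear_scale bij_is_inj surj_f_inv_f bij_is_surj)
qed

text \<open>Coordinates bound the difference of \<open>K y\<close> and \<open>K y0\<close> by its
  values on finitely many basis vectors, which are small near \<open>y0\<close>. The inverse at
  \<open>y0\<close> then absorbs the perturbation, so the inverses near \<open>y0\<close> have a
  common bound.\<close>

lemma linear_family_lower_bound: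
  fixes K :: "'a::real_normed_vector \<Rightarrow> 'b::finite_dim_normed \<Rightarrow> 'c::finite_dim_normed"
  assumes "open S" "y0 \<in> S" and lin: "\<And>y. y \<in> S \<Longrightarrow> linear (K y)" and "bij (K y0)"
    and cont: "\<And>w. continuous_on S (\<lambda>y. K y w)"
  shows "\<exists>C>0. \<forall>\<^sub>F y in nhds y0. \<forall>w. norm w \<le> C * norm (K y w)"
proof -
  have "linear (inv_into UNIV (K y0))"
    using lin[OF assms(2)] assms(4) by (rule linear_inv)
  then obtain C where C: "C > 0" "\<And>v. norm (inv_into UNIV (K y0) v) \<le> norm v * C"
    using bounded_linear.pos_bounded[OF linear_imp_bounded_linear] by blast
  have "\<exists>M. \<forall>w. \<bar>coord b w\<bar> \<le> norm w * M" for b :: 'b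
    using bounded_linear.bounded[OF bounded_linear_coord[of b]] by auto
  then obtain M where M: "\<And>b w. \<bar>coord (b::'b) w\<bar> \<le> norm w * M b" by metis
  define \<delta> where "\<delta> y = (\<Sum>b\<in>fin_basis. M b * norm (K y b - K y0 b))" for y
  have "((\<lambda>y. K y b) \<longlongrightarrow> K y0 b) (nhds y0)" for b
    using continuous_on_eq_continuous_at[OF assms(1), of "\<lambda>y. K y b"] cont[of b] assms(2)
    by (simp add: isCont_def tendsto_nhds_iff)
  then have "(\<delta> \<longlongrightarrow> (\<Sum>b\<in>fin_basis. M b * norm (K y0 b - K y0 b))) (nhds y0)"
    unfolding \<delta>_def by (intro tendsto_intros)
  \<comment> \<open>At this threshold the perturbation costs at most half of \<open>norm w\<close>,
    which is why the final constant is \<open>2 * C\<close>.\<close>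
  then have "\<forall>\<^sub>F y in nhds y0. \<delta> y < 1 / (2 * C)"
    using C(1) by (intro order_tendstoD(2)) auto
  moreover have "\<forall>\<^sub>F y in nhds y0. y \<in> S"
    using assms(1,2) by (rule eventually_nhds_in_open)
  ultimately have "\<forall>\<^sub>F y in nhds y0. \<forall>w. norm w \<le> 2 * C * norm (K y w)"
  proof eventually_elim
    case (elim y)
    show ?case
    proof
      fix w
      have "linear (\<lambda>w. K y w - K y0 w)"
        using lin[OF elim(2)] lin[OF assms(2)] by (intro linear_compose_sub)
      then have "K y w - K y0 w = (\<Sum>b\<in>fin_basis. coord b w *\<^sub>R (K y b - K y0 b))"
        by (rule linear_coord_expansion)
      also have "norm \<dots> \<le> (\<Sum>b\<in>fin_basis. norm w * (M b * norm (K y b - K y0 b)))"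
        using M by (intro sum_norm_le) (simp add: mult_right_mono flip: mult.assoc)
      also have "\<dots> = norm w * \<delta> y" by (simp add: \<delta>_def sum_distrib_left)
      also have "\<dots> \<le> norm w * (1 / (2 * C))" using elim(1) by (intro mult_left_mono) auto
      finally have 1: "norm (K y w - K y0 w) \<le> norm w * (1 / (2 * C))" .
      have "norm w \<le> norm (K y0 w) * C"
        using C(2)[of "K y0 w"] assms(4) by (simp add: bij_is_inj)
      also have "norm (K y0 w) \<le> norm (K y w) + norm (K y w - K y0 w)"
        by (metis norm_triangle_sub norm_minus_commute)
      finally have "norm w \<le> (norm (K y w) + norm w * (1 / (2 * C))) * C"
        using 1 C(1) by (smt (verit) mult_right_mono)
      then show "norm w \<le> 2 * C * norm (K y w)" using C(1) by (simp add: field_simps)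
    qed
  qed
  then show ?thesis using C(1) by (intro exI[of _ "2 * C"]) auto
qed

text \<open>For \<open>Z y = (K y)\<^sup>-\<^sup>1 z\<close> the proof expands
  \<open>Z y = Z y0 + (K y0)\<^sup>-\<^sup>1 (z - K y (Z y0)) + (K y0)\<^sup>-\<^sup>1 ((K y0 - K y) (Z y - Z y0))\<close>; the last
  summand is a product of two quantities vanishing at \<open>y0\<close>, so it does not contribute.\<close>

lemma has_derivative_linear_inverse:
  fixes K :: "'a::real_normed_vector \<Rightarrow> 'b::finite_dim_normed \<Rightarrow> 'c::finite_dim_normed"
  assumes S: "open S" "y0 \<in> S" and K: "\<And>y. y \<in> S \<Longrightarrow> linear (K y) \<and> bij (K y)"
    and K': "\<And>w y. y \<in> S \<Longrightarrow> ((\<lambda>y. K y w) has_derivative K' w y) (at y)"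
  shows "((\<lambda>y. inv_into UNIV (K y) z) has_derivative
    (\<lambda>v. - inv_into UNIV (K y0) (\<Sum>b\<in>fin_basis. coord b (inv_into UNIV (K y0) z) *\<^sub>R K' b y0 v))) (at y0)"
proof -
  define Z where "Z y = inv_into UNIV (K y) z" for y
  have KZ: "K y (Z y) = z" if "y \<in> S" for y
    unfolding Z_def using K[OF that] by (simp add: bij_is_surj surj_f_inv_f)
  have cont: "continuous_on S (\<lambda>y. K y w)" for w
    using K' by (auto intro!: continuous_at_imp_continuous_on has_derivative_continuous)
  obtain C where C: "C > 0" "\<forall>\<^sub>F y in nhds y0. \<forall>w. norm w \<le> C * norm (K y w)"
    using linear_family_lower_bound[OF S, of K] K S cont by blast
  have near: "\<forall>\<^sub>F y in nhds y0. y \<in> S" using S by (rule eventually_nhds_in_open)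
  \<comment> \<open>Continuity of \<open>Z\<close> at \<open>y0\<close> precedes differentiability:
    \<open>K y\<close> sends \<open>Z y - Z y0\<close> to \<open>z - K y (Z y0)\<close>, which tends
    to 0, and the uniform lower bound passes this on to \<open>Z\<close>.\<close>
  have "isCont (\<lambda>y. K y (Z y0)) y0"
    using K' S by (blast intro: has_derivative_continuous)
  then have "((\<lambda>y. C * norm (z - K y (Z y0))) \<longlongrightarrow> C * norm (z - K y0 (Z y0))) (at y0)"
    unfolding isCont_def by (intro tendsto_intros)
  then have "((\<lambda>y. C * norm (z - K y (Z y0))) \<longlongrightarrow> 0) (at y0)"
    by (simp add: KZ S)
  moreover have "\<forall>\<^sub>F y in at y0. norm (Z y - Z y0) \<le> C * norm (z - K y (Z y0))"
    unfolding eventually_at_filter using C(2) near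
  proof eventually_elim
    case (elim y)
    have "K y (Z y - Z y0) = z - K y (Z y0)"
      using elim K KZ by (simp add: linear_diff)
    then show ?case using elim by metis
  qed
  ultimately have "((\<lambda>y. Z y - Z y0) \<longlongrightarrow> 0) (at y0)"
    by (rule Lim_null_comparison[rotated])
  then have contZ: "isCont Z y0" by (simp add: isCont_def LIM_zero_iff)
  have lin0: "bounded_linear (inv_into UNIV (K y0))"
    using K S by (intro linear_imp_bounded_linear linear_inv) auto
  \<comment> \<open>The last part is split along coordinates of \<open>Z y - Z y0\<close>, so that
    each summand is a scalar times a vector and \<open>has_derivative_scaleR_vanishing\<close>
    applies.\<close>
  have d1: "((\<lambda>y. Z y0 + inv_into UNIV (K y0) (z - (\<Sum>b\<in>fin_basis. coord b (Z y0) *\<^sub>R K y b))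
      + (\<Sum>b\<in>fin_basis. coord b (Z y - Z y0) *\<^sub>R inv_into UNIV (K y0) (K y0 b - K y b))) has_derivative
    (\<lambda>v. 0 + inv_into UNIV (K y0) (0 - (\<Sum>b\<in>fin_basis. coord b (Z y0) *\<^sub>R K' b y0 v))
      + (\<Sum>b\<in>(fin_basis::'b set). 0))) (at y0)"
  proof (intro has_derivative_add has_derivative_const bounded_linear.has_derivative[OF lin0]
      has_derivative_diff has_derivative_sum has_derivative_scaleR_right)
    fix b :: 'b
    show "((\<lambda>y. K y b) has_derivative K' b y0) (at y0)"
      using K' S by blast
    have "isCont (\<lambda>y. coord b (Z y - Z y0)) y0"
      by (intro bounded_linear.isCont[OF bounded_linear_coord] continuous_intros contZ)
    moreover have "((\<lambda>y. inv_into UNIV (K y0) (K y0 b - K y b)) has_derivative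
        (\<lambda>v. inv_into UNIV (K y0) (0 - K' b y0 v))) (at y0)"
      using K' S
      by (intro bounded_linear.has_derivative[OF lin0] has_derivative_diff has_derivative_const) auto
    ultimately show "((\<lambda>y. coord b (Z y - Z y0) *\<^sub>R inv_into UNIV (K y0) (K y0 b - K y b))
        has_derivative (\<lambda>v. 0)) (at y0)"
      by (intro has_derivative_scaleR_vanishing)
        (auto simp: linear_0 linear_coord linear_0[OF bounded_linear.linear[OF lin0]])
  qed
  have "((\<lambda>y. Z y) has_derivative
    (\<lambda>v. 0 + inv_into UNIV (K y0) (0 - (\<Sum>b\<in>fin_basis. coord b (Z y0) *\<^sub>R K' b y0 v))
      + (\<Sum>b\<in>(fin_basis::'b set). 0))) (at y0)"
  proof (rule has_derivative_transform_within_open[OF d1 S])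
    fix y assume y: "y \<in> S"
    note li = bounded_linear.linear[OF lin0]
    have "(\<Sum>b\<in>fin_basis. coord b (Z y - Z y0) *\<^sub>R inv_into UNIV (K y0) (K y0 b - K y b))
        = inv_into UNIV (K y0) (K y0 (Z y - Z y0) - K y (Z y - Z y0))"
      using K S y
      by (intro linear_coord_expansion[symmetric] linear_compose[OF _ li, unfolded o_def]
          linear_compose_sub) auto
    also have "K y0 (Z y - Z y0) - K y (Z y - Z y0) = K y0 (Z y) - z - z + K y (Z y0)"
      using K S y by (simp add: linear_diff KZ)
    finally have "Z y0 + inv_into UNIV (K y0) (z - K y (Z y0))
      + (\<Sum>b\<in>fin_basis. coord b (Z y - Z y0) *\<^sub>R inv_into UNIV (K y0) (K y0 b - K y b))
      = Z y0 + inv_into UNIV (K y0) (K y0 (Z y) - z)"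
      by (simp add: add.assoc linear_diff[OF li] linear_add[OF li])
    also have "\<dots> = Z y"
      using K S by (simp add: linear_diff[OF li] bij_is_inj) (simp add: Z_def)
    finally show "Z y0 + inv_into UNIV (K y0) (z - (\<Sum>b\<in>fin_basis. coord b (Z y0) *\<^sub>R K y b))
      + (\<Sum>b\<in>fin_basis. coord b (Z y - Z y0) *\<^sub>R inv_into UNIV (K y0) (K y0 b - K y b)) = Z y"
      using K y by (simp flip: linear_coord_expansion)
  qed
  then show ?thesis
    by (simp add: Z_def[abs_def] linear_neg[OF bounded_linear.linear[OF lin0]])
qed

text \<open>The derivative of the inverse is again built from the inverse and derivatives of
  \<open>K\<close>, so regularity climbs one order at a time. The vector \<open>z\<close> varies in
  the induction because the derivative, expanded in a basis, involves the inverse at basis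
  vectors.\<close>

lemma smooth_on_linear_inverse:
  fixes K :: "'a::real_normed_vector \<Rightarrow> 'b::finite_dim_normed \<Rightarrow> 'c::finite_dim_normed"
  assumes S: "open S" and K: "\<And>y. y \<in> S \<Longrightarrow> linear (K y) \<and> bij (K y)"
    and smooth: "\<And>w. smooth_on S (\<lambda>y. K y w)"
  shows "smooth_on S (\<lambda>y. inv_into UNIV (K y) z)"
proof -
  define K' where "K' w y = frechet_derivative (\<lambda>y. K y w) (at y)" for w y
  have K': "((\<lambda>y. K y w) has_derivative K' w y) (at y)" if "y \<in> S" for w y
    unfolding K'_def using smooth_on_has_derivative[OF smooth that] .
  note der = has_derivative_linear_inverse[OF S _ K K']
  have "higher_differentiable_on n S (\<lambda>y. inv_into UNIV (K y) z)" for n z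
  proof (induction n arbitrary: z)
    case 0
    show ?case
      using der[of _ z] by (auto intro!: continuous_at_imp_continuous_on has_derivative_continuous)
  next
    case (Suc n)
    show ?case
    proof (rule higher_differentiable_on_SucI[OF S der[of _ z]])
      fix v
      define u where "u y = (\<Sum>b\<in>fin_basis. coord b (inv_into UNIV (K y) z) *\<^sub>R K' b y v)" for y
      have "higher_differentiable_on n S (\<lambda>y. K' b y v)" for b
        using smooth_on_frechet_derivative[OF smooth] by (auto simp: K'_def smooth_on_def)
      then have u: "higher_differentiable_on n S u"
        unfolding u_def
        by (intro higher_differentiable_on_sum S Suc bounded_linear_coord
            bounded_bilinear.higher_differentiable_on[OF bounded_bilinear_scaleR]
            higher_differentiable_on_bounded_linear_compose[OF S bounded_linear_coord])
      have "- inv_into UNIV (K y) (u y) = (\<Sum>c\<in>fin_basis. (- coord c (u y)) *\<^sub>R inv_into UNIV (K y) c)" if "y \<in> S" for y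
        using linear_coord_expansion[OF linear_inv, of "K y" "u y"] K[OF that]
        by (simp add: sum_negf)
      moreover have "higher_differentiable_on n S (\<lambda>y. - coord c (u y))" for c
        using bounded_linear_minus[OF bounded_linear_coord] u
        by (rule higher_differentiable_on_bounded_linear_compose[OF S])
      then have "higher_differentiable_on n S
          (\<lambda>y. \<Sum>c\<in>fin_basis. (- coord c (u y)) *\<^sub>R inv_into UNIV (K y) c)"
        by (intro higher_differentiable_on_sum S Suc
            bounded_bilinear.higher_differentiable_on[OF bounded_bilinear_scaleR])
      ultimately show "higher_differentiable_on n S
          (\<lambda>y. - inv_into UNIV (K y) (\<Sum>b\<in>fin_basis. coord b (inv_into UNIV (K y) z) *\<^sub>R K' b y v))"
        unfolding u_def[symmetric]
        by (subst higher_differentiable_on_cong[OF S]) auto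
    qed
  qed
  then show ?thesis by (simp add: smooth_on_def)
qed

section \<open>Symmetry of second derivatives\<close>

text \<open>The mean value theorem is applied along \<open>v\<close> to the difference over two
  parallel segments, then along \<open>w\<close> to the directional derivative. The left-hand side
  is unchanged when \<open>v\<close> and \<open>w\<close> are exchanged, while the right-hand side
  singles out one mixed derivative.\<close>

lemma second_difference_mean_value:
  fixes f :: "'a::real_normed_vector \<Rightarrow> real"
  assumes f: "smooth_on S f" and s: "s > 0"
    and S: "\<And>a b. 0 \<le> a \<Longrightarrow> a \<le> s \<Longrightarrow> 0 \<le> b \<Longrightarrow> b \<le> s \<Longrightarrow> x + a *\<^sub>R w + b *\<^sub>R v \<in> S"
  shows "\<exists>a b. 0 < a \<and> a < s \<and> 0 < b \<and> b < s \<and>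
    f (x + s *\<^sub>R w + s *\<^sub>R v) - f (x + s *\<^sub>R w) - f (x + s *\<^sub>R v) + f x =
    s * s * frechet_derivative (\<lambda>y. frechet_derivative f (at y) v) (at (x + a *\<^sub>R w + b *\<^sub>R v)) w"
proof -
  define fv where "fv y = frechet_derivative f (at y) v" for y
  have fv: "smooth_on S fv" unfolding fv_def by (rule smooth_on_frechet_derivative[OF f])
  define \<phi> where "\<phi> t = f (x + s *\<^sub>R w + t *\<^sub>R v) - f (x + 0 *\<^sub>R w + t *\<^sub>R v)" for t
  have d1: "((\<lambda>t. f (x + a *\<^sub>R w + t *\<^sub>R v)) has_derivative
      (\<lambda>h. h * fv (x + a *\<^sub>R w + t *\<^sub>R v))) (at t)"
    if "0 \<le> a" "a \<le> s" "0 \<le> t" "t \<le> s" for a t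
  proof -
    have D: "(f has_derivative frechet_derivative f (at (x + a *\<^sub>R w + t *\<^sub>R v)))
        (at (x + a *\<^sub>R w + t *\<^sub>R v))"
      by (rule smooth_on_has_derivative[OF f]) (use S that in auto)
    have "((\<lambda>t. x + a *\<^sub>R w + t *\<^sub>R v) has_derivative (\<lambda>h. h *\<^sub>R v)) (at t)"
      by (auto intro!: derivative_eq_intros)
    from has_derivative_compose[OF this D] show ?thesis
      by (simp add: fv_def linear_scale[OF has_derivative_linear[OF D]])
  qed
  have d2: "((\<lambda>a. fv (x + a *\<^sub>R w + t *\<^sub>R v)) has_derivative
      (\<lambda>h. h * frechet_derivative fv (at (x + a *\<^sub>R w + t *\<^sub>R v)) w)) (at a)"
    if "0 \<le> a" "a \<le> s" "0 \<le> t" "t \<le> s" for a t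
  proof -
    have D: "(fv has_derivative frechet_derivative fv (at (x + a *\<^sub>R w + t *\<^sub>R v)))
        (at (x + a *\<^sub>R w + t *\<^sub>R v))"
      by (rule smooth_on_has_derivative[OF fv]) (use S that in auto)
    have "((\<lambda>a. x + a *\<^sub>R w + t *\<^sub>R v) has_derivative (\<lambda>h. h *\<^sub>R w)) (at a)"
      by (auto intro!: derivative_eq_intros)
    from has_derivative_compose[OF this D] show ?thesis
      by (simp add: linear_scale[OF has_derivative_linear[OF D]])
  qed
  have d\<phi>: "(\<phi> has_derivative
      (\<lambda>h. h * fv (x + s *\<^sub>R w + t *\<^sub>R v) - h * fv (x + 0 *\<^sub>R w + t *\<^sub>R v))) (at t)"
    if "0 \<le> t" "t \<le> s" for t
    unfolding \<phi>_def by (intro has_derivative_diff d1) (use that s in auto)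
  then have c\<phi>: "continuous_on {0..s} \<phi>"
    by (auto intro!: continuous_at_imp_continuous_on has_derivative_continuous)
  have "\<exists>b. 0 < b \<and> b < s \<and> \<phi> s - \<phi> 0 =
    (s - 0) * fv (x + s *\<^sub>R w + b *\<^sub>R v) - (s - 0) * fv (x + 0 *\<^sub>R w + b *\<^sub>R v)"
    by (rule mvt[OF s c\<phi> d\<phi>]) (simp_all, blast)
  then obtain b where b: "0 < b" "b < s" "\<phi> s - \<phi> 0 =
    (s - 0) * fv (x + s *\<^sub>R w + b *\<^sub>R v) - (s - 0) * fv (x + 0 *\<^sub>R w + b *\<^sub>R v)"
    by blast
  have c2: "continuous_on {0..s} (\<lambda>a. fv (x + a *\<^sub>R w + b *\<^sub>R v))"
    using b by (auto intro!: continuous_at_imp_continuous_on has_derivative_continuous[OF d2])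
  have "\<exists>a. 0 < a \<and> a < s \<and> fv (x + s *\<^sub>R w + b *\<^sub>R v) - fv (x + 0 *\<^sub>R w + b *\<^sub>R v) =
      (s - 0) * frechet_derivative fv (at (x + a *\<^sub>R w + b *\<^sub>R v)) w"
    by (rule mvt[OF s c2 d2]) (use b in \<open>simp_all, blast\<close>)
  then obtain a where a: "0 < a" "a < s"
    "fv (x + s *\<^sub>R w + b *\<^sub>R v) - fv (x + 0 *\<^sub>R w + b *\<^sub>R v) =
      (s - 0) * frechet_derivative fv (at (x + a *\<^sub>R w + b *\<^sub>R v)) w"
    by blast
  have "f (x + s *\<^sub>R w + s *\<^sub>R v) - f (x + s *\<^sub>R w) - f (x + s *\<^sub>R v) + f x = \<phi> s - \<phi> 0"
    by (simp add: \<phi>_def)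
  also have "\<dots> = s * (fv (x + s *\<^sub>R w + b *\<^sub>R v) - fv (x + 0 *\<^sub>R w + b *\<^sub>R v))"
    using b(3) by (simp add: right_diff_distrib)
  also have "\<dots> = s * s * frechet_derivative fv (at (x + a *\<^sub>R w + b *\<^sub>R v)) w"
    using a(3) by simp
  finally show ?thesis using a b unfolding fv_def by blast
qed

text \<open>Both orders of differentiation express the same second difference, so the value of one
  mixed derivative at some point close to \<open>x\<close> equals the value of the other at a
  possibly different one. Continuity at \<open>x\<close> closes the gap.\<close>

lemma symmetric_second_derivative_real:
  fixes f :: "'a::real_normed_vector \<Rightarrow> real"
  assumes S: "open S" "x \<in> S" and f: "smooth_on S f"
  shows "frechet_derivative (\<lambda>y. frechet_derivative f (at y) v) (at x) w =
    frechet_derivative (\<lambda>y. frechet_derivative f (at y) w) (at x) v"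
proof -
  define A where "A v w y = frechet_derivative (\<lambda>y. frechet_derivative f (at y) v) (at y) w" for v w y
  have "\<bar>A v w x - A w v x\<bar> \<le> 2 * e" if e: "e > 0" for e
  proof -
    have near: "\<forall>\<^sub>F y in nhds x. \<bar>A p q y - A p q x\<bar> < e" for p q
    proof -
      have "continuous_on S (A p q)"
        unfolding A_def
        by (intro smooth_on_imp_continuous_on smooth_on_frechet_derivative f)
      then have "isCont (A p q) x"
        using S continuous_on_eq_continuous_at[OF S(1), of "A p q"] by blast
      then have "(A p q \<longlongrightarrow> A p q x) (nhds x)" by (simp add: isCont_def tendsto_nhds_iff)
      from tendstoD[OF this e] show ?thesis by (simp add: dist_real_def)
    qed
    have "\<forall>\<^sub>F y in nhds x. y \<in> S \<and> \<bar>A v w y - A v w x\<bar> < e \<and> \<bar>A w v y - A w v x\<bar> < e"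
      using near[of v w] near[of w v] eventually_nhds_in_open[OF S] by eventually_elim auto
    then obtain d where d: "d > 0"
      "\<And>y. dist y x < d \<Longrightarrow> y \<in> S \<and> \<bar>A v w y - A v w x\<bar> < e \<and> \<bar>A w v y - A w v x\<bar> < e"
      unfolding eventually_nhds_metric by blast
    \<comment> \<open>Parallelograms spanned with this scale stay within \<open>d / 2\<close> of
      \<open>x\<close>; the summand 1 allows \<open>v = w = 0\<close>.\<close>
    define s where "s = d / (2 * (norm v + norm w + 1))"
    have n: "norm v + norm w + 1 > 0" by (simp add: add_nonneg_pos)
    have s: "s > 0" using d n by (simp add: s_def)
    have close: "dist (x + a *\<^sub>R p + b *\<^sub>R q) x < d"
      if "0 \<le> a" "a \<le> s" "0 \<le> b" "b \<le> s" "norm p + norm q = norm v + norm w" for a b p q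
    proof -
      have "norm (a *\<^sub>R p + b *\<^sub>R q) \<le> a * norm p + b * norm q"
        using norm_triangle_ineq[of "a *\<^sub>R p" "b *\<^sub>R q"] that by simp
      also have "\<dots> \<le> s * norm p + s * norm q"
        using that by (intro add_mono mult_right_mono) auto
      also have "\<dots> \<le> s * (norm v + norm w + 1)" using s that by (simp flip: distrib_left)
      also have "\<dots> = d / 2" using n unfolding s_def by (simp add: field_simps)
      finally show ?thesis using d(1) by (simp add: dist_norm add.assoc)
    qed
    obtain a b where ab: "0 < a" "a < s" "0 < b" "b < s"
      "f (x + s *\<^sub>R w + s *\<^sub>R v) - f (x + s *\<^sub>R w) - f (x + s *\<^sub>R v) + f x =
       s * s * A v w (x + a *\<^sub>R w + b *\<^sub>R v)"
      using second_difference_mean_value[OF f s, of x w v] d(2) close[of _ _ w v]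
      unfolding A_def by (force simp: add.commute)
    obtain a' b' where ab': "0 < a'" "a' < s" "0 < b'" "b' < s"
      "f (x + s *\<^sub>R v + s *\<^sub>R w) - f (x + s *\<^sub>R v) - f (x + s *\<^sub>R w) + f x =
       s * s * A w v (x + a' *\<^sub>R v + b' *\<^sub>R w)"
      using second_difference_mean_value[OF f s, of x v w] d(2) close[of _ _ v w]
      unfolding A_def by force
    have "f (x + s *\<^sub>R w + s *\<^sub>R v) = f (x + s *\<^sub>R v + s *\<^sub>R w)" by (simp add: ac_simps)
    then have "s * s * A v w (x + a *\<^sub>R w + b *\<^sub>R v) = s * s * A w v (x + a' *\<^sub>R v + b' *\<^sub>R w)"
      using ab(5) ab'(5) by linarith
    then have eq: "A v w (x + a *\<^sub>R w + b *\<^sub>R v) = A w v (x + a' *\<^sub>R v + b' *\<^sub>R w)"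
      using s by simp
    have "\<bar>A v w (x + a *\<^sub>R w + b *\<^sub>R v) - A v w x\<bar> < e"
      using d(2)[OF close[of a b w v]] ab by (simp add: add.commute)
    moreover have "\<bar>A w v (x + a' *\<^sub>R v + b' *\<^sub>R w) - A w v x\<bar> < e"
      using d(2)[OF close[of a' b' v w]] ab' by simp
    ultimately show ?thesis using eq by linarith
  qed
  \<comment> \<open>With \<open>e\<close> a third of the difference, the bound \<open>2 * e\<close>
    forces the difference to be 0.\<close>
  then have "\<bar>A v w x - A w v x\<bar> / 3 \<le> 0 \<or> \<bar>A v w x - A w v x\<bar> \<le> 2 * (\<bar>A v w x - A w v x\<bar> / 3)"
    by (meson not_le)
  then show ?thesis unfolding A_def by (auto simp: field_simps)
qed

lemma frechet_derivative_bounded_linear: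
  assumes "bounded_linear L" "f differentiable (at x)"
  shows "frechet_derivative (\<lambda>y. L (f y)) (at x) v = L (frechet_derivative f (at x) v)"
  using frechet_derivative_at[OF bounded_linear.has_derivative[OF assms(1)
      assms(2)[unfolded frechet_derivative_works]]] by metis

lemma frechet_derivative_cong:
  assumes "open S" "x \<in> S" "\<And>y. y \<in> S \<Longrightarrow> f y = g y"
  shows "frechet_derivative f (at x) = frechet_derivative g (at x)"
proof -
  have "(f has_derivative D) (at x) \<longleftrightarrow> (g has_derivative D) (at x)" for D
    using has_derivative_transform_within_open[OF _ assms(1,2)] assms(3) by metis
  then show ?thesis unfolding frechet_derivative_def by simp
qed

lemma coord_eqI:
  assumes "\<And>b. coord b x = coord b y"
  shows "x = y"
proof -
  have "(\<Sum>b\<in>fin_basis. coord b x *\<^sub>R b) = (\<Sum>b\<in>fin_basis. coord b y *\<^sub>R b)"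
    using assms by simp
  then show ?thesis by (simp flip: coord_expansion)
qed

text \<open>The mean value theorem is real-valued, so the claim is checked on each
  coordinate.\<close>

lemma symmetric_second_derivative:
  fixes f :: "'a::real_normed_vector \<Rightarrow> 'b::finite_dim_normed"
  assumes S: "open S" "x \<in> S" and f: "smooth_on S f"
  shows "frechet_derivative (\<lambda>y. frechet_derivative f (at y) v) (at x) w =
    frechet_derivative (\<lambda>y. frechet_derivative f (at y) w) (at x) v"
proof -
  have 1: "coord b (frechet_derivative (\<lambda>y. frechet_derivative f (at y) p) (at x) q) =
    frechet_derivative (\<lambda>y. frechet_derivative (\<lambda>y. coord b (f y)) (at y) p) (at x) q" for p q and b :: 'b
  proof -
    have "coord b (frechet_derivative (\<lambda>y. frechet_derivative f (at y) p) (at x) q) =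
      frechet_derivative (\<lambda>y. coord b (frechet_derivative f (at y) p)) (at x) q"
      by (rule frechet_derivative_bounded_linear[OF bounded_linear_coord, symmetric])
        (rule smooth_on_imp_differentiable[OF smooth_on_frechet_derivative[OF f] S(2)])
    also have "frechet_derivative (\<lambda>y. coord b (frechet_derivative f (at y) p)) (at x) =
        frechet_derivative (\<lambda>y. frechet_derivative (\<lambda>y. coord b (f y)) (at y) p) (at x)"
      by (rule frechet_derivative_cong[OF S])
        (simp add: frechet_derivative_bounded_linear bounded_linear_coord smooth_on_imp_differentiable[OF f])
    finally show ?thesis .
  qed
  have "coord b (frechet_derivative (\<lambda>y. frechet_derivative f (at y) v) (at x) w) =
    coord b (frechet_derivative (\<lambda>y. frechet_derivative f (at y) w) (at x) v)" for b
    unfolding 1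
    by (rule symmetric_second_derivative_real[OF S])
      (rule smooth_on_bounded_linear_compose[OF S(1) bounded_linear_coord f])
  then show ?thesis by (rule coord_eqI)
qed

section \<open>Local Lipschitz estimate and integral curves\<close>

lemma smooth_on_locally_Lipschitz:
  fixes f :: "'a::finite_dim_normed \<Rightarrow> 'b::real_normed_vector"
  assumes S: "open S" "x \<in> S" and f: "smooth_on S f"
  obtains r L where "r > 0" "L > 0" "cball x r \<subseteq> S"
    "\<And>y z. y \<in> cball x r \<Longrightarrow> z \<in> cball x r \<Longrightarrow> norm (f y - f z) \<le> L * norm (y - z)"
proof -
  define f' where "f' y = frechet_derivative f (at y)" for y
  have "\<exists>M\<ge>0. \<forall>w. \<bar>coord b w\<bar> \<le> norm w * M" for b :: 'a
    using bounded_linear.nonneg_bounded[OF bounded_linear_coord[of b]] by auto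
  then obtain M where M: "\<And>b. M b \<ge> 0" "\<And>b w. \<bar>coord (b::'a) w\<bar> \<le> norm w * M b" by metis
  \<comment> \<open>\<open>M b\<close> bounds the coordinate functional, and the second factor
    bounds the derivative along \<open>b\<close> near \<open>x\<close>; the sum of the products
    dominates the operator norm. The last 1 keeps \<open>L\<close> positive in dimension 0.\<close>
  define L where "L = (\<Sum>b\<in>(fin_basis::'a set). M b * (norm (f' x b) + 1)) + 1"
  have L: "L > 0" unfolding L_def by (intro add_nonneg_pos sum_nonneg mult_nonneg_nonneg M) auto
  have "\<forall>\<^sub>F y in nhds x. norm (f' y b) < norm (f' x b) + 1" for b
  proof -
    have "continuous_on S (\<lambda>y. f' y b)"
      unfolding f'_def by (intro smooth_on_imp_continuous_on smooth_on_frechet_derivative f)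
    then have "isCont (\<lambda>y. f' y b) x"
      using S continuous_on_eq_continuous_at[OF S(1), of "\<lambda>y. f' y b"] by blast
    then have "((\<lambda>y. f' y b) \<longlongrightarrow> f' x b) (nhds x)" by (simp add: isCont_def tendsto_nhds_iff)
    then have "((\<lambda>y. norm (f' y b)) \<longlongrightarrow> norm (f' x b)) (nhds x)" by (rule tendsto_norm)
    then show ?thesis by (rule order_tendstoD) simp
  qed
  then have "\<forall>\<^sub>F y in nhds x. \<forall>b\<in>(fin_basis::'a set). norm (f' y b) < norm (f' x b) + 1"
    by (simp add: eventually_ball_finite_distrib fin_basis)
  then have "\<forall>\<^sub>F y in nhds x. y \<in> S \<and> (\<forall>b\<in>(fin_basis::'a set). norm (f' y b) < norm (f' x b) + 1)"
    using eventually_nhds_in_open[OF S] eventually_conj by blast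
  then obtain d where d: "d > 0" and dS: "\<And>y. dist y x < d \<Longrightarrow> y \<in> S"
    and df: "\<And>y b. dist y x < d \<Longrightarrow> b \<in> fin_basis \<Longrightarrow> norm (f' y b) < norm (f' x b) + 1"
    unfolding eventually_nhds_metric by blast
  have sub: "cball x (d/2) \<subseteq> S" using d dS by (auto simp: dist_commute)
  have "norm (f y - f z) \<le> L * norm (y - z)" if "y \<in> cball x (d/2)" "z \<in> cball x (d/2)" for y z
  proof (rule differentiable_bound[OF convex_cball _ _ that])
    fix u assume u: "u \<in> cball x (d/2)"
    have D: "(f has_derivative f' u) (at u)"
      unfolding f'_def using smooth_on_has_derivative[OF f] u sub by blast
    then show "(f has_derivative f' u) (at u within cball x (d/2))"
      by (rule has_derivative_at_withinI)
    have "norm (f' u v) \<le> L * norm v" for v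
    proof -
      have "norm (f' u v) = norm (\<Sum>b\<in>fin_basis. coord b v *\<^sub>R f' u b)"
        using linear_coord_expansion[OF has_derivative_linear[OF D]] by metis
      also have "\<dots> \<le> (\<Sum>b\<in>fin_basis. norm v * (M b * (norm (f' x b) + 1)))"
      proof (rule sum_norm_le)
        fix b :: 'a assume "b \<in> fin_basis"
        then have "\<bar>coord b v\<bar> * norm (f' u b) \<le> (norm v * M b) * (norm (f' x b) + 1)"
          using df[of u b] u d M by (intro mult_mono) (auto simp: dist_commute)
        then show "norm (coord b v *\<^sub>R f' u b) \<le> norm v * (M b * (norm (f' x b) + 1))"
          by (simp add: mult.assoc)
      qed
      also have "\<dots> \<le> L * norm v"
        unfolding L_def mult.commute[of _ "norm v"] sum_distrib_left[symmetric]
        by (intro mult_left_mono) auto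
      finally show ?thesis .
    qed
    with L show "onorm (f' u) \<le> L" by (intro onorm_bound) auto
  qed
  then show thesis using that[of "d/2" L] d L sub by auto
qed

text \<open>Picard iteration as a contraction on bounded continuous curves with values in a closed
  ball. The curves are defined for all real times, so that they form a complete subset of the type
  of bounded continuous functions; time is clamped to \<open>{-\<epsilon>..\<epsilon>}\<close>, and
  only the open interval is used in the end.\<close>

lemma integral_curve_exists:
  fixes f :: "'a::finite_dim_normed \<Rightarrow> 'a"
  assumes S: "open S" "x \<in> S" and f: "smooth_on S f"
  shows "\<exists>\<epsilon> y. \<epsilon> > 0 \<and> y 0 = x \<and>
    (\<forall>t\<in>{-\<epsilon><..<\<epsilon>}. y t \<in> S \<and> (y has_vector_derivative f (y t)) (at t))"
proof -
  obtain r L where r: "r > 0" and L: "L > 0" and sub: "cball x r \<subseteq> S"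
    and lip: "\<And>y z. y \<in> cball x r \<Longrightarrow> z \<in> cball x r \<Longrightarrow> norm (f y - f z) \<le> L * norm (y - z)"
    using smooth_on_locally_Lipschitz[OF S f] by metis
  define M where "M = norm (f x) + L * r"
  have M: "norm (f y) \<le> M" if "y \<in> cball x r" for y
  proof -
    have "norm (f y) \<le> norm (f x) + norm (f y - f x)" by (metis norm_triangle_sub)
    also have "norm (f y - f x) \<le> L * norm (y - x)" using lip[OF that, of x] r by simp
    also have "\<dots> \<le> L * r" using that L by (simp add: dist_norm norm_minus_commute)
    finally show ?thesis by (simp add: M_def)
  qed
  have M0: "M \<ge> 0" using L r by (simp add: M_def)
  \<comment> \<open>The first bound keeps the iterates in the ball, the second makes the iteration
    contract by 1/2. The factors 3 answer to the length estimate for \<open>J\<close>, and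
    \<open>M + 1\<close> avoids division by 0.\<close>
  define \<epsilon> where "\<epsilon> = min (r / (3 * (M + 1))) (1 / (6 * L))"
  have e: "\<epsilon> > 0" using r L M0 by (simp add: \<epsilon>_def)
  have eM: "3 * \<epsilon> * M \<le> r"
  proof -
    have "3 * \<epsilon> * M \<le> 3 * (r / (3 * (M + 1))) * (M + 1)"
      using M0 e r by (intro mult_mono) (auto simp: \<epsilon>_def)
    also have "\<dots> = r" using M0 by (simp add: divide_simps)
    finally show ?thesis .
  qed
  have eL: "3 * \<epsilon> * L \<le> 1 / 2"
  proof -
    have "3 * \<epsilon> * L \<le> 3 * (1 / (6 * L)) * L" using L by (intro mult_right_mono) (auto simp: \<epsilon>_def)
    then show ?thesis using L by simp
  qed
  define cl where "cl t = max (-\<epsilon>) (min \<epsilon> t)" for t :: real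
  have cl: "cl t \<in> {-\<epsilon>..\<epsilon>}" "0 \<in> {-\<epsilon>..\<epsilon>}" for t using e by (auto simp: cl_def)
  \<comment> \<open>This is the integral from 0 to \<open>cl t\<close>. An integral over a reversed
    interval would be 0, so both ends are measured from \<open>-\<epsilon>\<close>; the two pieces
    have total length at most \<open>3 * \<epsilon>\<close>.\<close>
  define J where "J g t = integral {-\<epsilon>..cl t} g - integral {-\<epsilon>..0} g" for g :: "real \<Rightarrow> 'a" and t
  have Jb: "norm (J g t) \<le> 3 * \<epsilon> * K"
    if g: "continuous_on UNIV g" "\<And>s. norm (g s) \<le> K" for g K t
  proof -
    have K: "0 \<le> K" using g(2)[of 0] by (meson norm_ge_zero order_trans)
    have *: "norm (integral {-\<epsilon>..s} g) \<le> K * (s + \<epsilon>)" if "s \<in> {-\<epsilon>..\<epsilon>}" for s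
      using integral_bound[of "-\<epsilon>" s g K] that g by (auto intro: continuous_on_subset)
    have "norm (J g t) \<le> K * (cl t + \<epsilon>) + K * (0 + \<epsilon>)"
      unfolding J_def by (rule order_trans[OF norm_triangle_ineq4 add_mono[OF *[OF cl(1)] *[OF cl(2)]]])
    also have "\<dots> \<le> K * (\<epsilon> + \<epsilon>) + K * (0 + \<epsilon>)"
      using cl(1)[of t] K by (intro add_mono mult_left_mono) auto
    finally show ?thesis by (simp add: algebra_simps)
  qed
  have Jc: "continuous_on UNIV (J g)" if "continuous_on UNIV g" for g
  proof -
    have "continuous_on {-\<epsilon>..\<epsilon>} (\<lambda>s. integral {-\<epsilon>..s} g)"
      by (intro indefinite_integral_continuous_1 integrable_continuous_interval
          continuous_on_subset[OF that]) auto
    moreover have "continuous_on UNIV cl" unfolding cl_def[abs_def] by (intro continuous_intros)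
    ultimately have "continuous_on UNIV (\<lambda>t. integral {-\<epsilon>..cl t} g)"
      using cl(1) by (intro continuous_on_compose2[of "{-\<epsilon>..\<epsilon>}" "\<lambda>s. integral {-\<epsilon>..s} g" UNIV cl]) auto
    then show ?thesis unfolding J_def[abs_def] by (intro continuous_intros)
  qed
  have Jd: "J g t - J h t = J (\<lambda>s. g s - h s) t"
    if "continuous_on UNIV g" "continuous_on UNIV h" for g h t
  proof -
    have "g integrable_on {-\<epsilon>..s}" "h integrable_on {-\<epsilon>..s}" for s
      using that by (auto intro!: integrable_continuous_interval intro: continuous_on_subset)
    then show ?thesis by (simp add: J_def integral_diff)
  qed
  have fc: "continuous_on (cball x r) f"
    using smooth_on_imp_continuous_on[OF f] sub by (rule continuous_on_subset)
  define P where "P = PiC (UNIV :: real set) (\<lambda>_. cball x r)"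
  have P: "\<phi> \<in> P \<longleftrightarrow> (\<forall>t. apply_bcontfun \<phi> t \<in> cball x r)" for \<phi>
    by (auto simp: P_def mem_PiC_iff)
  have fP: "continuous_on UNIV (\<lambda>s. f (apply_bcontfun \<phi> s))" if "\<phi> \<in> P" for \<phi>
    using that P by (intro continuous_on_compose2[OF fc]) auto
  define \<Phi> where "\<Phi> \<phi> = Bcontfun (\<lambda>t. x + J (\<lambda>s. f (apply_bcontfun \<phi> s)) t)" for \<phi>
  have in_ball: "x + J (\<lambda>s. f (apply_bcontfun \<phi> s)) t \<in> cball x r" if "\<phi> \<in> P" for \<phi> t
  proof -
    have "norm (J (\<lambda>s. f (apply_bcontfun \<phi> s)) t) \<le> 3 * \<epsilon> * M"
      using Jb[OF fP[OF that]] M that P by blast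
    then show ?thesis using eM by (simp add: dist_norm)
  qed
  have \<Phi>: "apply_bcontfun (\<Phi> \<phi>) = (\<lambda>t. x + J (\<lambda>s. f (apply_bcontfun \<phi> s)) t)" if "\<phi> \<in> P" for \<phi>
    unfolding \<Phi>_def
  proof (rule Bcontfun_inverse)
    have "continuous_on UNIV (\<lambda>t. x + J (\<lambda>s. f (apply_bcontfun \<phi> s)) t)"
      by (intro continuous_intros Jc fP that)
    moreover have "bounded (range (\<lambda>t. x + J (\<lambda>s. f (apply_bcontfun \<phi> s)) t))"
      using in_ball[OF that] by (intro bounded_subset[OF bounded_cball[of x r]]) auto
    ultimately show "(\<lambda>t. x + J (\<lambda>s. f (apply_bcontfun \<phi> s)) t) \<in> bcontfun"
      by (simp add: bcontfun_def)
  qed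
  have "\<exists>!\<phi>\<in>P. \<Phi> \<phi> = \<phi>"
  proof (rule Banach_fix[where c="1/2"])
    show "complete P"
      unfolding P_def complete_eq_closed by (rule closed_PiC) auto
    have "const_bcontfun x \<in> P" using r by (simp add: P const_bcontfun.rep_eq)
    then show "P \<noteq> {}" by blast
    show "\<Phi> ` P \<subseteq> P" using in_ball \<Phi> by (auto simp: P)
    show "dist (\<Phi> \<phi>) (\<Phi> \<psi>) \<le> 1 / 2 * dist \<phi> \<psi>" if "\<phi> \<in> P" "\<psi> \<in> P" for \<phi> \<psi>
    proof (rule dist_bound)
      fix t
      have b: "norm (f (apply_bcontfun \<phi> s) - f (apply_bcontfun \<psi> s)) \<le> L * dist \<phi> \<psi>" for s
      proof -
        have "norm (f (apply_bcontfun \<phi> s) - f (apply_bcontfun \<psi> s))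
            \<le> L * norm (apply_bcontfun \<phi> s - apply_bcontfun \<psi> s)"
          using lip that P by blast
        also have "\<dots> \<le> L * dist \<phi> \<psi>"
          using dist_bounded[of \<phi> s \<psi>] L by (simp add: dist_norm)
        finally show ?thesis .
      qed
      have "dist (apply_bcontfun (\<Phi> \<phi>) t) (apply_bcontfun (\<Phi> \<psi>) t) =
          norm (J (\<lambda>s. f (apply_bcontfun \<phi> s) - f (apply_bcontfun \<psi> s)) t)"
        using that by (simp add: \<Phi> dist_norm Jd fP)
      also have "\<dots> \<le> 3 * \<epsilon> * (L * dist \<phi> \<psi>)"
        using b by (intro Jb continuous_on_diff fP that)
      also have "\<dots> \<le> 1 / 2 * dist \<phi> \<psi>"
        using mult_right_mono[OF eL, of "dist \<phi> \<psi>"] by (simp add: mult.assoc)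
      finally show "dist (apply_bcontfun (\<Phi> \<phi>) t) (apply_bcontfun (\<Phi> \<psi>) t) \<le> 1 / 2 * dist \<phi> \<psi>" .
    qed
  qed auto
  then obtain \<phi> where \<phi>: "\<phi> \<in> P" "\<Phi> \<phi> = \<phi>" by blast
  define y where "y = apply_bcontfun \<phi>"
  have y: "y t = x + J (\<lambda>s. f (y s)) t" for t
    using \<Phi>[OF \<phi>(1)] \<phi>(2) unfolding y_def by metis
  have "y t \<in> S \<and> (y has_vector_derivative f (y t)) (at t)" if t: "t \<in> {-\<epsilon><..<\<epsilon>}" for t
  proof
    show "y t \<in> S" using \<phi>(1) P sub by (auto simp: y_def)
    have "((\<lambda>u. integral {-\<epsilon>..u} (\<lambda>s. f (y s))) has_vector_derivative f (y t)) (at t within {-\<epsilon>..\<epsilon>})"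
      using t fP[OF \<phi>(1)]
      by (intro integral_has_vector_derivative) (auto simp: y_def intro: continuous_on_subset)
    then have "((\<lambda>u. integral {-\<epsilon>..u} (\<lambda>s. f (y s))) has_vector_derivative f (y t)) (at t)"
      using t by (simp add: at_within_Icc_at)
    then have "((\<lambda>u. x + (integral {-\<epsilon>..u} (\<lambda>s. f (y s)) - integral {-\<epsilon>..0} (\<lambda>s. f (y s))))
        has_vector_derivative f (y t)) (at t)"
      by (auto intro!: derivative_eq_intros)
    then show "(y has_vector_derivative f (y t)) (at t)"
    proof (rule has_vector_derivative_transform_within_open[where S="{-\<epsilon><..<\<epsilon>}"])
      fix u assume "u \<in> {-\<epsilon><..<\<epsilon>}"
      then have "cl u = u" by (auto simp: cl_def)
      then show "x + (integral {-\<epsilon>..u} (\<lambda>s. f (y s)) - integral {-\<epsilon>..0} (\<lambda>s. f (y s))) = y u"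
        using y[of u] by (simp add: J_def)
    qed (use t in auto)
  qed
  moreover have "y 0 = x"
    using y[of 0] e by (simp add: J_def cl_def)
  ultimately show ?thesis using e by blast
qed

section \<open>Germs of smooth maps between manifolds\<close>

text \<open>The part of \<open>smooth_manifold\<close> that passes to products and open subsets by looking at charts
  alone.\<close>

definition charted :: "('a, 'e::finite_dim_normed) manifold \<Rightarrow> bool" where
  "charted M \<longleftrightarrow> (\<forall>c\<in>atlas M. is_chart (mtop M) c) \<and> (\<Union>c\<in>atlas M. fst c) = points M \<and>
     (\<forall>c\<in>atlas M. \<forall>d\<in>atlas M. smooth_on (snd c ` (fst c \<inter> fst d)) (snd d \<circ> chart_inv c))"

lemma smooth_manifold_charted: "smooth_manifold M \<Longrightarrow> charted M"
  by (simp add: smooth_manifold_def charted_def)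

lemma is_chart_inj: "is_chart T c \<Longrightarrow> inj_on (snd c) (fst c)"
  unfolding is_chart_def
  by (metis homeomorphic_map_def openin_subset topspace_subtopology_subset)

lemma is_chart_inv [simp]: "is_chart T c \<Longrightarrow> x \<in> fst c \<Longrightarrow> chart_inv c (snd c x) = x"
  by (simp add: is_chart_inj inv_into_f_f)

lemma is_chart_open_image:
  assumes "is_chart T c" "openin T U" "U \<subseteq> fst c"
  shows "open (snd c ` U)"
proof -
  have "openin (subtopology T (fst c)) U"
    using assms openin_subset_topspace_eq by (metis inf.absorb_iff2 inf.commute openin_subtopology)
  then have "openin (top_of_set (snd c ` fst c)) (snd c ` U)"
    using assms(1) unfolding is_chart_def
    by (meson homeomorphic_imp_open_map open_map_def)
  then show ?thesis
    using assms(1) unfolding is_chart_def by (meson openin_open_trans)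
qed

lemma is_chart_open_vimage:
  assumes "is_chart T c" "open W"
  shows "openin T {x \<in> fst c. snd c x \<in> W}"
proof -
  have *: "fst c \<subseteq> topspace T" using assms unfolding is_chart_def by (simp add: openin_subset)
  have "continuous_map (subtopology T (fst c)) (top_of_set (snd c ` fst c)) (snd c)"
    using assms unfolding is_chart_def by (simp add: homeomorphic_imp_continuous_map)
  then have "continuous_map (subtopology T (fst c)) euclidean (snd c)"
    by (simp add: continuous_map_in_subtopology)
  then have "openin (subtopology T (fst c)) {x \<in> topspace (subtopology T (fst c)). snd c x \<in> W}"
    using openin_continuous_map_preimage assms(2) open_openin by metis
  then have "openin (subtopology T (fst c)) {x \<in> fst c. snd c x \<in> W}"
    using * by (simp add: Int_absorb1)
  then show ?thesis
    using assms(1) unfolding is_chart_def by (meson openin_trans_full)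
qed

lemma charted_chart: "charted M \<Longrightarrow> c \<in> atlas M \<Longrightarrow> is_chart (mtop M) c"
  by (simp add: charted_def)

lemma charted_chart_open: "charted M \<Longrightarrow> c \<in> atlas M \<Longrightarrow> openin (mtop M) (fst c)"
  by (simp add: charted_def is_chart_def)

lemma charted_inv [simp]:
  "charted M \<Longrightarrow> c \<in> atlas M \<Longrightarrow> x \<in> fst c \<Longrightarrow> chart_inv c (snd c x) = x"
  by (rule is_chart_inv[OF charted_chart])

lemma charted_open_image:
  "charted M \<Longrightarrow> c \<in> atlas M \<Longrightarrow> openin (mtop M) U \<Longrightarrow> U \<subseteq> fst c \<Longrightarrow> open (snd c ` U)"
  by (rule is_chart_open_image[OF charted_chart])

lemma charted_open_vimage:
  "charted M \<Longrightarrow> c \<in> atlas M \<Longrightarrow> open W \<Longrightarrow> openin (mtop M) {x \<in> fst c. snd c x \<in> W}"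
  by (rule is_chart_open_vimage[OF charted_chart])

lemma charted_cover: "charted M \<Longrightarrow> x \<in> points M \<Longrightarrow> \<exists>c\<in>atlas M. x \<in> fst c"
  unfolding charted_def by blast

lemma charted_points: "charted M \<Longrightarrow> c \<in> atlas M \<Longrightarrow> x \<in> fst c \<Longrightarrow> x \<in> points M"
  unfolding charted_def by blast

lemma chart_at:
  assumes "charted M" "x \<in> points M"
  shows "chart_at M x \<in> atlas M" "x \<in> fst (chart_at M x)"
proof -
  have "chart_at M x \<in> atlas M \<and> x \<in> fst (chart_at M x)"
    unfolding chart_at_def by (rule someI_ex) (use charted_cover[OF assms] in blast)
  then show "chart_at M x \<in> atlas M" "x \<in> fst (chart_at M x)" by auto
qed

lemma chart_transition_smooth:
  "charted M \<Longrightarrow> c \<in> atlas M \<Longrightarrow> d \<in> atlas M \<Longrightarrow>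
    smooth_on (snd c ` (fst c \<inter> fst d)) (\<lambda>y. snd d (chart_inv c y))"
  unfolding charted_def by (auto simp: comp_def)

text \<open>Continuity is not demanded: it follows from smoothness in the charts, and the choice of the
  charts does not matter (\<open>smooth_near_charts\<close>).\<close>

definition smooth_near ::
    "('a, 'e::real_normed_vector) manifold \<Rightarrow> ('b, 'f::real_normed_vector) manifold
      \<Rightarrow> ('a \<Rightarrow> 'b) \<Rightarrow> 'a \<Rightarrow> bool" where
  "smooth_near M N f x \<longleftrightarrow> (\<exists>c\<in>atlas M. \<exists>d\<in>atlas N. \<exists>U. openin (mtop M) U \<and> x \<in> U \<and> U \<subseteq> fst c \<and>
     f ` U \<subseteq> fst d \<and> smooth_on (snd c ` U) (\<lambda>y. snd d (f (chart_inv c y))))"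

lemma smooth_nearI:
  assumes "c \<in> atlas M" "d \<in> atlas N" "openin (mtop M) U" "x \<in> U" "U \<subseteq> fst c"
    "\<And>u. u \<in> U \<Longrightarrow> f u \<in> fst d" "smooth_on (snd c ` U) (\<lambda>y. snd d (f (chart_inv c y)))"
  shows "smooth_near M N f x"
  using assms unfolding smooth_near_def by blast

lemma smooth_near_domain: "charted M \<Longrightarrow> smooth_near M N f x \<Longrightarrow> x \<in> points M"
  unfolding smooth_near_def by (meson charted_points subsetD)

lemma smooth_near_codomain: "charted N \<Longrightarrow> smooth_near M N f x \<Longrightarrow> f x \<in> points N"
  unfolding smooth_near_def by (meson charted_points imageI subsetD)

lemma smooth_near_eventually:
  "smooth_near M N f x \<Longrightarrow> \<exists>U. openin (mtop M) U \<and> x \<in> U \<and> (\<forall>u\<in>U. smooth_near M N f u)"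
  unfolding smooth_near_def by blast

text \<open>Because \<open>f\<close> sends \<open>U\<close> into a single chart domain, membership
  in \<open>W\<close> can be tested in coordinates, where continuity is assumed. This is how
  smoothness in charts comes to imply topological continuity.\<close>

lemma chart_preimage_open:
  assumes "charted M" "charted N" "c \<in> atlas M" "d \<in> atlas N" "openin (mtop M) U" "U \<subseteq> fst c"
    "f ` U \<subseteq> fst d" "continuous_on (snd c ` U) (\<lambda>y. snd d (f (chart_inv c y)))" "openin (mtop N) W"
  shows "openin (mtop M) {u \<in> U. f u \<in> W}"
proof -
  define Q where "Q = snd d ` (fst d \<inter> W)"
  have "open Q" unfolding Q_def
    by (intro charted_open_image[OF assms(2,4)]) (auto intro: openin_Int charted_chart_open assms)
  moreover have "open (snd c ` U)"
    by (intro charted_open_image[OF assms(1,3)] assms)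
  ultimately have "open (snd c ` U \<inter> (\<lambda>y. snd d (f (chart_inv c y))) -` Q)"
    using continuous_open_preimage[OF assms(8)] by blast
  then have "openin (mtop M)
      ({x \<in> fst c. snd c x \<in> snd c ` U \<inter> (\<lambda>y. snd d (f (chart_inv c y))) -` Q} \<inter> U)"
    by (intro openin_Int charted_open_vimage[OF assms(1,3)] assms)
  also have "{x \<in> fst c. snd c x \<in> snd c ` U \<inter> (\<lambda>y. snd d (f (chart_inv c y))) -` Q} \<inter> U =
      {u \<in> U. f u \<in> W}"
  proof -
    have "snd d (f u) \<in> Q \<longleftrightarrow> f u \<in> W" if "u \<in> U" for u
    proof -
      have "f u \<in> fst d" using assms(7) that by blast
      then show ?thesis
        using is_chart_inj[OF charted_chart[OF assms(2,4)]] unfolding Q_def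
        by (auto simp: inj_on_def)
    qed
    moreover have "chart_inv c (snd c u) = u" if "u \<in> U" for u
      using assms(1,3,6) that by auto
    ultimately show ?thesis using assms(6) by (auto; metis)
  qed
  finally show ?thesis .
qed

lemma smooth_near_continuous:
  assumes "charted M" "charted N" "smooth_near M N f x" "openin (mtop N) W" "f x \<in> W"
  shows "\<exists>U. openin (mtop M) U \<and> x \<in> U \<and> (\<forall>u\<in>U. f u \<in> W)"
proof -
  obtain c d U where U: "c \<in> atlas M" "d \<in> atlas N" "openin (mtop M) U" "x \<in> U" "U \<subseteq> fst c"
     "f ` U \<subseteq> fst d" "smooth_on (snd c ` U) (\<lambda>y. snd d (f (chart_inv c y)))"
    using assms(3) unfolding smooth_near_def by blast
  have "openin (mtop M) {u \<in> U. f u \<in> W}"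
    by (rule chart_preimage_open[OF assms(1,2) U(1,2,3,5,6) smooth_on_imp_continuous_on[OF U(7)] assms(4)])
  then show ?thesis using U(4) assms(5) by (intro exI[of _ "{u \<in> U. f u \<in> W}"]) auto
qed

text \<open>The expression in \<open>c\<close>, \<open>d\<close> is the one in \<open>c0\<close>,
  \<open>d0\<close> placed between two transition maps. Continuity is needed beforehand, to find a
  neighbourhood that \<open>f\<close> maps into both \<open>fst d0\<close> and
  \<open>fst d\<close>.\<close>

lemma smooth_near_charts:
  assumes M: "charted M" and N: "charted N" and f: "smooth_near M N f x"
    and c: "c \<in> atlas M" "x \<in> fst c" and d: "d \<in> atlas N" "f x \<in> fst d"
  obtains U where "openin (mtop M) U" "x \<in> U" "U \<subseteq> fst c" "f ` U \<subseteq> fst d"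
    "open (snd c ` U)" "smooth_on (snd c ` U) (\<lambda>y. snd d (f (chart_inv c y)))"
proof -
  obtain c0 d0 U0 where U0: "c0 \<in> atlas M" "d0 \<in> atlas N" "openin (mtop M) U0" "x \<in> U0" "U0 \<subseteq> fst c0"
     "f ` U0 \<subseteq> fst d0" "smooth_on (snd c0 ` U0) (\<lambda>y. snd d0 (f (chart_inv c0 y)))"
    using f unfolding smooth_near_def by blast
  obtain U1 where U1: "openin (mtop M) U1" "x \<in> U1" "\<forall>u\<in>U1. f u \<in> fst d"
    using smooth_near_continuous[OF M N f charted_chart_open[OF N d(1)] d(2)] by blast
  define U where "U = U0 \<inter> U1 \<inter> fst c"
  have U: "openin (mtop M) U" "x \<in> U" "U \<subseteq> fst c" "f ` U \<subseteq> fst d"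
    unfolding U_def using U0 U1 c charted_chart_open[OF M c(1)] by (auto intro: openin_Int)
  have open_U: "open (snd c ` U)" using charted_open_image[OF M c(1) U(1,3)] .
  have 1: "smooth_on (snd c ` U) (\<lambda>y. snd c0 (chart_inv c y))"
    by (rule smooth_on_subset[OF chart_transition_smooth[OF M c(1) U0(1)]])
      (use U0 U_def in auto)
  have 2: "smooth_on (snd c ` U) (\<lambda>y. snd d0 (f (chart_inv c0 (snd c0 (chart_inv c y)))))"
    by (rule smooth_on_compose[OF open_U charted_open_image[OF M U0(1,3,5)] 1 U0(7)])
      (use U0 c M U_def in auto)
  have "smooth_on (snd c ` U)
      (\<lambda>y. snd d (chart_inv d0 (snd d0 (f (chart_inv c0 (snd c0 (chart_inv c y)))))))"
  proof (rule smooth_on_compose[OF open_U _ 2 chart_transition_smooth[OF N U0(2) d(1)]])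
    show "open (snd d0 ` (fst d0 \<inter> fst d))"
      by (intro charted_open_image[OF N U0(2)] openin_Int charted_chart_open[OF N] U0 d) auto
    show "snd d0 (f (chart_inv c0 (snd c0 (chart_inv c y)))) \<in> snd d0 ` (fst d0 \<inter> fst d)"
      if y: "y \<in> snd c ` U" for y
    proof -
      obtain u where u: "u \<in> U" "y = snd c u" using y by blast
      then have "u \<in> fst c" "u \<in> fst c0" "f u \<in> fst d0" "f u \<in> fst d"
        using U0 U by (auto simp: U_def)
      then show ?thesis using u c U0 M by simp
    qed
  qed
  then have "smooth_on (snd c ` U) (\<lambda>y. snd d (f (chart_inv c y)))"
  proof (subst (asm) smooth_on_cong[OF open_U])
    fix y assume "y \<in> snd c ` U"
    then obtain u where u: "u \<in> U" "y = snd c u" by blast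
    then have "u \<in> fst c" "u \<in> fst c0" "f u \<in> fst d0"
      using U0 U by (auto simp: U_def)
    then show "snd d (chart_inv d0 (snd d0 (f (chart_inv c0 (snd c0 (chart_inv c y)))))) =
        snd d (f (chart_inv c y))"
      using u c U0 M N by simp
  qed
  then show thesis using that U open_U by blast
qed

lemma smooth_near_compose:
  assumes "charted M" "charted N" "charted K" "smooth_near M N f x" "smooth_near N K g (f x)"
  shows "smooth_near M K (\<lambda>x. g (f x)) x"
proof -
  obtain d k V where V: "d \<in> atlas N" "k \<in> atlas K" "openin (mtop N) V" "f x \<in> V" "V \<subseteq> fst d"
     "g ` V \<subseteq> fst k" "smooth_on (snd d ` V) (\<lambda>y. snd k (g (chart_inv d y)))"
    using assms(5) unfolding smooth_near_def by blast
  obtain c where c: "c \<in> atlas M" "x \<in> fst c"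
    using charted_cover[OF assms(1) smooth_near_domain[OF assms(1,4)]] by blast
  obtain U where U: "openin (mtop M) U" "x \<in> U" "U \<subseteq> fst c" "f ` U \<subseteq> fst d"
    "open (snd c ` U)" "smooth_on (snd c ` U) (\<lambda>y. snd d (f (chart_inv c y)))"
    using smooth_near_charts[OF assms(1,2,4) c V(1)] V by blast
  obtain U1 where U1: "openin (mtop M) U1" "x \<in> U1" "\<forall>u\<in>U1. f u \<in> V"
    using smooth_near_continuous[OF assms(1,2,4) V(3,4)] by blast
  define W where "W = U \<inter> U1"
  have W: "openin (mtop M) W" "x \<in> W" "W \<subseteq> fst c" "\<And>u. u \<in> W \<Longrightarrow> g (f u) \<in> fst k"
    unfolding W_def using U U1 V by (auto intro: openin_Int)
  have oW: "open (snd c ` W)" using charted_open_image[OF assms(1) c(1) W(1,3)] .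
  have "smooth_on (snd c ` W) (\<lambda>y. snd d (f (chart_inv c y)))"
    by (rule smooth_on_subset[OF U(6)]) (auto simp: W_def)
  then have *: "smooth_on (snd c ` W) (\<lambda>y. snd k (g (chart_inv d (snd d (f (chart_inv c y))))))"
    by (rule smooth_on_compose[OF oW charted_open_image[OF assms(2) V(1,3,5)] _ V(7)])
      (use U U1 c assms in \<open>auto simp: W_def\<close>)
  from * have "smooth_on (snd c ` W) (\<lambda>y. snd k (g (f (chart_inv c y))))"
  proof (subst (asm) smooth_on_cong[OF oW])
    fix y assume "y \<in> snd c ` W"
    then obtain u where u: "u \<in> W" "y = snd c u" by blast
    then have "u \<in> fst c" "f u \<in> fst d" using U by (auto simp: W_def)
    then show "snd k (g (chart_inv d (snd d (f (chart_inv c y))))) = snd k (g (f (chart_inv c y)))"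
      using u assms c V by simp
  qed
  then show ?thesis
    using smooth_nearI[OF c(1) V(2) W(1,2,3), of "\<lambda>x. g (f x)"] W(4) by blast
qed

lemma smooth_near_cong:
  assumes M: "charted M" and f: "smooth_near M N f x" and W: "openin (mtop M) W" "x \<in> W"
    "\<And>u. u \<in> W \<Longrightarrow> f u = g u"
  shows "smooth_near M N g x"
proof -
  obtain c d U where U: "c \<in> atlas M" "d \<in> atlas N" "openin (mtop M) U" "x \<in> U" "U \<subseteq> fst c"
     "f ` U \<subseteq> fst d" "smooth_on (snd c ` U) (\<lambda>y. snd d (f (chart_inv c y)))"
    using f unfolding smooth_near_def by blast
  have o: "openin (mtop M) (U \<inter> W)" using U W by (auto intro: openin_Int)
  have oi: "open (snd c ` (U \<inter> W))" using charted_open_image[OF M U(1) o] U by auto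
  have "smooth_on (snd c ` (U \<inter> W)) (\<lambda>y. snd d (f (chart_inv c y)))"
    by (rule smooth_on_subset[OF U(7)]) auto
  then have "smooth_on (snd c ` (U \<inter> W)) (\<lambda>y. snd d (g (chart_inv c y)))"
  proof (subst (asm) smooth_on_cong[OF oi])
    fix y assume "y \<in> snd c ` (U \<inter> W)"
    then obtain u where u: "u \<in> U \<inter> W" "y = snd c u" by blast
    then have "u \<in> fst c" using U by auto
    then show "snd d (f (chart_inv c y)) = snd d (g (chart_inv c y))" using u M U W by simp
  qed
  then show ?thesis
    by (rule smooth_nearI[OF U(1,2) o, rotated 3]) (use U W in auto)
qed

lemma smooth_map_imp_smooth_near:
  assumes "charted M" "charted N" "smooth_map M N f" "x \<in> points M"
  shows "smooth_near M N f x"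
proof -
  have cont: "continuous_map (mtop M) (mtop N) f" using assms by (simp add: smooth_map_def)
  then have "f x \<in> points N" using assms(4) by (auto simp: continuous_map_def)
  then obtain c d where c: "c \<in> atlas M" "x \<in> fst c" and d: "d \<in> atlas N" "f x \<in> fst d"
    using charted_cover[OF assms(1,4)] charted_cover[OF assms(2)] by blast
  have "openin (mtop M) (fst c \<inter> {u \<in> points M. f u \<in> fst d})"
    using openin_continuous_map_preimage[OF cont charted_chart_open[OF assms(2) d(1)]]
      charted_chart_open[OF assms(1) c(1)] by (rule openin_Int[rotated])
  also have "fst c \<inter> {u \<in> points M. f u \<in> fst d} = fst c \<inter> f -` fst d"
    using charted_points[OF assms(1) c(1)] by auto
  finally have o: "openin (mtop M) (fst c \<inter> f -` fst d)" .
  have "smooth_on (snd c ` (fst c \<inter> f -` fst d)) (snd d \<circ> f \<circ> chart_inv c)"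
    using assms(3) c d by (simp add: smooth_map_def)
  then show ?thesis
    by (intro smooth_nearI[OF c(1) d(1) o]) (use c d in \<open>auto simp: comp_def\<close>)
qed

text \<open>Lets maps be handled as germs and converted only when a definition asks for
  \<open>smooth_map\<close>.\<close>

lemma smooth_near_imp_smooth_map:
  assumes M: "charted M" and N: "charted N" and f: "\<And>x. x \<in> points M \<Longrightarrow> smooth_near M N f x"
  shows "smooth_map M N f"
  unfolding smooth_map_def continuous_map_def
proof (intro conjI ballI allI impI)
  show "f \<in> points M \<rightarrow> points N" by (intro funcsetI smooth_near_codomain[OF N f])
  show "openin (mtop M) {x \<in> points M. f x \<in> W}" if W: "openin (mtop N) W" for W
  proof (subst openin_subopen, intro ballI)
    fix x assume "x \<in> {x \<in> points M. f x \<in> W}"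
    then have "x \<in> points M" "f x \<in> W" by auto
    then obtain U where "openin (mtop M) U" "x \<in> U" "\<forall>u\<in>U. f u \<in> W"
      using smooth_near_continuous[OF M N f W] by blast
    then show "\<exists>T. openin (mtop M) T \<and> x \<in> T \<and> T \<subseteq> {x \<in> points M. f x \<in> W}"
      by (intro exI[of _ U]) (auto dest: openin_subset)
  qed
next
  fix c d assume c: "c \<in> atlas M" and d: "d \<in> atlas N"
  show "smooth_on (snd c ` (fst c \<inter> f -` fst d)) (snd d \<circ> f \<circ> chart_inv c)"
  proof (rule smooth_on_local)
    fix y assume "y \<in> snd c ` (fst c \<inter> f -` fst d)"
    then obtain x where x: "x \<in> fst c" "f x \<in> fst d" "y = snd c x" by blast
    obtain U where "openin (mtop M) U" "x \<in> U" "U \<subseteq> fst c" "f ` U \<subseteq> fst d"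
      "open (snd c ` U)" "smooth_on (snd c ` U) (\<lambda>y. snd d (f (chart_inv c y)))"
      using smooth_near_charts[OF M N f[OF charted_points[OF M c x(1)]] c x(1) d x(2)] by blast
    then show "\<exists>T. open T \<and> y \<in> T \<and> smooth_on T (snd d \<circ> f \<circ> chart_inv c)"
      using x by (intro exI[of _ "snd c ` U"]) (auto simp: comp_def)
  qed
qed

section \<open>Vector spaces as manifolds, and vector-valued germs\<close>

lemma vec_manifold_simps [simp]:
  "points vec_manifold = UNIV" "mtop vec_manifold = euclidean"
  "atlas vec_manifold = {(UNIV, \<lambda>x. x)}"
  by (simp_all add: vec_manifold_def)

lemma chart_at_vec_manifold [simp]: "chart_at vec_manifold x = (UNIV, \<lambda>x. x)"
proof -
  have "(SOME c. c = (UNIV, \<lambda>x. x) \<and> x \<in> fst c) = (UNIV, \<lambda>x. x)"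
    by (rule some_equality) auto
  then show ?thesis by (simp add: chart_at_def)
qed

lemma charted_vec_manifold [simp]: "charted (vec_manifold :: ('e::finite_dim_normed, 'e) manifold)"
proof -
  have "homeomorphic_map euclidean euclidean (\<lambda>x::'e. x)"
    by (metis homeomorphic_map_id id_def eq_id_iff)
  then show ?thesis
    by (auto simp: charted_def is_chart_def comp_def smooth_on_bounded_linear bounded_linear_ident)
qed

lemma smooth_near_chart:
  assumes "charted M" "c \<in> atlas M" "x \<in> fst c"
  shows "smooth_near M (vec_manifold :: ('e::finite_dim_normed, 'e) manifold) (snd c) x"
proof (rule smooth_nearI[OF assms(2) _ charted_chart_open[OF assms(1,2)] assms(3)])
  have "smooth_on (snd c ` fst c) (\<lambda>y. y)"
    by (rule smooth_on_bounded_linear[OF bounded_linear_ident])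
  then have "smooth_on (snd c ` fst c) (\<lambda>y. snd c (chart_inv c y))"
    using charted_open_image[OF assms(1,2) charted_chart_open[OF assms(1,2)]]
    by (subst smooth_on_cong) (auto simp: f_inv_into_f)
  then show "smooth_on (snd c ` fst c) (\<lambda>y. snd (UNIV, \<lambda>x. x) (snd c (chart_inv c y)))"
    by simp
qed auto

lemma smooth_near_chart_inv:
  fixes M :: "('a, 'e::finite_dim_normed) manifold"
  assumes "charted M" "c \<in> atlas M" "y \<in> snd c ` fst c"
  shows "smooth_near vec_manifold M (chart_inv c) y"
proof -
  have o: "open (snd c ` fst c)"
    using charted_open_image[OF assms(1,2) charted_chart_open[OF assms(1,2)]] by simp
  have "smooth_on (snd c ` fst c) (\<lambda>y. y)"
    by (rule smooth_on_bounded_linear[OF bounded_linear_ident])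
  then have "smooth_on (snd c ` fst c) (\<lambda>y. snd c (chart_inv c y))"
    using o by (subst smooth_on_cong) (auto simp: f_inv_into_f)
  then show ?thesis
    using assms o by (intro smooth_nearI[where U="snd c ` fst c" and d=c]) (auto simp: inv_into_into)
qed

lemma smooth_near_smooth_on:
  assumes "open S" "x \<in> S" "smooth_on S f"
  shows "smooth_near vec_manifold vec_manifold f x"
  using assms by (intro smooth_nearI[where U=S]) auto

lemma smooth_near_vecI:
  assumes "c \<in> atlas M" "openin (mtop M) U" "x \<in> U" "U \<subseteq> fst c"
    "smooth_on (snd c ` U) (\<lambda>y. f (chart_inv c y))"
  shows "smooth_near M vec_manifold f x"
  using assms by (intro smooth_nearI[where U=U and c=c]) auto

lemma smooth_near_vecE:
  fixes f :: "'a \<Rightarrow> 'f::finite_dim_normed"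
  assumes "charted M" "smooth_near M vec_manifold f x" "c \<in> atlas M" "x \<in> fst c"
  obtains U where "openin (mtop M) U" "x \<in> U" "U \<subseteq> fst c" "open (snd c ` U)"
    "smooth_on (snd c ` U) (\<lambda>y. f (chart_inv c y))"
  using smooth_near_charts[OF assms(1) charted_vec_manifold assms(2,3,4), of "(UNIV, \<lambda>x. x)"]
  by auto

lemma smooth_near_vec2E:
  fixes f :: "'a \<Rightarrow> 'f::finite_dim_normed" and g :: "'a \<Rightarrow> 'g::finite_dim_normed"
  assumes M: "charted M" and f: "smooth_near M vec_manifold f x" and g: "smooth_near M vec_manifold g x"
  obtains c U where "c \<in> atlas M" "openin (mtop M) U" "x \<in> U" "U \<subseteq> fst c" "open (snd c ` U)"
    "smooth_on (snd c ` U) (\<lambda>y. f (chart_inv c y))" "smooth_on (snd c ` U) (\<lambda>y. g (chart_inv c y))"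
proof -
  obtain c where c: "c \<in> atlas M" "x \<in> fst c"
    using charted_cover[OF M smooth_near_domain[OF M f]] by blast
  obtain U1 where U1: "openin (mtop M) U1" "x \<in> U1" "U1 \<subseteq> fst c" "open (snd c ` U1)"
    "smooth_on (snd c ` U1) (\<lambda>y. f (chart_inv c y))" by (rule smooth_near_vecE[OF M f c])
  obtain U2 where U2: "openin (mtop M) U2" "x \<in> U2" "U2 \<subseteq> fst c" "open (snd c ` U2)"
    "smooth_on (snd c ` U2) (\<lambda>y. g (chart_inv c y))" by (rule smooth_near_vecE[OF M g c])
  have o: "openin (mtop M) (U1 \<inter> U2)" using U1 U2 by (auto intro: openin_Int)
  show thesis
    by (rule that[OF c(1) o _ _ charted_open_image[OF M c(1) o]
          smooth_on_subset[OF U1(5)] smooth_on_subset[OF U2(5)]])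
      (use U1 U2 in auto)
qed

lemma smooth_near_add:
  fixes f g :: "'a \<Rightarrow> 'f::finite_dim_normed"
  assumes "charted M" "smooth_near M vec_manifold f x" "smooth_near M vec_manifold g x"
  shows "smooth_near M vec_manifold (\<lambda>x. f x + g x) x"
  by (rule smooth_near_vec2E[OF assms]) (rule smooth_near_vecI, auto intro: smooth_on_add)

lemma smooth_near_scaleR:
  fixes f :: "'a \<Rightarrow> real" and g :: "'a \<Rightarrow> 'f::finite_dim_normed"
  assumes "charted M" "smooth_near M vec_manifold f x" "smooth_near M vec_manifold g x"
  shows "smooth_near M vec_manifold (\<lambda>x. f x *\<^sub>R g x) x"
  by (rule smooth_near_vec2E[OF assms]) (rule smooth_near_vecI, auto intro: smooth_on_scaleR)

lemma smooth_near_const: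
  assumes M: "charted M" and N: "charted N" and "x \<in> points M" "y \<in> points N"
  shows "smooth_near M N (\<lambda>_. y) x"
proof -
  obtain c where "c \<in> atlas M" "x \<in> fst c" using charted_cover[OF M assms(3)] by blast
  moreover obtain d where "d \<in> atlas N" "y \<in> fst d" using charted_cover[OF N assms(4)] by blast
  ultimately show ?thesis
    using charted_chart_open[OF M] by (intro smooth_nearI[of c _ d _ "fst c"]) (auto intro: smooth_on_const)
qed

lemma smooth_near_sum:
  fixes f :: "'i \<Rightarrow> 'a \<Rightarrow> 'f::finite_dim_normed"
  assumes M: "charted M" and x: "x \<in> points M" and f: "\<And>i. i \<in> I \<Longrightarrow> smooth_near M vec_manifold (f i) x"
  shows "smooth_near M vec_manifold (\<lambda>x. \<Sum>i\<in>I. f i x) x"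
  using f
  by (induction I rule: infinite_finite_induct)
    (auto intro: smooth_near_const[OF M] smooth_near_add[OF M] x)

lemma smooth_near_bounded_linear:
  fixes f :: "'a \<Rightarrow> 'f::finite_dim_normed" and L :: "'f \<Rightarrow> 'g::finite_dim_normed"
  assumes "charted M" "smooth_near M vec_manifold f x" "linear L"
  shows "smooth_near M vec_manifold (\<lambda>x. L (f x)) x"
  using assms smooth_near_compose[OF assms(1) charted_vec_manifold charted_vec_manifold assms(2)]
    smooth_near_smooth_on[OF open_UNIV UNIV_I smooth_on_bounded_linear[OF linear_imp_bounded_linear]]
  by blast

lemma smooth_near_ident:
  assumes M: "charted M" and x: "x \<in> points M"
  shows "smooth_near M M (\<lambda>x. x) x"
proof -
  obtain c where c: "c \<in> atlas M" "x \<in> fst c" using charted_cover[OF M x] by blast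
  then show ?thesis
    using charted_chart_open[OF M c(1)] smooth_on_subset[OF chart_transition_smooth[OF M c(1) c(1)]]
    by (intro smooth_nearI[of c _ c _ "fst c"]) auto
qed

section \<open>Products of manifolds\<close>

lemma prod_manifold_simps [simp]:
  "mtop (prod_manifold M N) = prod_topology (mtop M) (mtop N)"
  "atlas (prod_manifold M N) =
    {(fst c \<times> fst d, map_prod (snd c) (snd d)) | c d. c \<in> atlas M \<and> d \<in> atlas N}"
  by (simp_all add: prod_manifold_def)

lemma prod_chart_in_atlas:
  "c \<in> atlas M \<Longrightarrow> d \<in> atlas N \<Longrightarrow>
    (fst c \<times> fst d, map_prod (snd c) (snd d)) \<in> atlas (prod_manifold M N)"
  unfolding prod_manifold_simps by blast

lemma prod_chart_inv:
  assumes "inj_on f A" "inj_on g B" "y \<in> f ` A" "z \<in> g ` B"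
  shows "inv_into (A \<times> B) (map_prod f g) (y, z) = (inv_into A f y, inv_into B g z)"
  using assms by (intro inv_into_f_eq) (auto simp: inj_on_def f_inv_into_f inv_into_into)

lemma is_chart_prod:
  assumes c: "is_chart S c" and d: "is_chart T d"
  shows "is_chart (prod_topology S T) (fst c \<times> fst d, map_prod (snd c) (snd d))"
proof -
  obtain g h where
    "homeomorphic_maps (subtopology S (fst c)) (top_of_set (snd c ` fst c)) (snd c) g"
    "homeomorphic_maps (subtopology T (fst d)) (top_of_set (snd d ` fst d)) (snd d) h"
    using c d unfolding is_chart_def homeomorphic_map_maps by blast
  then have "homeomorphic_maps (prod_topology (subtopology S (fst c)) (subtopology T (fst d)))
      (prod_topology (top_of_set (snd c ` fst c)) (top_of_set (snd d ` fst d)))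
      (\<lambda>(x, y). (snd c x, snd d y)) (\<lambda>(x, y). (g x, h y))"
    by (intro iffD2[OF homeomorphic_maps_prod] disjI2 conjI)
  then have "homeomorphic_map (subtopology (prod_topology S T) (fst c \<times> fst d))
      (top_of_set (snd c ` fst c \<times> snd d ` fst d)) (map_prod (snd c) (snd d))"
    unfolding homeomorphic_map_maps
    by (auto simp: subtopology_Times prod_topology_subtopology_eu map_prod_def)
  moreover have "map_prod (snd c) (snd d) ` (fst c \<times> fst d) = snd c ` fst c \<times> snd d ` fst d"
    by (rule map_prod_surj_on) auto
  ultimately show ?thesis
    using c d unfolding is_chart_def by (auto simp: openin_prod_Times_iff open_Times)
qed

lemma smooth_on_map_prod:
  fixes f :: "'a::finite_dim_normed \<Rightarrow> 'b::real_normed_vector"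
    and g :: "'c::finite_dim_normed \<Rightarrow> 'd::real_normed_vector"
  assumes A: "open A" "smooth_on A f" and B: "open B" "smooth_on B g"
  shows "smooth_on (A \<times> B) (\<lambda>p. (f (fst p), g (snd p)))"
  by (intro smooth_on_Pair open_Times A(1) B(1)
      smooth_on_compose[OF open_Times[OF A(1) B(1)] A(1) smooth_on_bounded_linear[OF bounded_linear_fst] A(2)]
      smooth_on_compose[OF open_Times[OF A(1) B(1)] B(1) smooth_on_bounded_linear[OF bounded_linear_snd] B(2)])
    auto

lemma charted_prod_manifold:
  assumes M: "charted M" and N: "charted N"
  shows "charted (prod_manifold M N)"
  unfolding charted_def
proof (intro conjI ballI)
  show "is_chart (mtop (prod_manifold M N)) k" if "k \<in> atlas (prod_manifold M N)" for k
  proof -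
    obtain c d where "c \<in> atlas M" "d \<in> atlas N" "k = (fst c \<times> fst d, map_prod (snd c) (snd d))"
      using \<open>k \<in> atlas (prod_manifold M N)\<close> unfolding prod_manifold_simps by blast
    then show ?thesis
      using is_chart_prod[OF charted_chart[OF M] charted_chart[OF N], of c d] by simp
  qed
  show "(\<Union>k\<in>atlas (prod_manifold M N). fst k) = points (prod_manifold M N)"
  proof
    show "(\<Union>k\<in>atlas (prod_manifold M N). fst k) \<subseteq> points (prod_manifold M N)"
      using charted_points[OF M] charted_points[OF N] by auto
    show "points (prod_manifold M N) \<subseteq> (\<Union>k\<in>atlas (prod_manifold M N). fst k)"
    proof
      fix p assume "p \<in> points (prod_manifold M N)"
      then have "fst p \<in> points M" "snd p \<in> points N" by auto
      then obtain c d where "c \<in> atlas M" "fst p \<in> fst c" "d \<in> atlas N" "snd p \<in> fst d"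
        using charted_cover[OF M] charted_cover[OF N] by meson
      then show "p \<in> (\<Union>k\<in>atlas (prod_manifold M N). fst k)"
        by (intro UN_I[OF prod_chart_in_atlas]) (auto simp: mem_Times_iff)
    qed
  qed
  fix k l assume "k \<in> atlas (prod_manifold M N)" "l \<in> atlas (prod_manifold M N)"
  then obtain c d c' d' where
    k: "c \<in> atlas M" "d \<in> atlas N" "k = (fst c \<times> fst d, map_prod (snd c) (snd d))" and
    l: "c' \<in> atlas M" "d' \<in> atlas N" "l = (fst c' \<times> fst d', map_prod (snd c') (snd d'))"
    by auto
  define A where "A = snd c ` (fst c \<inter> fst c')"
  define B where "B = snd d ` (fst d \<inter> fst d')"
  have A: "open A" and B: "open B" unfolding A_def B_def
    by (auto intro!: charted_open_image[OF M k(1)] charted_open_image[OF N k(2)] openin_Int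
        charted_chart_open[OF M] charted_chart_open[OF N] k l)
  have im: "snd k ` (fst k \<inter> fst l) = A \<times> B"
    unfolding k(3) l(3) A_def B_def by (force simp: Times_Int_Times intro!: map_prod_surj_on)
  have sA: "smooth_on A (\<lambda>y. snd c' (chart_inv c y))"
    unfolding A_def by (rule chart_transition_smooth[OF M k(1) l(1)])
  have sB: "smooth_on B (\<lambda>z. snd d' (chart_inv d z))"
    unfolding B_def by (rule chart_transition_smooth[OF N k(2) l(2)])
  note smooth_on_map_prod[OF A sA B sB]
  moreover have "(snd l \<circ> chart_inv k) p = (snd c' (chart_inv c (fst p)), snd d' (chart_inv d (snd p)))"
    if "p \<in> A \<times> B" for p
    using that is_chart_inj[OF charted_chart[OF M k(1)]] is_chart_inj[OF charted_chart[OF N k(2)]]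
    unfolding k(3) l(3) A_def B_def
    by (cases p) (auto simp: prod_chart_inv)
  ultimately show "smooth_on (snd k ` (fst k \<inter> fst l)) (snd l \<circ> chart_inv k)"
    unfolding im using smooth_on_cong[OF open_Times[OF A B]] by (metis (no_types, lifting))
qed

lemma smooth_near_Pair:
  assumes M: "charted M" and N: "charted N" and K: "charted K"
    and f: "smooth_near M N f x" and g: "smooth_near M K g x"
  shows "smooth_near M (prod_manifold N K) (\<lambda>x. (f x, g x)) x"
proof -
  obtain c where c: "c \<in> atlas M" "x \<in> fst c"
    using charted_cover[OF M smooth_near_domain[OF M f]] by blast
  obtain d where d: "d \<in> atlas N" "f x \<in> fst d"
    using charted_cover[OF N smooth_near_codomain[OF N f]] by blast
  obtain k where k: "k \<in> atlas K" "g x \<in> fst k"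
    using charted_cover[OF K smooth_near_codomain[OF K g]] by blast
  obtain U1 where U1: "openin (mtop M) U1" "x \<in> U1" "U1 \<subseteq> fst c" "f ` U1 \<subseteq> fst d"
    "open (snd c ` U1)" "smooth_on (snd c ` U1) (\<lambda>y. snd d (f (chart_inv c y)))"
    by (rule smooth_near_charts[OF M N f c d])
  obtain U2 where U2: "openin (mtop M) U2" "x \<in> U2" "U2 \<subseteq> fst c" "g ` U2 \<subseteq> fst k"
    "open (snd c ` U2)" "smooth_on (snd c ` U2) (\<lambda>y. snd k (g (chart_inv c y)))"
    by (rule smooth_near_charts[OF M K g c k])
  have o: "openin (mtop M) (U1 \<inter> U2)" using U1 U2 by (auto intro: openin_Int)
  have "smooth_on (snd c ` (U1 \<inter> U2)) (\<lambda>y. (snd d (f (chart_inv c y)), snd k (g (chart_inv c y))))"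
    by (intro smooth_on_Pair charted_open_image[OF M c(1) o] smooth_on_subset[OF U1(6)]
        smooth_on_subset[OF U2(6)]) (use U1 in auto)
  then show ?thesis
    using U1 U2 d k
    by (intro smooth_nearI[OF c(1) prod_chart_in_atlas[OF d(1) k(1)] o]) auto
qed

lemma smooth_near_fst:
  assumes M: "charted M" and N: "charted N" and x: "x \<in> points M" "y \<in> points N"
  shows "smooth_near (prod_manifold M N) M fst (x, y)"
proof -
  obtain c where c: "c \<in> atlas M" "x \<in> fst c" using charted_cover[OF M x(1)] by blast
  obtain d where d: "d \<in> atlas N" "y \<in> fst d" using charted_cover[OF N x(2)] by blast
  let ?k = "(fst c \<times> fst d, map_prod (snd c) (snd d))"
  have k: "?k \<in> atlas (prod_manifold M N)" by (rule prod_chart_in_atlas[OF c(1) d(1)])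
  have o: "open (snd c ` fst c \<times> snd d ` fst d)"
    by (intro open_Times charted_open_image[OF M c(1)] charted_open_image[OF N d(1)]
        charted_chart_open[OF M] charted_chart_open[OF N] c d order_refl)
  have im: "snd ?k ` (fst c \<times> fst d) = snd c ` fst c \<times> snd d ` fst d"
    by (simp add: map_prod_surj_on)
  have "smooth_on (snd c ` fst c \<times> snd d ` fst d) fst"
    by (rule smooth_on_bounded_linear[OF bounded_linear_fst])
  then have "smooth_on (snd ?k ` (fst c \<times> fst d)) (\<lambda>p. snd c (fst (chart_inv ?k p)))"
    unfolding im
    by (subst smooth_on_cong[OF o, of _ fst])
      (auto simp: prod_chart_inv is_chart_inj[OF charted_chart[OF M c(1)]]
        is_chart_inj[OF charted_chart[OF N d(1)]] M N c d)
  then show ?thesis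
    using c d charted_chart_open[OF charted_prod_manifold[OF M N] k]
    by (intro smooth_nearI[OF k c(1), of "fst c \<times> fst d"]) auto
qed

lemma smooth_near_snd:
  assumes M: "charted M" and N: "charted N" and x: "x \<in> points M" "y \<in> points N"
  shows "smooth_near (prod_manifold M N) N snd (x, y)"
proof -
  obtain c where c: "c \<in> atlas M" "x \<in> fst c" using charted_cover[OF M x(1)] by blast
  obtain d where d: "d \<in> atlas N" "y \<in> fst d" using charted_cover[OF N x(2)] by blast
  let ?k = "(fst c \<times> fst d, map_prod (snd c) (snd d))"
  have k: "?k \<in> atlas (prod_manifold M N)" by (rule prod_chart_in_atlas[OF c(1) d(1)])
  have o: "open (snd c ` fst c \<times> snd d ` fst d)"
    by (intro open_Times charted_open_image[OF M c(1)] charted_open_image[OF N d(1)]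
        charted_chart_open[OF M] charted_chart_open[OF N] c d order_refl)
  have im: "snd ?k ` (fst c \<times> fst d) = snd c ` fst c \<times> snd d ` fst d"
    by (simp add: map_prod_surj_on)
  have "smooth_on (snd c ` fst c \<times> snd d ` fst d) snd"
    by (rule smooth_on_bounded_linear[OF bounded_linear_snd])
  then have "smooth_on (snd ?k ` (fst c \<times> fst d)) (\<lambda>p. snd d (snd (chart_inv ?k p)))"
    unfolding im
    by (subst smooth_on_cong[OF o, of _ snd])
      (auto simp: prod_chart_inv is_chart_inj[OF charted_chart[OF M c(1)]]
        is_chart_inj[OF charted_chart[OF N d(1)]] M N c d)
  then show ?thesis
    using c d charted_chart_open[OF charted_prod_manifold[OF M N] k]
    by (intro smooth_nearI[OF k d(1), of "fst c \<times> fst d"]) auto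
qed

section \<open>Open submanifolds\<close>

lemma open_submanifold_simps [simp]:
  "mtop (open_submanifold M U) = subtopology (mtop M) U"
  "atlas (open_submanifold M U) = (\<lambda>c. (U \<inter> fst c, snd c)) ` atlas M"
  unfolding open_submanifold_def by (simp, unfold manifold.simps, blast)

text \<open>Restricting a chart changes \<open>chart_inv\<close> as a function, since
  \<open>inv_into\<close> chooses within the smaller domain; injectivity makes the two agree on the
  image of that domain.\<close>

lemma inv_into_subset_eq:
  "inj_on f A \<Longrightarrow> B \<subseteq> A \<Longrightarrow> y \<in> f ` B \<Longrightarrow> inv_into B f y = inv_into A f y"
  by (metis (no_types, lifting) f_inv_into_f image_mono inj_on_subset inv_into_f_f inv_into_into subsetD)

lemma is_chart_restrict:
  assumes c: "is_chart T c" and U: "openin T U"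
  shows "is_chart (subtopology T U) (U \<inter> fst c, snd c)"
proof -
  have oU: "openin T (U \<inter> fst c)" using c U by (auto simp: is_chart_def intro: openin_Int)
  have "homeomorphic_map (subtopology (subtopology T (fst c)) (U \<inter> fst c))
     (subtopology (top_of_set (snd c ` fst c)) (snd c ` (U \<inter> fst c))) (snd c)"
  proof (rule homeomorphic_map_subtopologies)
    show "homeomorphic_map (subtopology T (fst c)) (top_of_set (snd c ` fst c)) (snd c)"
      using c by (simp add: is_chart_def)
    show "snd c ` (topspace (subtopology T (fst c)) \<inter> (U \<inter> fst c)) =
        topspace (top_of_set (snd c ` fst c)) \<inter> snd c ` (U \<inter> fst c)"
      using openin_subset[OF oU] by auto
  qed
  moreover have "subtopology (subtopology T (fst c)) (U \<inter> fst c) = subtopology (subtopology T U) (U \<inter> fst c)"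
    by (simp add: subtopology_subtopology Int_ac)
  moreover have "subtopology (top_of_set (snd c ` fst c)) (snd c ` (U \<inter> fst c)) = top_of_set (snd c ` (U \<inter> fst c))"
    by (simp add: subtopology_subtopology Int_absorb1 image_mono)
  ultimately show ?thesis
    using is_chart_open_image[OF c oU] oU U
    unfolding is_chart_def by (auto simp: openin_open_subtopology)
qed

lemma charted_open_submanifold:
  assumes M: "charted M" and U: "openin (mtop M) U"
  shows "charted (open_submanifold M U)"
  unfolding charted_def
proof (intro conjI ballI)
  show "is_chart (mtop (open_submanifold M U)) k" if "k \<in> atlas (open_submanifold M U)" for k
    using that is_chart_restrict[OF charted_chart[OF M] U] by auto
  show "(\<Union>k\<in>atlas (open_submanifold M U). fst k) = points (open_submanifold M U)"
    using M by (simp add: charted_def Int_commute flip: Int_UN_distrib)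
  fix k l assume "k \<in> atlas (open_submanifold M U)" "l \<in> atlas (open_submanifold M U)"
  then obtain c d where k: "c \<in> atlas M" "k = (U \<inter> fst c, snd c)" and l: "d \<in> atlas M" "l = (U \<inter> fst d, snd d)"
    by auto
  have o: "open (snd c ` (U \<inter> (fst c \<inter> fst d)))"
    using U charted_chart_open[OF M] k l by (intro charted_open_image[OF M k(1)] openin_Int) auto
  have "smooth_on (snd c ` (U \<inter> (fst c \<inter> fst d))) (\<lambda>y. snd d (chart_inv c y))"
    by (rule smooth_on_subset[OF chart_transition_smooth[OF M k(1) l(1)]]) auto
  moreover have "snd k ` (fst k \<inter> fst l) = snd c ` (U \<inter> (fst c \<inter> fst d))"
    unfolding k l by (simp add: Int_ac)
  moreover have "(snd l \<circ> chart_inv k) y = snd d (chart_inv c y)" if "y \<in> snd c ` (U \<inter> (fst c \<inter> fst d))" for y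
    unfolding k l using that
    by (simp, subst inv_into_subset_eq[OF is_chart_inj[OF charted_chart[OF M k(1)]]]) auto
  ultimately show "smooth_on (snd k ` (fst k \<inter> fst l)) (snd l \<circ> chart_inv k)"
    using smooth_on_cong[OF o] by (metis (no_types, lifting))
qed

lemma smooth_near_open_submanifold:
  assumes M: "charted M" and U: "openin (mtop M) U" and x: "x \<in> U"
  shows "smooth_near (open_submanifold M U) M (\<lambda>x. x) x" "smooth_near M (open_submanifold M U) (\<lambda>x. x) x"
proof -
  obtain c where c: "c \<in> atlas M" "x \<in> fst c"
    using charted_cover[OF M] U x openin_subset by blast
  let ?k = "(U \<inter> fst c, snd c)"
  have k: "?k \<in> atlas (open_submanifold M U)" using c by auto
  have o: "openin (mtop M) (U \<inter> fst c)" using U charted_chart_open[OF M c(1)] by (rule openin_Int)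
  have oi: "open (snd c ` (U \<inter> fst c))" using charted_open_image[OF M c(1) o] by simp
  have "smooth_on (snd c ` (U \<inter> fst c)) (\<lambda>y. y)"
    by (rule smooth_on_bounded_linear[OF bounded_linear_ident])
  then have "smooth_on (snd c ` (U \<inter> fst c)) (\<lambda>y. snd c (inv_into (U \<inter> fst c) (snd c) y))"
    by (subst smooth_on_cong[OF oi, of _ "\<lambda>y. y"]) (auto simp: f_inv_into_f)
  then show "smooth_near (open_submanifold M U) M (\<lambda>x. x) x"
    using c x o U by (intro smooth_nearI[OF k c(1), of "U \<inter> fst c"]) (auto simp: openin_open_subtopology)
  have "smooth_on (snd c ` (U \<inter> fst c)) (\<lambda>y. snd c (chart_inv c y))"
    by (rule smooth_on_subset[OF chart_transition_smooth[OF M c(1) c(1)]]) auto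
  then show "smooth_near M (open_submanifold M U) (\<lambda>x. x) x"
    using c x o by (intro smooth_nearI[OF c(1) k, of "U \<inter> fst c"]) auto
qed

section \<open>Tangent maps\<close>

text \<open>The term \<open>frechet_derivative\<close> inside \<open>tangent_map\<close> is
  meaningful only where a derivative exists; smoothness of the germ in the preferred charts supplies
  it.\<close>

lemma tangent_map_has_derivative:
  assumes M: "charted M" and N: "charted N" and f: "smooth_near M N f x"
  shows "((\<lambda>y. snd (chart_at N (f x)) (f (chart_inv (chart_at M x) y))) has_derivative
    tangent_map M N f x) (at (snd (chart_at M x) x))"
proof -
  note x = smooth_near_domain[OF M f] and fx = smooth_near_codomain[OF N f]
  obtain U where U: "openin (mtop M) U" "x \<in> U" "U \<subseteq> fst (chart_at M x)"
    "f ` U \<subseteq> fst (chart_at N (f x))" "open (snd (chart_at M x) ` U)"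
    "smooth_on (snd (chart_at M x) ` U) (\<lambda>y. snd (chart_at N (f x)) (f (chart_inv (chart_at M x) y)))"
    by (rule smooth_near_charts[OF M N f chart_at[OF M x] chart_at[OF N fx]])
  show ?thesis
    using smooth_on_has_derivative[OF U(6), of "snd (chart_at M x) x"] U(2)
    by (simp add: tangent_map_def comp_def)
qed

lemma tangent_mapI:
  assumes M: "charted M" and N: "charted N" and f: "smooth_near M N f x"
    and "((\<lambda>y. snd (chart_at N (f x)) (f (chart_inv (chart_at M x) y))) has_derivative D)
      (at (snd (chart_at M x) x))"
  shows "tangent_map M N f x = D"
  using has_derivative_unique[OF tangent_map_has_derivative[OF M N f] assms(4)] .

lemma linear_tangent_map:
  "charted M \<Longrightarrow> charted N \<Longrightarrow> smooth_near M N f x \<Longrightarrow> linear (tangent_map M N f x)"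
  by (rule has_derivative_linear[OF tangent_map_has_derivative])

text \<open>No transition map enters: both factors are expressed in the same preferred chart at
  \<open>f x\<close>, which cancels.\<close>

lemma tangent_map_compose:
  assumes M: "charted M" and N: "charted N" and K: "charted K"
    and f: "smooth_near M N f x" and g: "smooth_near N K g (f x)"
  shows "tangent_map M K (\<lambda>x. g (f x)) x v = tangent_map N K g (f x) (tangent_map M N f x v)"
proof -
  define c where "c = chart_at M x"
  define d where "d = chart_at N (f x)"
  define k where "k = chart_at K (g (f x))"
  note x = smooth_near_domain[OF M f] and fx = smooth_near_codomain[OF N f]
  note cd = chart_at[OF M x, folded c_def] chart_at[OF N fx, folded d_def]
  obtain U where U: "openin (mtop M) U" "x \<in> U" "U \<subseteq> fst c" "f ` U \<subseteq> fst d" "open (snd c ` U)"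
    "smooth_on (snd c ` U) (\<lambda>y. snd d (f (chart_inv c y)))"
    by (rule smooth_near_charts[OF M N f cd])
  have F: "((\<lambda>y. snd d (f (chart_inv c y))) has_derivative tangent_map M N f x) (at (snd c x))"
    using tangent_map_has_derivative[OF M N f] by (simp add: c_def d_def)
  have G: "((\<lambda>y. snd k (g (chart_inv d y))) has_derivative tangent_map N K g (f x))
      (at (snd d (f (chart_inv c (snd c x)))))"
    using tangent_map_has_derivative[OF N K g] M cd by (simp add: k_def d_def)
  have "((\<lambda>y. snd k (g (f (chart_inv c y)))) has_derivative
      (\<lambda>v. tangent_map N K g (f x) (tangent_map M N f x v))) (at (snd c x))"
  proof (rule has_derivative_transform_within_open[OF has_derivative_compose[OF F G] U(5)])
    show "snd c x \<in> snd c ` U" using U by blast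
    fix y assume "y \<in> snd c ` U"
    then obtain u where u: "u \<in> U" "y = snd c u" by blast
    then have "u \<in> fst c" "f u \<in> fst d" using U by auto
    then show "snd k (g (chart_inv d (snd d (f (chart_inv c y))))) = snd k (g (f (chart_inv c y)))"
      using u M N cd by simp
  qed
  then have "tangent_map M K (\<lambda>x. g (f x)) x = (\<lambda>v. tangent_map N K g (f x) (tangent_map M N f x v))"
    by (intro tangent_mapI[OF M K smooth_near_compose[OF M N K f g]]) (simp add: c_def k_def)
  then show ?thesis by simp
qed

lemma tangent_map_cong:
  assumes M: "charted M" and W: "openin (mtop M) W" "x \<in> W" "\<And>u. u \<in> W \<Longrightarrow> f u = g u"
  shows "tangent_map M N f x = tangent_map M N g x"
proof -
  define c where "c = chart_at M x"
  have "x \<in> points M" using openin_subset[OF W(1)] W(2) by blast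
  then have c: "c \<in> atlas M" "x \<in> fst c" using chart_at[OF M] by (auto simp: c_def)
  have o: "openin (mtop M) (fst c \<inter> W)" using charted_chart_open[OF M c(1)] W(1) by (rule openin_Int)
  have "frechet_derivative (snd (chart_at N (g x)) \<circ> f \<circ> chart_inv c) (at (snd c x)) =
      frechet_derivative (snd (chart_at N (g x)) \<circ> g \<circ> chart_inv c) (at (snd c x))"
  proof (rule frechet_derivative_cong[OF charted_open_image[OF M c(1) o]])
    show "snd c x \<in> snd c ` (fst c \<inter> W)" using c W by blast
    show "(snd (chart_at N (g x)) \<circ> f \<circ> chart_inv c) y = (snd (chart_at N (g x)) \<circ> g \<circ> chart_inv c) y"
      if "y \<in> snd c ` (fst c \<inter> W)" for y
      using that W M c by auto
  qed auto
  then show ?thesis using W by (simp add: tangent_map_def c_def)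
qed

lemma tangent_map_ident:
  assumes M: "charted M" and x: "x \<in> points M"
  shows "tangent_map M M (\<lambda>x. x) x v = v"
proof -
  define c where "c = chart_at M x"
  have c: "c \<in> atlas M" "x \<in> fst c" using chart_at[OF M x] by (auto simp: c_def)
  have "((\<lambda>y. snd c (chart_inv c y)) has_derivative (\<lambda>v. v)) (at (snd c x))"
    by (rule has_derivative_transform_within_open[OF has_derivative_ident
          charted_open_image[OF M c(1) charted_chart_open[OF M c(1)] order_refl]])
      (use c in \<open>auto simp: f_inv_into_f\<close>)
  then have "tangent_map M M (\<lambda>x. x) x = (\<lambda>v. v)"
    by (intro tangent_mapI[OF M M smooth_near_ident[OF M x]]) (simp add: c_def)
  then show ?thesis by simp
qed

text \<open>The relation \<open>g (f u) = u\<close> is asked only near \<open>x\<close>, so that it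
  serves for charts, local sections and translations of a group alike.\<close>

lemma tangent_map_left_inverse:
  assumes M: "charted M" and N: "charted N" and f: "smooth_near M N f x" and g: "smooth_near N M g (f x)"
    and W: "openin (mtop M) W" "x \<in> W" "\<And>u. u \<in> W \<Longrightarrow> g (f u) = u"
  shows "tangent_map N M g (f x) (tangent_map M N f x v) = v"
proof -
  have "tangent_map N M g (f x) (tangent_map M N f x v) = tangent_map M M (\<lambda>x. g (f x)) x v"
    using tangent_map_compose[OF M N M f g] by simp
  also have "\<dots> = tangent_map M M (\<lambda>x. x) x v"
    using tangent_map_cong[OF M W(1,2), of "\<lambda>x. g (f x)" "\<lambda>x. x" M] W(3) by simp
  finally show ?thesis using tangent_map_ident[OF M smooth_near_domain[OF M f]] by simp
qed

lemma tangent_map_const: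
  assumes M: "charted M" and N: "charted N" and x: "x \<in> points M" and y: "y \<in> points N"
  shows "tangent_map M N (\<lambda>_. y) x v = 0"
proof -
  have "tangent_map M N (\<lambda>_. y) x = (\<lambda>_. 0)"
    by (rule tangent_mapI[OF M N smooth_near_const[OF M N x y]]) (rule has_derivative_const)
  then show ?thesis by simp
qed

lemma tangent_map_vec:
  "tangent_map M vec_manifold f x =
    frechet_derivative (\<lambda>y. f (chart_inv (chart_at M x) y)) (at (snd (chart_at M x) x))"
  by (simp add: tangent_map_def comp_def)

lemma tangent_map_chart_at:
  assumes M: "charted M" and x: "x \<in> points M"
  shows "tangent_map M vec_manifold (snd (chart_at M x)) x v = v"
  using tangent_map_ident[OF M x] by (simp add: tangent_map_def comp_def)

lemma tangent_map_linear:
  fixes L :: "'a::finite_dim_normed \<Rightarrow> 'b::finite_dim_normed"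
  assumes "linear L"
  shows "tangent_map vec_manifold vec_manifold L x v = L v"
proof -
  have "(L has_derivative L) (at x)"
    by (intro bounded_linear_imp_has_derivative linear_imp_bounded_linear assms)
  then show ?thesis by (simp add: tangent_map_vec frechet_derivative_at[symmetric])
qed

lemma smooth_near_linear:
  fixes L :: "'a::finite_dim_normed \<Rightarrow> 'b::finite_dim_normed"
  assumes "linear L"
  shows "smooth_near vec_manifold vec_manifold L x"
  by (rule smooth_near_smooth_on[OF open_UNIV UNIV_I smooth_on_bounded_linear])
    (rule linear_imp_bounded_linear[OF assms])

lemma velocity_eq_tangent_map:
  assumes M: "charted M" and c: "smooth_near vec_manifold M c t"
  shows "velocity M c t = tangent_map vec_manifold M c t 1"
proof -
  have D: "((\<lambda>s. snd (chart_at M (c t)) (c s)) has_derivative tangent_map vec_manifold M c t) (at t)"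
    using tangent_map_has_derivative[OF charted_vec_manifold M c] by simp
  have "tangent_map vec_manifold M c t h = h *\<^sub>R tangent_map vec_manifold M c t 1" for h
    using linear_scale[OF has_derivative_linear[OF D], of h 1] by simp
  then have "tangent_map vec_manifold M c t = (\<lambda>h. h *\<^sub>R tangent_map vec_manifold M c t 1)"
    by (rule ext)
  then have "((\<lambda>s. snd (chart_at M (c t)) (c s)) has_vector_derivative tangent_map vec_manifold M c t 1) (at t)"
    using D by (simp add: has_vector_derivative_def)
  then show ?thesis by (simp add: velocity_def comp_def vector_derivative_at)
qed

section \<open>Tangent maps on products and partial derivatives\<close>

text \<open>The preferred chart at a pair is a product of two charts, but these need not be the
  preferred charts of the factors. Hence \<open>c\<close> and \<open>d\<close> remain
  unspecified.\<close>

lemma chart_at_prod: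
  assumes M: "charted M" and N: "charted N" and "x \<in> points M" "y \<in> points N"
  obtains c d where "c \<in> atlas M" "x \<in> fst c" "d \<in> atlas N" "y \<in> fst d"
    "chart_at (prod_manifold M N) (x, y) = (fst c \<times> fst d, map_prod (snd c) (snd d))"
proof -
  have "(x, y) \<in> points (prod_manifold M N)" using assms by simp
  note k = chart_at[OF charted_prod_manifold[OF M N] this]
  obtain c d where "c \<in> atlas M" "d \<in> atlas N"
    and cd: "chart_at (prod_manifold M N) (x, y) = (fst c \<times> fst d, map_prod (snd c) (snd d))"
    using k(1) unfolding prod_manifold_simps by blast
  moreover have "x \<in> fst c" "y \<in> fst d" using k(2) unfolding cd by auto
  ultimately show thesis using that by blast
qed

text \<open>The tangent maps of \<open>snd c\<close> and \<open>snd d\<close> convert from the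
  preferred charts of the factors to the chart of the pair.\<close>

lemma tangent_map_Pair_charts:
  assumes M: "charted M" and N: "charted N" and K: "charted K"
    and f: "smooth_near M N f z" and g: "smooth_near M K g z"
    and c: "c \<in> atlas N" "f z \<in> fst c" and d: "d \<in> atlas K" "g z \<in> fst d"
    and k: "chart_at (prod_manifold N K) (f z, g z) = (fst c \<times> fst d, map_prod (snd c) (snd d))"
  shows "tangent_map M (prod_manifold N K) (\<lambda>u. (f u, g u)) z v =
    (tangent_map N vec_manifold (snd c) (f z) (tangent_map M N f z v),
     tangent_map K vec_manifold (snd d) (g z) (tangent_map M K g z v))"
proof -
  define b where "b = chart_at M z"
  note cf = smooth_near_compose[OF M N charted_vec_manifold f smooth_near_chart[OF N c]]
  note dg = smooth_near_compose[OF M K charted_vec_manifold g smooth_near_chart[OF K d]]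
  have "((\<lambda>y. (snd c (f (chart_inv b y)), snd d (g (chart_inv b y)))) has_derivative
      (\<lambda>v. (tangent_map M vec_manifold (\<lambda>u. snd c (f u)) z v, tangent_map M vec_manifold (\<lambda>u. snd d (g u)) z v)))
      (at (snd b z))"
    using tangent_map_has_derivative[OF M charted_vec_manifold cf]
      tangent_map_has_derivative[OF M charted_vec_manifold dg]
    by (intro has_derivative_Pair) (simp_all add: b_def)
  then have "tangent_map M (prod_manifold N K) (\<lambda>u. (f u, g u)) z =
      (\<lambda>v. (tangent_map M vec_manifold (\<lambda>u. snd c (f u)) z v, tangent_map M vec_manifold (\<lambda>u. snd d (g u)) z v))"
    by (intro tangent_mapI[OF M charted_prod_manifold[OF N K] smooth_near_Pair[OF M N K f g]])
      (simp add: k b_def)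
  then show ?thesis
    by (simp add: tangent_map_compose[OF M N charted_vec_manifold f smooth_near_chart[OF N c]]
        tangent_map_compose[OF M K charted_vec_manifold g smooth_near_chart[OF K d]])
qed

text \<open>Splitting along the two slices through the point avoids identifying the tangent space of
  a product with a product of tangent spaces; the unknown chart conversions are the same on both
  sides.\<close>

lemma tangent_map_Pair:
  assumes M: "charted M" and N: "charted N" and K: "charted K"
    and f: "smooth_near M N f z" and g: "smooth_near M K g z"
  shows "tangent_map M (prod_manifold N K) (\<lambda>u. (f u, g u)) z v =
    tangent_map N (prod_manifold N K) (\<lambda>u. (u, g z)) (f z) (tangent_map M N f z v) +
    tangent_map K (prod_manifold N K) (\<lambda>u. (f z, u)) (g z) (tangent_map M K g z v)"
proof -
  note p = smooth_near_codomain[OF N f] smooth_near_codomain[OF K g]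
  obtain c d where c: "c \<in> atlas N" "f z \<in> fst c" and d: "d \<in> atlas K" "g z \<in> fst d"
    and k: "chart_at (prod_manifold N K) (f z, g z) = (fst c \<times> fst d, map_prod (snd c) (snd d))"
    by (rule chart_at_prod[OF N K p])
  have z1: "tangent_map K vec_manifold (snd d) (g z) 0 = 0"
    by (intro linear_0 linear_tangent_map K charted_vec_manifold smooth_near_chart d)
  have z2: "tangent_map N vec_manifold (snd c) (f z) 0 = 0"
    by (intro linear_0 linear_tangent_map N charted_vec_manifold smooth_near_chart c)
  show ?thesis
    using tangent_map_Pair_charts[OF M N K f g c d k]
      tangent_map_Pair_charts[OF N N K smooth_near_ident[OF N p(1)] smooth_near_const[OF N K p] c d k]
      tangent_map_Pair_charts[OF K N K smooth_near_const[OF K N p(2,1)] smooth_near_ident[OF K p(2)] c d k]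
    by (simp add: tangent_map_ident N K p tangent_map_const z1 z2)
qed

lemma smooth_near_Pair1:
  "charted M \<Longrightarrow> charted N \<Longrightarrow> x \<in> points M \<Longrightarrow> y \<in> points N \<Longrightarrow>
    smooth_near M (prod_manifold M N) (\<lambda>u. (u, y)) x"
  by (intro smooth_near_Pair smooth_near_ident smooth_near_const)

lemma smooth_near_Pair2:
  "charted M \<Longrightarrow> charted N \<Longrightarrow> x \<in> points M \<Longrightarrow> y \<in> points N \<Longrightarrow>
    smooth_near N (prod_manifold M N) (\<lambda>u. (x, u)) y"
  by (intro smooth_near_Pair smooth_near_ident smooth_near_const)

lemma smooth_near_section1:
  assumes "charted M" "charted N" "charted L" "smooth_near (prod_manifold M N) L h (x, y)"
  shows "smooth_near M L (\<lambda>u. h (u, y)) x"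
  using smooth_near_domain[OF charted_prod_manifold[OF assms(1,2)] assms(4)] assms
  by (intro smooth_near_compose[OF assms(1) charted_prod_manifold[OF assms(1,2)] assms(3)] smooth_near_Pair1)
    simp_all

lemma smooth_near_section2:
  assumes "charted M" "charted N" "charted L" "smooth_near (prod_manifold M N) L h (x, y)"
  shows "smooth_near N L (\<lambda>u. h (x, u)) y"
  using smooth_near_domain[OF charted_prod_manifold[OF assms(1,2)] assms(4)] assms
  by (intro smooth_near_compose[OF assms(2) charted_prod_manifold[OF assms(1,2)] assms(3)] smooth_near_Pair2)
    simp_all

text \<open>The total derivative as a sum of partial ones. It carries the computations with
  quotients of curves, with trivializations and with the bracket.\<close>

lemma tangent_map_compose2:
  assumes M: "charted M" and N: "charted N" and K: "charted K" and L: "charted L"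
    and f: "smooth_near M N f z" and g: "smooth_near M K g z"
    and h: "smooth_near (prod_manifold N K) L h (f z, g z)"
  shows "tangent_map M L (\<lambda>u. h (f u, g u)) z v =
    tangent_map N L (\<lambda>u. h (u, g z)) (f z) (tangent_map M N f z v) +
    tangent_map K L (\<lambda>u. h (f z, u)) (g z) (tangent_map M K g z v)"
proof -
  note p = smooth_near_codomain[OF N f] smooth_near_codomain[OF K g]
  note NK = charted_prod_manifold[OF N K]
  have "tangent_map M L (\<lambda>u. h (f u, g u)) z v = tangent_map (prod_manifold N K) L h (f z, g z)
      (tangent_map M (prod_manifold N K) (\<lambda>u. (f u, g u)) z v)"
    by (rule tangent_map_compose[OF M NK L smooth_near_Pair[OF M N K f g] h])
  also have "\<dots> = tangent_map (prod_manifold N K) L h (f z, g z)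
      (tangent_map N (prod_manifold N K) (\<lambda>u. (u, g z)) (f z) (tangent_map M N f z v)) +
      tangent_map (prod_manifold N K) L h (f z, g z)
      (tangent_map K (prod_manifold N K) (\<lambda>u. (f z, u)) (g z) (tangent_map M K g z v))"
    unfolding tangent_map_Pair[OF M N K f g]
    by (rule linear_add[OF linear_tangent_map[OF NK L h]])
  also have "tangent_map (prod_manifold N K) L h (f z, g z)
      (tangent_map N (prod_manifold N K) (\<lambda>u. (u, g z)) (f z) w) =
      tangent_map N L (\<lambda>u. h (u, g z)) (f z) w" for w
    by (rule tangent_map_compose[OF N NK L smooth_near_Pair1[OF N K p] h, symmetric])
  also have "tangent_map (prod_manifold N K) L h (f z, g z)
      (tangent_map K (prod_manifold N K) (\<lambda>u. (f z, u)) (g z) w) =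
      tangent_map K L (\<lambda>u. h (f z, u)) (g z) w" for w
    by (rule tangent_map_compose[OF K NK L smooth_near_Pair2[OF N K p] h, symmetric])
  finally show ?thesis .
qed

text \<open>The chart is a product of prescribed charts instead of the preferred chart of the pair.
  Partial derivatives taken in the preferred charts of the factors thus become partial derivatives
  of a single function on an open set.\<close>

lemma prod_chart_representation:
  fixes h :: "'a \<times> 'b \<Rightarrow> 'v::finite_dim_normed"
  assumes M: "charted M" and N: "charted N"
    and h: "smooth_near (prod_manifold M N) vec_manifold h (x, y)"
    and c: "c \<in> atlas M" "x \<in> fst c" and d: "d \<in> atlas N" "y \<in> fst d"
  obtains W where "open W" "(snd c x, snd d y) \<in> W" "W \<subseteq> snd c ` fst c \<times> snd d ` fst d"
    "smooth_on W (\<lambda>p. h (chart_inv c (fst p), chart_inv d (snd p)))"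
proof -
  let ?k = "(fst c \<times> fst d, map_prod (snd c) (snd d))"
  have xy: "(x, y) \<in> fst ?k" using c d by simp
  obtain U where U': "openin (mtop (prod_manifold M N)) U" "(x, y) \<in> U" "U \<subseteq> fst ?k"
    "open (snd ?k ` U)" "smooth_on (snd ?k ` U) (\<lambda>p. h (chart_inv ?k p))"
    by (rule smooth_near_vecE[OF charted_prod_manifold[OF M N] h prod_chart_in_atlas[OF c(1) d(1)] xy])
  have U: "(x, y) \<in> U" "U \<subseteq> fst c \<times> fst d" "open (map_prod (snd c) (snd d) ` U)"
    "smooth_on (map_prod (snd c) (snd d) ` U) (\<lambda>p. h (chart_inv ?k p))"
    using U' by simp_all
  have "chart_inv ?k p = (chart_inv c (fst p), chart_inv d (snd p))" if "p \<in> map_prod (snd c) (snd d) ` U" for p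
    using that U(2) is_chart_inj[OF charted_chart[OF M c(1)]] is_chart_inj[OF charted_chart[OF N d(1)]]
    by (cases p) (auto intro!: prod_chart_inv)
  then have "smooth_on (map_prod (snd c) (snd d) ` U) (\<lambda>p. h (chart_inv c (fst p), chart_inv d (snd p)))"
    using U(4) by (subst (asm) smooth_on_cong[OF U(3)]) auto
  then show thesis using that[OF U(3)] U(1,2) by fastforce
qed

lemma frechet_derivative_section2:
  assumes W: "smooth_on W F" "(a, b) \<in> W"
  shows "frechet_derivative (\<lambda>z. F (a, z)) (at b) w = frechet_derivative F (at (a, b)) (0, w)"
proof -
  have "((\<lambda>z. (a, z)) has_derivative (\<lambda>w. (0, w))) (at b)"
    by (auto intro!: derivative_eq_intros)
  from has_derivative_compose[OF this smooth_on_has_derivative[OF W]]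
  show ?thesis using frechet_derivative_at by metis
qed

lemma frechet_derivative_section1:
  assumes W: "smooth_on W F" "(a, b) \<in> W"
  shows "frechet_derivative (\<lambda>z. F (z, b)) (at a) w = frechet_derivative F (at (a, b)) (w, 0)"
proof -
  have "((\<lambda>z. (z, b)) has_derivative (\<lambda>w. (w, 0))) (at a)"
    by (auto intro!: derivative_eq_intros)
  from has_derivative_compose[OF this smooth_on_has_derivative[OF W]]
  show ?thesis using frechet_derivative_at by metis
qed

text \<open>The base point \<open>y\<close> does not move with \<open>u\<close>, so neither does the
  chart there; in coordinates the expression is a derivative of a smooth function in a constant
  direction. Smoothness of \<open>Ad\<close> and of left-invariant fields rests on this.\<close>

lemma smooth_near_partial2:
  fixes h :: "'a \<times> 'b \<Rightarrow> 'v::finite_dim_normed" and M :: "('a, 'e::finite_dim_normed) manifold"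
  assumes M: "charted M" and N: "charted N"
    and h: "smooth_near (prod_manifold M N) vec_manifold h (x, y)"
  shows "smooth_near M vec_manifold (\<lambda>u. tangent_map N vec_manifold (\<lambda>z. h (u, z)) y w) x"
proof -
  have p: "x \<in> points M" "y \<in> points N"
    using smooth_near_domain[OF charted_prod_manifold[OF M N] h] by auto
  define c where "c = chart_at M x"
  define d where "d = chart_at N y"
  have c: "c \<in> atlas M" "x \<in> fst c" unfolding c_def using chart_at[OF M p(1)] .
  have d: "d \<in> atlas N" "y \<in> fst d" unfolding d_def using chart_at[OF N p(2)] .
  define F where "F = (\<lambda>p. h (chart_inv c (fst p), chart_inv d (snd p)))"
  obtain W where W: "open W" "(snd c x, snd d y) \<in> W" "W \<subseteq> snd c ` fst c \<times> snd d ` fst d" "smooth_on W F"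
    unfolding F_def by (rule prod_chart_representation[OF M N h c d])
  define V where "V = (\<lambda>a. (a, snd d y)) -` W"
  have V: "open V" unfolding V_def
    by (intro open_vimage W continuous_intros)
  have "bounded_linear (\<lambda>a::'e. (a, 0))" by (intro bounded_linear_Pair bounded_linear_ident bounded_linear_zero)
  then have "smooth_on V (\<lambda>a. (a, 0) + (0, snd d y))"
    by (intro smooth_on_add V smooth_on_const smooth_on_bounded_linear)
  then have "smooth_on V (\<lambda>a. (a, snd d y))" by simp
  then have sm: "smooth_on V (\<lambda>a. frechet_derivative F (at (a, snd d y)) (0, w))"
    by (rule smooth_on_compose[OF V W(1) _ smooth_on_frechet_derivative[OF W(4)]]) (simp add: V_def)
  define U where "U = {u \<in> fst c. snd c u \<in> V}"
  have U: "openin (mtop M) U" "x \<in> U" "U \<subseteq> fst c"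
    unfolding U_def using charted_open_vimage[OF M c(1) V] c(2) W(2) by (auto simp: V_def)
  have oU: "open (snd c ` U)" by (rule charted_open_image[OF M c(1) U(1,3)])
  have eq: "tangent_map N vec_manifold (\<lambda>z. h (chart_inv c a, z)) y w =
      frechet_derivative F (at (a, snd d y)) (0, w)" if "a \<in> snd c ` U" for a
  proof -
    have "(a, snd d y) \<in> W" using that by (auto simp: U_def V_def)
    from frechet_derivative_section2[OF W(4) this, of w] show ?thesis
      by (simp add: tangent_map_vec F_def d_def)
  qed
  have "smooth_on (snd c ` U) (\<lambda>a. frechet_derivative F (at (a, snd d y)) (0, w))"
    by (rule smooth_on_subset[OF sm]) (auto simp: U_def)
  then have "smooth_on (snd c ` U) (\<lambda>a. tangent_map N vec_manifold (\<lambda>z. h (chart_inv c a, z)) y w)"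
    by (subst smooth_on_cong[OF oU eq])
  then show ?thesis by (rule smooth_near_vecI[OF c(1) U])
qed

text \<open>The target is a vector space, so the inner derivatives are again vector-valued functions
  that can be differentiated. In coordinates this is symmetry of the second derivative in the
  directions \<open>(v, 0)\<close> and \<open>(0, w)\<close>.\<close>

lemma tangent_map_partials_commute:
  fixes h :: "'a \<times> 'b \<Rightarrow> 'v::finite_dim_normed"
  assumes M: "charted M" and N: "charted N"
    and h: "smooth_near (prod_manifold M N) vec_manifold h (x, y)"
  shows "tangent_map M vec_manifold (\<lambda>u. tangent_map N vec_manifold (\<lambda>z. h (u, z)) y w) x v =
    tangent_map N vec_manifold (\<lambda>z. tangent_map M vec_manifold (\<lambda>u. h (u, z)) x v) y w"
proof -
  have p: "x \<in> points M" "y \<in> points N"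
    using smooth_near_domain[OF charted_prod_manifold[OF M N] h] by auto
  define c where "c = chart_at M x"
  define d where "d = chart_at N y"
  have c: "c \<in> atlas M" "x \<in> fst c" unfolding c_def using chart_at[OF M p(1)] .
  have d: "d \<in> atlas N" "y \<in> fst d" unfolding d_def using chart_at[OF N p(2)] .
  define F where "F = (\<lambda>p. h (chart_inv c (fst p), chart_inv d (snd p)))"
  obtain W where W: "open W" "(snd c x, snd d y) \<in> W" "W \<subseteq> snd c ` fst c \<times> snd d ` fst d" "smooth_on W F"
    unfolding F_def by (rule prod_chart_representation[OF M N h c d])
  have o1: "open ((\<lambda>a. (a, snd d y)) -` W)" and o2: "open ((\<lambda>b. (snd c x, b)) -` W)"
    by (intro open_vimage W continuous_intros)+
  have "tangent_map M vec_manifold (\<lambda>u. tangent_map N vec_manifold (\<lambda>z. h (u, z)) y w) x v =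
      frechet_derivative (\<lambda>a. frechet_derivative (\<lambda>b. F (a, b)) (at (snd d y)) w) (at (snd c x)) v"
    by (simp add: tangent_map_vec F_def c_def d_def)
  also have "frechet_derivative (\<lambda>a. frechet_derivative (\<lambda>b. F (a, b)) (at (snd d y)) w) (at (snd c x)) =
      frechet_derivative (\<lambda>a. frechet_derivative F (at (a, snd d y)) (0, w)) (at (snd c x))"
    by (rule frechet_derivative_cong[OF o1]) (use W frechet_derivative_section2[OF W(4)] in auto)
  also have "\<dots> v = frechet_derivative (\<lambda>p. frechet_derivative F (at p) (0, w)) (at (snd c x, snd d y)) (v, 0)"
    by (rule frechet_derivative_section1[OF smooth_on_frechet_derivative[OF W(4)] W(2)])
  also have "\<dots> = frechet_derivative (\<lambda>p. frechet_derivative F (at p) (v, 0)) (at (snd c x, snd d y)) (0, w)"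
    by (rule symmetric_second_derivative[OF W(1,2,4)])
  also have "\<dots> = frechet_derivative (\<lambda>b. frechet_derivative F (at (snd c x, b)) (v, 0)) (at (snd d y)) w"
    by (rule frechet_derivative_section2[OF smooth_on_frechet_derivative[OF W(4)] W(2), symmetric])
  also have "frechet_derivative (\<lambda>b. frechet_derivative F (at (snd c x, b)) (v, 0)) (at (snd d y)) =
      frechet_derivative (\<lambda>b. frechet_derivative (\<lambda>a. F (a, b)) (at (snd c x)) v) (at (snd d y))"
    by (rule frechet_derivative_cong[OF o2]) (use W frechet_derivative_section1[OF W(4)] in auto)
  also have "\<dots> w = tangent_map N vec_manifold (\<lambda>z. tangent_map M vec_manifold (\<lambda>u. h (u, z)) x v) y w"
    by (simp add: tangent_map_vec F_def c_def d_def)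
  finally show ?thesis .
qed

section \<open>Brackets and the adjoint representation\<close>

text \<open>\<open>Z\<close> reads a field in the chart at \<open>x\<close>, kept fixed while
  \<open>u\<close> moves; at \<open>x\<close> itself it changes nothing. The bracket becomes an
  expression in tangent maps, open to the chain rule and to the exchange of partials.\<close>

lemma vf_bracket_tangent_map:
  assumes M: "charted M" and x: "x \<in> points M"
  defines "Z \<equiv> \<lambda>X u. tangent_map M vec_manifold (snd (chart_at M x)) u (X u)"
  shows "vf_bracket M X Y x =
    tangent_map M vec_manifold (Z Y) x (X x) - tangent_map M vec_manifold (Z X) x (Y x)"
proof -
  have 1: "field_in_chart M (chart_at M x) X = (\<lambda>y. Z X (chart_inv (chart_at M x) y))" for X
    by (simp add: field_in_chart_def Z_def fun_eq_iff)
  have 2: "Z X (chart_inv (chart_at M x) (snd (chart_at M x) x)) = X x" for X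
    using chart_at[OF M x] M x by (simp add: Z_def tangent_map_chart_at)
  show ?thesis
    unfolding vf_bracket_def Let_def 1 2 tangent_map_vec by simp
qed

text \<open>For an action known only near one point: along both slices it remains smooth and inside
  a given chart domain, so that tangent maps may be composed there.\<close>

lemma smooth_near_pointwise_section:
  assumes M: "charted M" and N: "charted N" and L: "charted L"
    and h: "smooth_near (prod_manifold M N) L h (x, y)" and V: "openin (mtop L) V" "h (x, y) \<in> V"
  shows "\<exists>U. openin (mtop M) U \<and> x \<in> U \<and> (\<forall>u\<in>U. smooth_near (prod_manifold M N) L h (u, y) \<and> h (u, y) \<in> V)"
    and "\<exists>U. openin (mtop N) U \<and> y \<in> U \<and> (\<forall>u\<in>U. smooth_near (prod_manifold M N) L h (x, u) \<and> h (x, u) \<in> V)"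
proof -
  note MN = charted_prod_manifold[OF M N]
  have p: "x \<in> points M" "y \<in> points N" using smooth_near_domain[OF MN h] by auto
  obtain W where W: "openin (mtop (prod_manifold M N)) W" "(x, y) \<in> W"
    "\<forall>q\<in>W. smooth_near (prod_manifold M N) L h q"
    using smooth_near_eventually[OF h] by blast
  obtain W' where W': "openin (mtop (prod_manifold M N)) W'" "(x, y) \<in> W'" "\<forall>q\<in>W'. h q \<in> V"
    using smooth_near_continuous[OF MN L h V] by blast
  have o: "openin (mtop (prod_manifold M N)) (W \<inter> W')" using W(1) W'(1) by (rule openin_Int)
  have i: "(x, y) \<in> W \<inter> W'" using W W' by blast
  obtain U where "openin (mtop M) U" "x \<in> U" "\<forall>u\<in>U. (u, y) \<in> W \<inter> W'"
    using smooth_near_continuous[OF M MN smooth_near_Pair1[OF M N p] o i] by blast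
  then show "\<exists>U. openin (mtop M) U \<and> x \<in> U \<and> (\<forall>u\<in>U. smooth_near (prod_manifold M N) L h (u, y) \<and> h (u, y) \<in> V)"
    using W(3) W'(3) by blast
  obtain U where "openin (mtop N) U" "y \<in> U" "\<forall>u\<in>U. (x, u) \<in> W \<inter> W'"
    using smooth_near_continuous[OF N MN smooth_near_Pair2[OF M N p] o i] by blast
  then show "\<exists>U. openin (mtop N) U \<and> y \<in> U \<and> (\<forall>u\<in>U. smooth_near (prod_manifold M N) L h (x, u) \<and> h (x, u) \<in> V)"
    using W(3) W'(3) by blast
qed

text \<open>\<open>a\<close> is a right action on \<open>P\<close>, given only near \<open>(x, e)\<close>. It is applied to the bundle with the
  fields of a Cartan connection, and to a Lie group acting on itself with the left-invariant fields.\<close>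

lemma bracket_of_equivariant_fields:
  fixes P :: "('p, 'ep::finite_dim_normed) manifold" and N :: "('g, 'eg::finite_dim_normed) manifold"
    and \<zeta> :: "'w::finite_dim_normed \<Rightarrow> 'p \<Rightarrow> 'ep" and \<beta> :: "'g \<Rightarrow> 'w"
  assumes P: "charted P" and N: "charted N"
    and a: "smooth_near (prod_manifold P N) P (\<lambda>p. a (fst p) (snd p)) (x, e)"
    and unit: "\<And>u. u \<in> points P \<Longrightarrow> a u e = u"
    and lin: "\<And>u. u \<in> points P \<Longrightarrow> linear (\<lambda>w. \<zeta> w u)"
    and smooth: "\<And>w. smooth_near P vec_manifold
      (\<lambda>u. tangent_map P vec_manifold (snd (chart_at P x)) u (\<zeta> w u)) x"
    and gen: "\<And>u. u \<in> points P \<Longrightarrow> \<zeta> w0 u = tangent_map N P (a u) e Y"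
    and equiv: "\<And>g. g \<in> points N \<Longrightarrow> tangent_map P P (\<lambda>u. a u g) x (\<zeta> (\<beta> e) x) = \<zeta> (\<beta> g) (a x g)"
    and \<beta>: "smooth_near N vec_manifold \<beta> e"
  shows "vf_bracket P (\<zeta> (\<beta> e)) (\<zeta> w0) x = \<zeta> (tangent_map N vec_manifold \<beta> e Y) x"
proof -
  note PN = charted_prod_manifold[OF P N]
  have x: "x \<in> points P" and e: "e \<in> points N" using smooth_near_domain[OF PN a] by auto
  define c where "c = chart_at P x"
  have c: "c \<in> atlas P" "x \<in> fst c" unfolding c_def using chart_at[OF P x] .
  have axe: "a x e = x" using unit[OF x] .
  define Z where "Z w u = tangent_map P vec_manifold (snd c) u (\<zeta> w u)" for w u
  have Zx: "Z w x = \<zeta> w x" for w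
    by (simp add: Z_def c_def tangent_map_chart_at P x)
  \<comment> \<open>The action read in the chart at \<open>x\<close>: it is vector-valued, so its
    mixed partials at \<open>(x, e)\<close> can be exchanged.\<close>
  define h where "h p = snd c (a (fst p) (snd p))" for p
  have axc: "a (fst (x, e)) (snd (x, e)) \<in> fst c" using axe c by simp
  have h: "smooth_near (prod_manifold P N) vec_manifold h (x, e)"
    unfolding h_def
    by (rule smooth_near_compose[OF PN P charted_vec_manifold a smooth_near_chart[OF P c(1) axc]])
  obtain U where U: "openin (mtop P) U" "x \<in> U"
    "\<forall>u\<in>U. smooth_near (prod_manifold P N) P (\<lambda>p. a (fst p) (snd p)) (u, e) \<and>
      a (fst (u, e)) (snd (u, e)) \<in> fst c"
    using smooth_near_pointwise_section(1)[OF P N P a charted_chart_open[OF P c(1)] axc] by blast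
  obtain V where V: "openin (mtop N) V" "e \<in> V"
    "\<forall>g\<in>V. smooth_near (prod_manifold P N) P (\<lambda>p. a (fst p) (snd p)) (x, g) \<and>
      a (fst (x, g)) (snd (x, g)) \<in> fst c"
    using smooth_near_pointwise_section(2)[OF P N P a charted_chart_open[OF P c(1)] axc] by blast
  \<comment> \<open>One partial of \<open>h\<close> is the field of \<open>w0\<close> at moving
    points, by \<open>gen\<close>; the other, in \<open>2\<close>, is the field of
    \<open>\<beta> g\<close> at \<open>a x g\<close>, by \<open>equiv\<close>.\<close>
  have 1: "tangent_map N vec_manifold (\<lambda>z. h (u, z)) e Y = Z w0 u" if u: "u \<in> U" for u
  proof -
    have up: "u \<in> points P" using openin_subset[OF U(1)] u by blast
    have s: "smooth_near (prod_manifold P N) P (\<lambda>p. a (fst p) (snd p)) (u, e)"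
      and uc: "a u e \<in> fst c" using U(3) u by auto
    have s': "smooth_near N P (\<lambda>z. a u z) e"
      using smooth_near_section2[OF P N P s] by simp
    have "tangent_map N vec_manifold (\<lambda>z. snd c (a u z)) e Y =
        tangent_map P vec_manifold (snd c) (a u e) (tangent_map N P (\<lambda>z. a u z) e Y)"
      by (rule tangent_map_compose[OF N P charted_vec_manifold s' smooth_near_chart[OF P c(1) uc]])
    then show ?thesis using gen[OF up] unit[OF up] by (simp add: h_def Z_def)
  qed
  have 2: "tangent_map P vec_manifold (\<lambda>u. h (u, g)) x (\<zeta> (\<beta> e) x) = Z (\<beta> g) (a x g)" if g: "g \<in> V" for g
  proof -
    have gp: "g \<in> points N" using openin_subset[OF V(1)] g by blast
    have s: "smooth_near (prod_manifold P N) P (\<lambda>p. a (fst p) (snd p)) (x, g)"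
      and xc: "a x g \<in> fst c" using V(3) g by auto
    have s': "smooth_near P P (\<lambda>u. a u g) x"
      using smooth_near_section1[OF P N P s] by simp
    have "tangent_map P vec_manifold (\<lambda>u. snd c (a u g)) x (\<zeta> (\<beta> e) x) =
        tangent_map P vec_manifold (snd c) (a x g) (tangent_map P P (\<lambda>u. a u g) x (\<zeta> (\<beta> e) x))"
      by (rule tangent_map_compose[OF P P charted_vec_manifold s' smooth_near_chart[OF P c(1) xc]])
    then show ?thesis using equiv[OF gp] by (simp add: h_def Z_def)
  qed
  \<comment> \<open>Separates the point from the index of the field, so that
    \<open>k (a x g, \<beta> g)\<close> can be differentiated in each place. Joint smoothness of
    \<open>k\<close> comes from linearity in the index and an expansion in a basis.\<close>
  define k where "k p = Z (snd p) (fst p)" for p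
  have linZ: "linear (\<lambda>w. Z w u)" if "u \<in> fst c" for u
    using linear_compose[OF lin linear_tangent_map[OF P charted_vec_manifold smooth_near_chart[OF P c(1) that]]]
      charted_points[OF P c(1) that]
    by (simp add: Z_def comp_def)
  have Pv: "charted (prod_manifold P (vec_manifold :: ('w, 'w) manifold))"
    by (rule charted_prod_manifold[OF P charted_vec_manifold])
  have k: "smooth_near (prod_manifold P vec_manifold) vec_manifold k (x, \<beta> e)"
  proof (rule smooth_near_cong[OF Pv])
    show "smooth_near (prod_manifold P vec_manifold) vec_manifold
      (\<lambda>p. \<Sum>b\<in>fin_basis. coord b (snd p) *\<^sub>R Z b (fst p)) (x, \<beta> e)"
    proof (rule smooth_near_sum[OF Pv])
      fix b :: 'w
      have 1: "smooth_near (prod_manifold P vec_manifold) vec_manifold (\<lambda>p. coord b (snd p)) (x, \<beta> e)"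
        by (rule smooth_near_bounded_linear[OF Pv smooth_near_snd[OF P charted_vec_manifold x] linear_coord])
          simp
      have "smooth_near P vec_manifold (Z b) (fst (x, \<beta> e))"
        using smooth[of b] by (simp add: Z_def[abs_def] c_def)
      then have 2: "smooth_near (prod_manifold P vec_manifold) vec_manifold (\<lambda>p. Z b (fst p)) (x, \<beta> e)"
        by (intro smooth_near_compose[OF Pv P charted_vec_manifold smooth_near_fst[OF P charted_vec_manifold x]])
          simp_all
      show "smooth_near (prod_manifold P vec_manifold) vec_manifold (\<lambda>p. coord b (snd p) *\<^sub>R Z b (fst p)) (x, \<beta> e)"
        by (rule smooth_near_scaleR[OF Pv 1 2])
    qed (simp add: x)
    show "openin (mtop (prod_manifold P vec_manifold)) (fst c \<times> UNIV)"
      using charted_chart_open[OF P c(1)] by (simp add: openin_prod_Times_iff)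
    show "(x, \<beta> e) \<in> fst c \<times> UNIV" using c by simp
    show "(\<Sum>b\<in>fin_basis. coord b (snd p) *\<^sub>R Z b (fst p)) = k p" if "p \<in> fst c \<times> UNIV" for p
      using linear_coord_expansion[OF linZ, of "fst p" "snd p"] that by (auto simp: k_def)
  qed
  have ax: "smooth_near N P (a x) e"
    using smooth_near_section2[OF P N P a] by simp
  \<comment> \<open>Exchanging the partials of \<open>h\<close> turns the first term of the bracket
    into the second one plus the contribution of \<open>\<beta>\<close>.\<close>
  have "tangent_map P vec_manifold (Z w0) x (\<zeta> (\<beta> e) x) =
      tangent_map P vec_manifold (\<lambda>u. tangent_map N vec_manifold (\<lambda>z. h (u, z)) e Y) x (\<zeta> (\<beta> e) x)"
    by (subst tangent_map_cong[OF P U(1,2) 1]) simp_all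
  also have "\<dots> = tangent_map N vec_manifold (\<lambda>z. tangent_map P vec_manifold (\<lambda>u. h (u, z)) x (\<zeta> (\<beta> e) x)) e Y"
    by (rule tangent_map_partials_commute[OF P N h])
  also have "\<dots> = tangent_map N vec_manifold (\<lambda>g. k (a x g, \<beta> g)) e Y"
    by (subst tangent_map_cong[OF N V(1,2) 2]) (simp_all add: k_def)
  also have "\<dots> = tangent_map P vec_manifold (\<lambda>u. k (u, \<beta> e)) (a x e) (tangent_map N P (a x) e Y)
      + tangent_map vec_manifold vec_manifold (\<lambda>w. k (a x e, w)) (\<beta> e) (tangent_map N vec_manifold \<beta> e Y)"
    by (rule tangent_map_compose2[OF N P charted_vec_manifold charted_vec_manifold ax \<beta>]) (simp add: axe k)
  also have "tangent_map vec_manifold vec_manifold (\<lambda>w. k (a x e, w)) (\<beta> e) (tangent_map N vec_manifold \<beta> e Y)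
      = Z (tangent_map N vec_manifold \<beta> e Y) x"
    using tangent_map_linear[OF linZ[OF c(2)]] by (simp add: k_def axe)
  also have "tangent_map P vec_manifold (\<lambda>u. k (u, \<beta> e)) (a x e) (tangent_map N P (a x) e Y) =
      tangent_map P vec_manifold (Z (\<beta> e)) x (\<zeta> w0 x)"
    by (simp add: k_def axe gen[OF x])
  finally show ?thesis
    unfolding vf_bracket_tangent_map[OF P x] c_def[symmetric]
    by (simp add: Z_def[symmetric, abs_def] Zx)
qed

section \<open>Lie groups and the adjoint representation\<close>

lemma lie_groupD:
  assumes "lie_group G"
  shows "group G" "charted (mfd G)" "points (mfd G) = carrier G"
  using assms by (auto simp: lie_group_def smooth_manifold_charted)

lemma lie_group_mult_smooth:
  assumes G: "lie_group G" and "x \<in> carrier G" "y \<in> carrier G"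
  shows "smooth_near (prod_manifold (mfd G) (mfd G)) (mfd G) (\<lambda>p. fst p \<otimes>\<^bsub>G\<^esub> snd p) (x, y)"
  using smooth_map_imp_smooth_near[OF charted_prod_manifold[OF lie_groupD(2)[OF G] lie_groupD(2)[OF G]] lie_groupD(2)[OF G],
      of "\<lambda>p. fst p \<otimes>\<^bsub>G\<^esub> snd p" "(x, y)"] assms
  by (simp add: lie_group_def case_prod_unfold)

lemma smooth_near_mult:
  assumes G: "lie_group G" and M: "charted M"
    and f: "smooth_near M (mfd G) f x" and g: "smooth_near M (mfd G) g x"
  shows "smooth_near M (mfd G) (\<lambda>x. f x \<otimes>\<^bsub>G\<^esub> g x) x"
proof -
  note c = lie_groupD(2)[OF G]
  have "f x \<in> carrier G" "g x \<in> carrier G"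
    using smooth_near_codomain[OF c f] smooth_near_codomain[OF c g] lie_groupD(3)[OF G] by auto
  from smooth_near_compose[OF M charted_prod_manifold[OF c c] c smooth_near_Pair[OF M c c f g]
      lie_group_mult_smooth[OF G this]]
  show ?thesis by simp
qed

lemma smooth_near_m_inv:
  assumes G: "lie_group G" and M: "charted M" and f: "smooth_near M (mfd G) f x"
  shows "smooth_near M (mfd G) (\<lambda>x. m_inv G (f x)) x"
proof -
  note c = lie_groupD(2)[OF G]
  have "smooth_map (mfd G) (mfd G) (m_inv G)" using G by (simp add: lie_group_def)
  from smooth_near_compose[OF M c c f smooth_map_imp_smooth_near[OF c c this smooth_near_codomain[OF c f]]]
  show ?thesis .
qed

lemma smooth_near_left_mult:
  assumes G: "lie_group G" and "x \<in> carrier G" "y \<in> carrier G"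
  shows "smooth_near (mfd G) (mfd G) (\<lambda>z. x \<otimes>\<^bsub>G\<^esub> z) y"
  using assms lie_groupD[OF G]
  by (intro smooth_near_mult smooth_near_const smooth_near_ident) auto

lemma smooth_near_conj:
  assumes G: "lie_group G" and "g \<in> carrier G" "y \<in> carrier G"
  shows "smooth_near (mfd G) (mfd G) (\<lambda>x. g \<otimes>\<^bsub>G\<^esub> x \<otimes>\<^bsub>G\<^esub> m_inv G g) y"
  using assms lie_groupD[OF G] group.inv_closed[OF lie_groupD(1)[OF G]]
  by (intro smooth_near_mult smooth_near_const smooth_near_ident) auto

lemma linear_Ad:
  assumes G: "lie_group G" and g: "g \<in> carrier G"
  shows "linear (Ad G g)"
  unfolding Ad_def
  using group.is_monoid[OF lie_groupD(1)[OF G]]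
  by (intro linear_tangent_map lie_groupD[OF G] smooth_near_conj[OF G g]) (simp add: monoid.one_closed)

lemma conj_one:
  assumes G: "group G" and g: "g \<in> carrier G"
  shows "g \<otimes>\<^bsub>G\<^esub> \<one>\<^bsub>G\<^esub> \<otimes>\<^bsub>G\<^esub> m_inv G g = \<one>\<^bsub>G\<^esub>"
proof -
  interpret group G by (rule G)
  show ?thesis using g by simp
qed

lemma Ad_mult:
  assumes G: "lie_group G" and g: "g \<in> carrier G" "h \<in> carrier G"
  shows "Ad G (g \<otimes>\<^bsub>G\<^esub> h) X = Ad G g (Ad G h X)"
proof -
  interpret group G using lie_groupD(1)[OF G] .
  note c = lie_groupD(2)[OF G] and p = lie_groupD(3)[OF G]
  have s: "smooth_near (mfd G) (mfd G) (\<lambda>x. g \<otimes>\<^bsub>G\<^esub> x \<otimes>\<^bsub>G\<^esub> m_inv G g) (h \<otimes>\<^bsub>G\<^esub> \<one>\<^bsub>G\<^esub> \<otimes>\<^bsub>G\<^esub> m_inv G h)"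
    using smooth_near_conj[OF G g(1)] g by simp
  have "openin (mtop (mfd G)) (carrier G)" using p openin_topspace by metis
  then have "Ad G (g \<otimes>\<^bsub>G\<^esub> h) = tangent_map (mfd G) (mfd G)
      (\<lambda>x. g \<otimes>\<^bsub>G\<^esub> (h \<otimes>\<^bsub>G\<^esub> x \<otimes>\<^bsub>G\<^esub> m_inv G h) \<otimes>\<^bsub>G\<^esub> m_inv G g) \<one>\<^bsub>G\<^esub>"
    unfolding Ad_def by (rule tangent_map_cong[OF c]) (use g in \<open>simp_all add: inv_mult_group m_assoc\<close>)
  then have "Ad G (g \<otimes>\<^bsub>G\<^esub> h) X = tangent_map (mfd G) (mfd G) (\<lambda>x. g \<otimes>\<^bsub>G\<^esub> x \<otimes>\<^bsub>G\<^esub> m_inv G g)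
      (h \<otimes>\<^bsub>G\<^esub> \<one>\<^bsub>G\<^esub> \<otimes>\<^bsub>G\<^esub> m_inv G h) (Ad G h X)"
    using tangent_map_compose[OF c c c smooth_near_conj[OF G g(2) one_closed] s, of X]
    by (simp only: Ad_def[of G h])
  then show ?thesis using conj_one[OF is_group g(2)] by (simp add: Ad_def)
qed

lemma Ad_one:
  assumes G: "lie_group G"
  shows "Ad G \<one>\<^bsub>G\<^esub> X = X"
proof -
  interpret group G using lie_groupD(1)[OF G] .
  note c = lie_groupD(2)[OF G] and p = lie_groupD(3)[OF G]
  have "openin (mtop (mfd G)) (carrier G)" using p openin_topspace by metis
  then have "Ad G \<one>\<^bsub>G\<^esub> = tangent_map (mfd G) (mfd G) (\<lambda>x. x) \<one>\<^bsub>G\<^esub>"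
    unfolding Ad_def by (rule tangent_map_cong[OF c]) simp_all
  then show ?thesis using tangent_map_ident[OF c] p by simp
qed

text \<open>Conjugation fixes the identity, so every \<open>Ad G g\<close> is a partial derivative
  at one fixed point with values at that same point; one chart \<open>k\<close> there reads them
  all, and it leaves their components unchanged.\<close>

lemma smooth_near_Ad:
  assumes G: "lie_group G" and g: "g \<in> carrier G"
  shows "smooth_near (mfd G) vec_manifold (\<lambda>g. Ad G g X) g"
proof -
  interpret group G using lie_groupD(1)[OF G] .
  note c = lie_groupD(2)[OF G] and p = lie_groupD(3)[OF G]
  note cc = charted_prod_manifold[OF c c]
  define k where "k = chart_at (mfd G) \<one>\<^bsub>G\<^esub>"
  have k: "k \<in> atlas (mfd G)" "\<one>\<^bsub>G\<^esub> \<in> fst k"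
    unfolding k_def using chart_at[OF c] p by auto
  have o: "openin (mtop (mfd G)) (carrier G)" using p openin_topspace by metis
  have f: "smooth_near (prod_manifold (mfd G) (mfd G)) (mfd G) fst (g, \<one>\<^bsub>G\<^esub>)"
    and s: "smooth_near (prod_manifold (mfd G) (mfd G)) (mfd G) snd (g, \<one>\<^bsub>G\<^esub>)"
    using smooth_near_fst[OF c c] smooth_near_snd[OF c c] g p by auto
  have "smooth_near (prod_manifold (mfd G) (mfd G)) vec_manifold
      (\<lambda>q. snd k (fst q \<otimes>\<^bsub>G\<^esub> snd q \<otimes>\<^bsub>G\<^esub> m_inv G (fst q))) (g, \<one>\<^bsub>G\<^esub>)"
    by (rule smooth_near_compose[OF cc c charted_vec_manifold
          smooth_near_mult[OF G cc smooth_near_mult[OF G cc f s] smooth_near_m_inv[OF G cc f]]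
          smooth_near_chart[OF c k(1)]])
      (simp add: g k)
  from smooth_near_partial2[OF c c this, of X]
  have "smooth_near (mfd G) vec_manifold
      (\<lambda>g. tangent_map (mfd G) vec_manifold (\<lambda>x. snd k (g \<otimes>\<^bsub>G\<^esub> x \<otimes>\<^bsub>G\<^esub> m_inv G g)) \<one>\<^bsub>G\<^esub> X) g"
    by simp
  then show ?thesis
  proof (rule smooth_near_cong[OF c _ o g])
    fix g assume g: "g \<in> carrier G"
    have e: "g \<otimes>\<^bsub>G\<^esub> \<one>\<^bsub>G\<^esub> \<otimes>\<^bsub>G\<^esub> m_inv G g = \<one>\<^bsub>G\<^esub>" using g by simp
    have "tangent_map (mfd G) vec_manifold (\<lambda>x. snd k (g \<otimes>\<^bsub>G\<^esub> x \<otimes>\<^bsub>G\<^esub> m_inv G g)) \<one>\<^bsub>G\<^esub> X =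
        tangent_map (mfd G) vec_manifold (snd k) (g \<otimes>\<^bsub>G\<^esub> \<one>\<^bsub>G\<^esub> \<otimes>\<^bsub>G\<^esub> m_inv G g) (Ad G g X)"
      unfolding Ad_def
      by (rule tangent_map_compose[OF c c charted_vec_manifold smooth_near_conj[OF G g one_closed]
            smooth_near_chart[OF c k(1)]]) (simp only: e k)
    also have "\<dots> = Ad G g X"
      unfolding e k_def by (rule tangent_map_chart_at[OF c]) (simp add: p)
    finally show "tangent_map (mfd G) vec_manifold (\<lambda>x. snd k (g \<otimes>\<^bsub>G\<^esub> x \<otimes>\<^bsub>G\<^esub> m_inv G g)) \<one>\<^bsub>G\<^esub> X = Ad G g X" .
  qed
qed

lemma smooth_near_Ad_inv:
  assumes G: "lie_group G" and g: "g \<in> carrier G"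
  shows "smooth_near (mfd G) vec_manifold (\<lambda>g. Ad G (m_inv G g) X) g"
proof -
  interpret group G using lie_groupD(1)[OF G] .
  note c = lie_groupD(2)[OF G] and p = lie_groupD(3)[OF G]
  show ?thesis
    by (rule smooth_near_compose[OF c c charted_vec_manifold
          smooth_near_m_inv[OF G c smooth_near_ident[OF c]] smooth_near_Ad[OF G]]) (use g p in auto)
qed

lemma left_invariant_field_one:
  assumes G: "lie_group G"
  shows "left_invariant_field G X \<one>\<^bsub>G\<^esub> = X"
proof -
  interpret group G using lie_groupD(1)[OF G] .
  note c = lie_groupD(2)[OF G] and p = lie_groupD(3)[OF G]
  have "openin (mtop (mfd G)) (carrier G)" using p openin_topspace by metis
  then have "tangent_map (mfd G) (mfd G) (\<lambda>x. \<one>\<^bsub>G\<^esub> \<otimes>\<^bsub>G\<^esub> x) \<one>\<^bsub>G\<^esub> =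
      tangent_map (mfd G) (mfd G) (\<lambda>x. x) \<one>\<^bsub>G\<^esub>"
    by (rule tangent_map_cong[OF c]) simp_all
  then show ?thesis using tangent_map_ident[OF c] p by (simp add: left_invariant_field_def)
qed

text \<open>Again a partial derivative at the identity, now of the multiplication. Its value sits at
  the moving point \<open>u\<close>, hence the fixed chart \<open>k\<close> on the outside.\<close>

lemma smooth_near_left_invariant_field:
  assumes G: "lie_group G" and k: "k \<in> atlas (mfd G)" and x: "x \<in> fst k"
  shows "smooth_near (mfd G) vec_manifold
    (\<lambda>u. tangent_map (mfd G) vec_manifold (snd k) u (left_invariant_field G X u)) x"
proof -
  interpret group G using lie_groupD(1)[OF G] .
  note c = lie_groupD(2)[OF G] and p = lie_groupD(3)[OF G]
  note cc = charted_prod_manifold[OF c c]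
  have sub: "u \<in> carrier G" if "u \<in> fst k" for u using charted_points[OF c k that] p by simp
  have "smooth_near (prod_manifold (mfd G) (mfd G)) vec_manifold
      (\<lambda>q. snd k (fst q \<otimes>\<^bsub>G\<^esub> snd q)) (x, \<one>\<^bsub>G\<^esub>)"
    by (rule smooth_near_compose[OF cc c charted_vec_manifold lie_group_mult_smooth[OF G sub[OF x] one_closed]
          smooth_near_chart[OF c k]]) (simp add: x sub)
  from smooth_near_partial2[OF c c this, of X]
  have "smooth_near (mfd G) vec_manifold
      (\<lambda>u. tangent_map (mfd G) vec_manifold (\<lambda>z. snd k (u \<otimes>\<^bsub>G\<^esub> z)) \<one>\<^bsub>G\<^esub> X) x"
    by simp
  then show ?thesis
  proof (rule smooth_near_cong[OF c _ charted_chart_open[OF c k] x])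
    fix u assume u: "u \<in> fst k"
    have e: "u \<otimes>\<^bsub>G\<^esub> \<one>\<^bsub>G\<^esub> = u" using sub[OF u] by simp
    have "tangent_map (mfd G) vec_manifold (\<lambda>z. snd k (u \<otimes>\<^bsub>G\<^esub> z)) \<one>\<^bsub>G\<^esub> X =
        tangent_map (mfd G) vec_manifold (snd k) (u \<otimes>\<^bsub>G\<^esub> \<one>\<^bsub>G\<^esub>) (left_invariant_field G X u)"
      unfolding left_invariant_field_def
      by (rule tangent_map_compose[OF c c charted_vec_manifold smooth_near_left_mult[OF G sub[OF u] one_closed]
            smooth_near_chart[OF c k]]) (simp only: e u)
    then show "tangent_map (mfd G) vec_manifold (\<lambda>z. snd k (u \<otimes>\<^bsub>G\<^esub> z)) \<one>\<^bsub>G\<^esub> X =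
        tangent_map (mfd G) vec_manifold (snd k) u (left_invariant_field G X u)"
      unfolding e .
  qed
qed

text \<open>In classical terms this is \<open>[X, Y] = - ad Y X\<close>. The inverse appears because
  right translation by \<open>g\<close> carries the left-invariant field of \<open>X\<close> to that
  of \<open>Ad G (m_inv G g) X\<close>.\<close>

lemma lie_algebra_bracket_eq_derivative_Ad:
  assumes G: "lie_group G"
  shows "lie_algebra_bracket G X Y = tangent_map (mfd G) vec_manifold (\<lambda>g. Ad G (m_inv G g) X) \<one>\<^bsub>G\<^esub> Y"
proof -
  interpret group G using lie_groupD(1)[OF G] .
  note c = lie_groupD(2)[OF G] and p = lie_groupD(3)[OF G]
  define k where "k = chart_at (mfd G) \<one>\<^bsub>G\<^esub>"
  have k: "k \<in> atlas (mfd G)" "\<one>\<^bsub>G\<^esub> \<in> fst k"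
    unfolding k_def using chart_at[OF c] p by auto
  have o: "openin (mtop (mfd G)) (carrier G)" using p openin_topspace by metis
  define \<beta> where "\<beta> g = Ad G (m_inv G g) X" for g
  have \<beta>1: "\<beta> \<one>\<^bsub>G\<^esub> = X" by (simp add: \<beta>_def Ad_one[OF G])
  have "vf_bracket (mfd G) (left_invariant_field G (\<beta> \<one>\<^bsub>G\<^esub>)) (left_invariant_field G Y) \<one>\<^bsub>G\<^esub> =
      left_invariant_field G (tangent_map (mfd G) vec_manifold \<beta> \<one>\<^bsub>G\<^esub> Y) \<one>\<^bsub>G\<^esub>"
  proof (rule bracket_of_equivariant_fields[OF c c lie_group_mult_smooth[OF G one_closed one_closed]])
    show "u \<otimes>\<^bsub>G\<^esub> \<one>\<^bsub>G\<^esub> = u" if "u \<in> points (mfd G)" for u using that p by simp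
    show "linear (\<lambda>w. left_invariant_field G w u)" if "u \<in> points (mfd G)" for u
      unfolding left_invariant_field_def
      using linear_tangent_map[OF c c smooth_near_left_mult[OF G _ one_closed]] that p by simp
    show "smooth_near (mfd G) vec_manifold (\<lambda>u. tangent_map (mfd G) vec_manifold
        (snd (chart_at (mfd G) \<one>\<^bsub>G\<^esub>)) u (left_invariant_field G w u)) \<one>\<^bsub>G\<^esub>" for w
      using smooth_near_left_invariant_field[OF G k] by (simp add: k_def)
    show "left_invariant_field G Y u = tangent_map (mfd G) (mfd G) (\<lambda>x. u \<otimes>\<^bsub>G\<^esub> x) \<one>\<^bsub>G\<^esub> Y" for u
      by (simp add: left_invariant_field_def)
    show "smooth_near (mfd G) vec_manifold \<beta> \<one>\<^bsub>G\<^esub>"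
      unfolding \<beta>_def by (rule smooth_near_Ad_inv[OF G one_closed])
    fix g assume "g \<in> points (mfd G)"
    then have g: "g \<in> carrier G" "m_inv G g \<in> carrier G" using p by auto
    have e: "m_inv G g \<otimes>\<^bsub>G\<^esub> \<one>\<^bsub>G\<^esub> \<otimes>\<^bsub>G\<^esub> m_inv G (m_inv G g) = \<one>\<^bsub>G\<^esub>" using g by simp
    \<comment> \<open>Right translation by \<open>g\<close> is conjugation by the inverse followed
      by left translation by \<open>g\<close>; this yields the required equivariance.\<close>
    have "tangent_map (mfd G) (mfd G) (\<lambda>u. u \<otimes>\<^bsub>G\<^esub> g) \<one>\<^bsub>G\<^esub> X =
       tangent_map (mfd G) (mfd G) (\<lambda>u. g \<otimes>\<^bsub>G\<^esub> (m_inv G g \<otimes>\<^bsub>G\<^esub> u \<otimes>\<^bsub>G\<^esub> m_inv G (m_inv G g))) \<one>\<^bsub>G\<^esub> X"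
      by (subst tangent_map_cong[OF c o]) (use g in \<open>simp_all add: m_assoc[symmetric]\<close>)
    also have "\<dots> = tangent_map (mfd G) (mfd G) (\<lambda>u. g \<otimes>\<^bsub>G\<^esub> u)
        (m_inv G g \<otimes>\<^bsub>G\<^esub> \<one>\<^bsub>G\<^esub> \<otimes>\<^bsub>G\<^esub> m_inv G (m_inv G g)) (\<beta> g)"
      unfolding \<beta>_def Ad_def
      by (rule tangent_map_compose[OF c c c smooth_near_conj[OF G g(2) one_closed]])
        (simp only: e smooth_near_left_mult[OF G g(1) one_closed])
    also have "\<dots> = left_invariant_field G (\<beta> g) (\<one>\<^bsub>G\<^esub> \<otimes>\<^bsub>G\<^esub> g)"
      unfolding e left_invariant_field_def using g by simp
    finally show "tangent_map (mfd G) (mfd G) (\<lambda>u. u \<otimes>\<^bsub>G\<^esub> g) \<one>\<^bsub>G\<^esub>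
        (left_invariant_field G (\<beta> \<one>\<^bsub>G\<^esub>) \<one>\<^bsub>G\<^esub>) = left_invariant_field G (\<beta> g) (\<one>\<^bsub>G\<^esub> \<otimes>\<^bsub>G\<^esub> g)"
      by (simp add: \<beta>1 left_invariant_field_one[OF G])
  qed
  then show ?thesis
    unfolding lie_algebra_bracket_def \<beta>1 left_invariant_field_one[OF G]
    by (simp add: \<beta>_def[abs_def])
qed

section \<open>One-parameter subgroups\<close>

text \<open>No single chart need contain the curve, so vanishing velocity is first turned into local
  constancy, on a ball mapped into one chart domain; connectedness of \<open>I\<close> does the
  rest.\<close>

lemma zero_velocity_imp_constant:
  fixes d :: "real \<Rightarrow> 'a"
  assumes M: "charted M" and I: "open I" "connected I" "s \<in> I" "t \<in> I"
    and d: "\<And>t. t \<in> I \<Longrightarrow> smooth_near vec_manifold M d t"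
    and zero: "\<And>t. t \<in> I \<Longrightarrow> tangent_map vec_manifold M d t 1 = 0"
  shows "d s = d t"
proof (rule connected_local_const[OF I(2,3,4)], intro ballI)
  fix a assume a: "a \<in> I"
  define k where "k = chart_at M (d a)"
  have k: "k \<in> atlas M" "d a \<in> fst k"
    unfolding k_def using chart_at[OF M smooth_near_codomain[OF M d[OF a]]] .
  obtain U where U: "openin (mtop vec_manifold) U" "a \<in> U" "\<forall>u\<in>U. d u \<in> fst k"
    using smooth_near_continuous[OF charted_vec_manifold M d[OF a] charted_chart_open[OF M k(1)] k(2)] by blast
  have "open (U \<inter> I)" using U(1) I(1) by auto
  moreover have "a \<in> U \<inter> I" using U(2) a by blast
  ultimately obtain r where r: "r > 0" "ball a r \<subseteq> U \<inter> I"
    unfolding open_contains_ball by blast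
  have der: "((\<lambda>u. snd k (d u)) has_derivative (\<lambda>h. 0)) (at u within ball a r)" if u: "u \<in> ball a r" for u
  proof -
    have ui: "u \<in> I" and uk: "d u \<in> fst k" using r(2) u U(3) by auto
    note s = d[OF ui] and sk = smooth_near_chart[OF M k(1) uk]
    note lin = linear_tangent_map[OF charted_vec_manifold M s]
    have "tangent_map vec_manifold M d u h = 0" for h
      using linear_scale[OF lin, of h 1] zero[OF ui] by simp
    then have "tangent_map vec_manifold vec_manifold (\<lambda>u. snd k (d u)) u h = 0" for h
      using tangent_map_compose[OF charted_vec_manifold M charted_vec_manifold s sk, of h]
        linear_0[OF linear_tangent_map[OF M charted_vec_manifold sk]] by simp
    then have "tangent_map vec_manifold vec_manifold (\<lambda>u. snd k (d u)) u = (\<lambda>h. 0)" by (rule ext)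
    then show ?thesis
      using tangent_map_has_derivative[OF charted_vec_manifold charted_vec_manifold
          smooth_near_compose[OF charted_vec_manifold M charted_vec_manifold s sk]]
      by (simp add: has_derivative_at_withinI)
  qed
  have eq: "d a = d b" if b: "b \<in> ball a r" for b
  proof -
    obtain z where z: "\<And>u. u \<in> ball a r \<Longrightarrow> snd k (d u) = z"
      using has_derivative_zero_constant[OF convex_ball der] by blast
    have "snd k (d b) = snd k (d a)" using z[OF b] z[of a] r(1) by simp
    moreover have "d b \<in> fst k" using b r(2) U(3) by blast
    ultimately show ?thesis using k(2) is_chart_inj[OF charted_chart[OF M k(1)]] by (simp add: inj_on_def)
  qed
  show "\<forall>\<^sub>F b in at a within I. d a = d b"
    unfolding eventually_at
    by (intro exI[of _ r] conjI r(1) ballI impI eq) (simp add: dist_commute)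
qed

text \<open>Imposed at a single time, so that curves which solve the equation only on an interval
  need no domain of their own.\<close>

definition solves_left_invariant ::
    "('g, 'e::finite_dim_normed) lie_group_data \<Rightarrow> 'e \<Rightarrow> (real \<Rightarrow> 'g) \<Rightarrow> real \<Rightarrow> bool" where
  "solves_left_invariant G X a t \<longleftrightarrow> smooth_near vec_manifold (mfd G) a t \<and>
     tangent_map vec_manifold (mfd G) a t 1 = left_invariant_field G X (a t)"

text \<open>The velocity of \<open>a b\<^sup>-\<^sup>1\<close> is that of \<open>z \<mapsto> (a t z) (b t z)\<^sup>-\<^sup>1\<close> in the direction \<open>X\<close> at the
  identity, and the latter map is constant.\<close>

lemma solves_left_invariant_quotient:
  assumes G: "lie_group G" and a: "solves_left_invariant G X a t" and b: "solves_left_invariant G X b t"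
  shows "smooth_near vec_manifold (mfd G) (\<lambda>s. a s \<otimes>\<^bsub>G\<^esub> m_inv G (b s)) t"
    and "tangent_map vec_manifold (mfd G) (\<lambda>s. a s \<otimes>\<^bsub>G\<^esub> m_inv G (b s)) t 1 = 0"
proof -
  interpret group G using lie_groupD(1)[OF G] .
  note c = lie_groupD(2)[OF G] and p = lie_groupD(3)[OF G]
  note cc = charted_prod_manifold[OF c c]
  have sa: "smooth_near vec_manifold (mfd G) a t" and Ta: "tangent_map vec_manifold (mfd G) a t 1 = left_invariant_field G X (a t)"
    and sb: "smooth_near vec_manifold (mfd G) b t" and Tb: "tangent_map vec_manifold (mfd G) b t 1 = left_invariant_field G X (b t)"
    using a b by (auto simp: solves_left_invariant_def)
  show "smooth_near vec_manifold (mfd G) (\<lambda>s. a s \<otimes>\<^bsub>G\<^esub> m_inv G (b s)) t"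
    by (rule smooth_near_mult[OF G charted_vec_manifold sa smooth_near_m_inv[OF G charted_vec_manifold sb]])
  have x: "a t \<in> carrier G" and y: "b t \<in> carrier G"
    using smooth_near_codomain[OF c sa] smooth_near_codomain[OF c sb] p by auto
  define h where "h q = fst q \<otimes>\<^bsub>G\<^esub> m_inv G (snd q)" for q
  have h: "smooth_near (prod_manifold (mfd G) (mfd G)) (mfd G) h (a t, b t)"
    unfolding h_def
    by (rule smooth_near_mult[OF G cc smooth_near_fst[OF c c] smooth_near_m_inv[OF G cc smooth_near_snd[OF c c]]])
      (use x y p in auto)
  have la: "smooth_near (mfd G) (mfd G) (\<lambda>z. a t \<otimes>\<^bsub>G\<^esub> z) \<one>\<^bsub>G\<^esub>"
    and lb: "smooth_near (mfd G) (mfd G) (\<lambda>z. b t \<otimes>\<^bsub>G\<^esub> z) \<one>\<^bsub>G\<^esub>"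
    using smooth_near_left_mult[OF G x one_closed] smooth_near_left_mult[OF G y one_closed] by auto
  have h1: "smooth_near (prod_manifold (mfd G) (mfd G)) (mfd G) h (a t \<otimes>\<^bsub>G\<^esub> \<one>\<^bsub>G\<^esub>, b t \<otimes>\<^bsub>G\<^esub> \<one>\<^bsub>G\<^esub>)"
    using h x y by simp
  have o: "openin (mtop (mfd G)) (carrier G)" using p openin_topspace by metis
  have "tangent_map vec_manifold (mfd G) (\<lambda>s. h (a s, b s)) t 1 =
      tangent_map (mfd G) (mfd G) (\<lambda>u. h (u, b t)) (a t) (left_invariant_field G X (a t)) +
      tangent_map (mfd G) (mfd G) (\<lambda>u. h (a t, u)) (b t) (left_invariant_field G X (b t))"
    using tangent_map_compose2[OF charted_vec_manifold c c c sa sb h, of 1] by (simp add: Ta Tb)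
  also have "\<dots> = tangent_map (mfd G) (mfd G) (\<lambda>z. h (a t \<otimes>\<^bsub>G\<^esub> z, b t \<otimes>\<^bsub>G\<^esub> z)) \<one>\<^bsub>G\<^esub> X"
    using tangent_map_compose2[OF c c c c la lb h1, of X] x y by (simp add: left_invariant_field_def)
  also have "tangent_map (mfd G) (mfd G) (\<lambda>z. h (a t \<otimes>\<^bsub>G\<^esub> z, b t \<otimes>\<^bsub>G\<^esub> z)) \<one>\<^bsub>G\<^esub> =
      tangent_map (mfd G) (mfd G) (\<lambda>z. a t \<otimes>\<^bsub>G\<^esub> m_inv G (b t)) \<one>\<^bsub>G\<^esub>"
  proof (rule tangent_map_cong[OF c o one_closed])
    fix z assume z: "z \<in> carrier G"
    have "z \<otimes>\<^bsub>G\<^esub> (m_inv G z \<otimes>\<^bsub>G\<^esub> m_inv G (b t)) = m_inv G (b t)"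
      using y z by (simp add: m_assoc[symmetric])
    then show "h (a t \<otimes>\<^bsub>G\<^esub> z, b t \<otimes>\<^bsub>G\<^esub> z) = a t \<otimes>\<^bsub>G\<^esub> m_inv G (b t)"
      using x y z by (simp add: h_def inv_mult_group m_assoc)
  qed
  also have "tangent_map (mfd G) (mfd G) (\<lambda>z. a t \<otimes>\<^bsub>G\<^esub> m_inv G (b t)) \<one>\<^bsub>G\<^esub> X = 0"
    by (rule tangent_map_const[OF c c]) (use x y p in auto)
  finally show "tangent_map vec_manifold (mfd G) (\<lambda>s. a s \<otimes>\<^bsub>G\<^esub> m_inv G (b s)) t 1 = 0"
    by (simp add: h_def)
qed

lemma solves_left_invariant_unique:
  assumes G: "lie_group G" and I: "open I" "connected I" "s \<in> I" "t \<in> I"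
    and a: "\<And>t. t \<in> I \<Longrightarrow> solves_left_invariant G X a t"
    and b: "\<And>t. t \<in> I \<Longrightarrow> solves_left_invariant G X b t"
    and eq: "a s = b s"
  shows "a t = b t"
proof -
  interpret group G using lie_groupD(1)[OF G] .
  note c = lie_groupD(2)[OF G] and p = lie_groupD(3)[OF G]
  have cl: "a u \<in> carrier G" "b u \<in> carrier G" if "u \<in> I" for u
    using a[OF that] b[OF that] smooth_near_codomain[OF c] p unfolding solves_left_invariant_def by metis+
  have "a s \<otimes>\<^bsub>G\<^esub> m_inv G (b s) = a t \<otimes>\<^bsub>G\<^esub> m_inv G (b t)"
    by (rule zero_velocity_imp_constant[OF c I, of "\<lambda>s. a s \<otimes>\<^bsub>G\<^esub> m_inv G (b s)"])
      (rule solves_left_invariant_quotient[OF G a b]; assumption)+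
  then have "a t \<otimes>\<^bsub>G\<^esub> m_inv G (b t) = \<one>\<^bsub>G\<^esub>" using eq cl[OF I(3)] by simp
  then show ?thesis using cl[OF I(4)] by (metis inv_equality inv_inv inv_closed)
qed

lemma solves_left_invariant_left_mult:
  assumes G: "lie_group G" and a: "solves_left_invariant G X a t" and g: "g \<in> carrier G"
  shows "solves_left_invariant G X (\<lambda>s. g \<otimes>\<^bsub>G\<^esub> a s) t"
proof -
  interpret group G using lie_groupD(1)[OF G] .
  note c = lie_groupD(2)[OF G] and p = lie_groupD(3)[OF G]
  have o: "openin (mtop (mfd G)) (carrier G)" using p openin_topspace by metis
  have sa: "smooth_near vec_manifold (mfd G) a t" and Ta: "tangent_map vec_manifold (mfd G) a t 1 = left_invariant_field G X (a t)"
    using a by (auto simp: solves_left_invariant_def)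
  have x: "a t \<in> carrier G" using smooth_near_codomain[OF c sa] p by simp
  note lg = smooth_near_left_mult[OF G g x]
  have lx: "smooth_near (mfd G) (mfd G) (\<lambda>z. a t \<otimes>\<^bsub>G\<^esub> z) \<one>\<^bsub>G\<^esub>" by (rule smooth_near_left_mult[OF G x one_closed])
  have lg': "smooth_near (mfd G) (mfd G) (\<lambda>z. g \<otimes>\<^bsub>G\<^esub> z) (a t \<otimes>\<^bsub>G\<^esub> \<one>\<^bsub>G\<^esub>)" using lg x by simp
  have "tangent_map vec_manifold (mfd G) (\<lambda>s. g \<otimes>\<^bsub>G\<^esub> a s) t 1 =
      tangent_map (mfd G) (mfd G) (\<lambda>z. g \<otimes>\<^bsub>G\<^esub> z) (a t) (left_invariant_field G X (a t))"
    using tangent_map_compose[OF charted_vec_manifold c c sa lg, of 1] by (simp add: Ta)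
  also have "\<dots> = tangent_map (mfd G) (mfd G) (\<lambda>z. g \<otimes>\<^bsub>G\<^esub> (a t \<otimes>\<^bsub>G\<^esub> z)) \<one>\<^bsub>G\<^esub> X"
    using tangent_map_compose[OF c c c lx lg', of X] x by (simp add: left_invariant_field_def)
  also have "tangent_map (mfd G) (mfd G) (\<lambda>z. g \<otimes>\<^bsub>G\<^esub> (a t \<otimes>\<^bsub>G\<^esub> z)) \<one>\<^bsub>G\<^esub> =
      tangent_map (mfd G) (mfd G) (\<lambda>z. (g \<otimes>\<^bsub>G\<^esub> a t) \<otimes>\<^bsub>G\<^esub> z) \<one>\<^bsub>G\<^esub>"
    by (rule tangent_map_cong[OF c o one_closed]) (use x g in \<open>simp add: m_assoc\<close>)
  finally show ?thesis
    using smooth_near_compose[OF charted_vec_manifold c c sa lg]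
    by (simp add: solves_left_invariant_def left_invariant_field_def)
qed

lemma smooth_near_shift: "smooth_near vec_manifold vec_manifold (\<lambda>s::real. r + s) t"
proof (rule smooth_near_smooth_on[OF open_UNIV UNIV_I])
  show "smooth_on UNIV (\<lambda>s::real. r + s)"
    by (intro smooth_on_add smooth_on_const smooth_on_bounded_linear bounded_linear_ident open_UNIV)
qed

lemma tangent_map_shift: "tangent_map vec_manifold vec_manifold (\<lambda>s::real. r + s) t v = v"
proof -
  have "((\<lambda>s. r + s) has_derivative (\<lambda>v. v)) (at t)"
    by (auto intro!: derivative_eq_intros)
  from frechet_derivative_at[OF this, symmetric] show ?thesis by (simp add: tangent_map_vec)
qed

lemma solves_left_invariant_shift:
  assumes G: "lie_group G" and a: "solves_left_invariant G X a (r + t)"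
  shows "solves_left_invariant G X (\<lambda>s. a (r + s)) t"
proof -
  note c = lie_groupD(2)[OF G]
  have sa: "smooth_near vec_manifold (mfd G) a (r + t)" using a by (auto simp: solves_left_invariant_def)
  show ?thesis
    using smooth_near_compose[OF charted_vec_manifold charted_vec_manifold c smooth_near_shift sa] a
      tangent_map_compose[OF charted_vec_manifold charted_vec_manifold c smooth_near_shift sa, of 1]
    by (simp add: solves_left_invariant_def tangent_map_shift)
qed

lemma one_parameter_subgroup_smooth:
  assumes G: "lie_group G" and a: "one_parameter_subgroup G a"
  shows "smooth_near vec_manifold (mfd G) a t"
  by (rule smooth_map_imp_smooth_near[OF charted_vec_manifold lie_groupD(2)[OF G]])
    (use a in \<open>simp_all add: one_parameter_subgroup_def\<close>)

lemma one_parameter_subgroup_zero: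
  assumes G: "lie_group G" and a: "one_parameter_subgroup G a"
  shows "a 0 = \<one>\<^bsub>G\<^esub>"
proof -
  interpret group G using lie_groupD(1)[OF G] .
  have "a 0 \<in> carrier G"
    using smooth_near_codomain[OF lie_groupD(2)[OF G] one_parameter_subgroup_smooth[OF G a]] lie_groupD(3)[OF G]
    by simp
  moreover have "a 0 = a 0 \<otimes>\<^bsub>G\<^esub> a 0"
    using a by (metis one_parameter_subgroup_def add_0)
  ultimately show ?thesis by (metis r_cancel_one')
qed

text \<open>Comes from differentiating the homomorphism law in its second argument at 0. It brings
  one-parameter subgroups under the uniqueness of solutions.\<close>

lemma one_parameter_subgroup_solves:
  assumes G: "lie_group G" and a: "one_parameter_subgroup G a"
  shows "solves_left_invariant G (velocity (mfd G) a 0) a t"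
proof -
  interpret group G using lie_groupD(1)[OF G] .
  note c = lie_groupD(2)[OF G] and p = lie_groupD(3)[OF G]
  note sa = one_parameter_subgroup_smooth[OF G a]
  have x: "a t \<in> carrier G" using smooth_near_codomain[OF c sa] p by simp
  note a0 = one_parameter_subgroup_zero[OF G a]
  have sa': "smooth_near vec_manifold (mfd G) a (t + 0)" using sa by simp
  have lx: "smooth_near (mfd G) (mfd G) (\<lambda>z. a t \<otimes>\<^bsub>G\<^esub> z) (a 0)" by (rule smooth_near_left_mult[OF G x]) (simp add: a0)
  have eq: "(\<lambda>s. a (t + s)) = (\<lambda>s. a t \<otimes>\<^bsub>G\<^esub> a s)" using a by (simp add: one_parameter_subgroup_def)
  have "tangent_map vec_manifold (mfd G) a t 1 = tangent_map vec_manifold (mfd G) (\<lambda>s. a (t + s)) 0 1"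
    using tangent_map_compose[OF charted_vec_manifold charted_vec_manifold c smooth_near_shift sa', of 1]
    by (simp add: tangent_map_shift)
  also have "\<dots> = tangent_map (mfd G) (mfd G) (\<lambda>z. a t \<otimes>\<^bsub>G\<^esub> z) (a 0) (tangent_map vec_manifold (mfd G) a 0 1)"
    unfolding eq by (rule tangent_map_compose[OF charted_vec_manifold c c sa lx])
  finally show ?thesis
    using sa by (simp add: solves_left_invariant_def left_invariant_field_def a0 velocity_eq_tangent_map[OF c sa])
qed

lemma one_parameter_subgroup_unique:
  assumes G: "lie_group G" and a: "one_parameter_subgroup G a" and b: "one_parameter_subgroup G b"
    and eq: "velocity (mfd G) a 0 = velocity (mfd G) b 0"
  shows "a = b"
proof
  show "a t = b t" for t
    by (rule solves_left_invariant_unique[OF G open_UNIV connected_UNIV UNIV_I UNIV_I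
          one_parameter_subgroup_solves[OF G a], of b 0])
      (simp_all add: one_parameter_subgroup_solves[OF G b] eq one_parameter_subgroup_zero[OF G] a b)
qed

section \<open>Existence of one-parameter subgroups and the exponential map\<close>

text \<open>The left-invariant field is carried to a chart at the identity, where Picard iteration
  applies. That gives a differentiable curve; smoothness follows because its derivative
  \<open>f (y t)\<close> is as regular as \<open>y\<close>.\<close>

lemma local_one_parameter_subgroup:
  assumes G: "lie_group G"
  shows "\<exists>\<epsilon> a. \<epsilon> > 0 \<and> a 0 = \<one>\<^bsub>G\<^esub> \<and> (\<forall>t. \<bar>t\<bar> < \<epsilon> \<longrightarrow> solves_left_invariant G X a t)"
proof -
  interpret group G using lie_groupD(1)[OF G] .
  note c = lie_groupD(2)[OF G] and p = lie_groupD(3)[OF G]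
  define k where "k = chart_at (mfd G) \<one>\<^bsub>G\<^esub>"
  have k: "k \<in> atlas (mfd G)" "\<one>\<^bsub>G\<^esub> \<in> fst k"
    unfolding k_def using chart_at[OF c] p by auto
  define S where "S = snd k ` fst k"
  have S: "open S" unfolding S_def by (rule charted_open_image[OF c k(1) charted_chart_open[OF c k(1)] order_refl])
  have inS: "snd k \<one>\<^bsub>G\<^esub> \<in> S" unfolding S_def using k by blast
  define F where "F u = tangent_map (mfd G) vec_manifold (snd k) u (left_invariant_field G X u)" for u
  define f where "f y = F (chart_inv k y)" for y
  have f: "smooth_on S f"
  proof (rule smooth_on_local)
    fix y assume "y \<in> S"
    then obtain x where x: "x \<in> fst k" "y = snd k x" by (auto simp: S_def)
    have sF: "smooth_near (mfd G) vec_manifold F x"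
      using smooth_near_left_invariant_field[OF G k(1) x(1)] by (simp add: F_def[abs_def])
    obtain U where "openin (mtop (mfd G)) U" "x \<in> U" "U \<subseteq> fst k" "open (snd k ` U)"
      "smooth_on (snd k ` U) (\<lambda>y. F (chart_inv k y))"
      by (rule smooth_near_vecE[OF c sF k(1) x(1)])
    then show "\<exists>T. open T \<and> y \<in> T \<and> smooth_on T f"
      using x(2) unfolding f_def[abs_def] by blast
  qed
  obtain \<epsilon> y where e: "\<epsilon> > 0" and y0: "y 0 = snd k \<one>\<^bsub>G\<^esub>"
    and yd: "\<forall>t\<in>{-\<epsilon><..<\<epsilon>}. y t \<in> S \<and> (y has_vector_derivative f (y t)) (at t)"
    using integral_curve_exists[OF S inS f] by blast
  let ?I = "{-\<epsilon><..<\<epsilon>}"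
  have y: "y t \<in> S \<and> (y has_vector_derivative f (y t)) (at t)" if "t \<in> ?I" for t
    using yd that by blast
  have "higher_differentiable_on n ?I y" for n
  proof (induction n)
    case 0
    have "isCont y t" if "t \<in> ?I" for t
      using y[OF that] has_vector_derivative_continuous by blast
    then show ?case by (simp add: continuous_at_imp_continuous_on)
  next
    case (Suc n)
    have "higher_differentiable_on n ?I (\<lambda>t. f (y t))"
      by (rule higher_differentiable_on_compose[OF _ S Suc]) (use f y in \<open>auto simp: smooth_on_def\<close>)
    then have "higher_differentiable_on n ?I (\<lambda>t. h *\<^sub>R f (y t))" for h
      by (rule higher_differentiable_on_bounded_linear_compose[OF open_greaterThanLessThan bounded_linear_scaleR_right])
    then show ?case
      using y by (intro higher_differentiable_on_SucI[where D="\<lambda>t h. h *\<^sub>R f (y t)"])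
        (auto simp: has_vector_derivative_def)
  qed
  then have sy: "smooth_on ?I y" by (simp add: smooth_on_def)
  have "solves_left_invariant G X (\<lambda>t. chart_inv k (y t)) t" if "\<bar>t\<bar> < \<epsilon>" for t
  proof -
    have t: "t \<in> ?I" using that by auto
    then have yS: "y t \<in> snd k ` fst k" using y by (auto simp: S_def)
    have st: "smooth_near vec_manifold vec_manifold y t"
      by (rule smooth_near_smooth_on[OF _ t sy]) simp
    note sk = smooth_near_chart_inv[OF c k(1) yS]
    define u where "u = chart_inv k (y t)"
    have u: "u \<in> fst k" "snd k u = y t" unfolding u_def using yS by (auto simp: inv_into_into f_inv_into_f)
    have D: "(y has_derivative (\<lambda>h. h *\<^sub>R f (y t))) (at t)"
      using y[OF t] by (simp add: has_vector_derivative_def)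
    have "tangent_map vec_manifold vec_manifold y t 1 = f (y t)"
      using frechet_derivative_at[OF D, symmetric] by (simp add: tangent_map_vec)
    then have 1: "tangent_map vec_manifold (mfd G) (\<lambda>t. chart_inv k (y t)) t 1 =
        tangent_map vec_manifold (mfd G) (chart_inv k) (y t) (f (y t))"
      using tangent_map_compose[OF charted_vec_manifold charted_vec_manifold c st sk, of 1] by simp
    have sk': "smooth_near vec_manifold (mfd G) (chart_inv k) (snd k u)" using sk u by simp
    have "tangent_map vec_manifold (mfd G) (chart_inv k) (snd k u)
        (tangent_map (mfd G) vec_manifold (snd k) u (left_invariant_field G X u)) = left_invariant_field G X u"
      by (rule tangent_map_left_inverse[OF c charted_vec_manifold smooth_near_chart[OF c k(1) u(1)] sk'
            charted_chart_open[OF c k(1)] u(1)]) (rule charted_inv[OF c k(1)])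
    then have "tangent_map vec_manifold (mfd G) (chart_inv k) (y t) (f (y t)) = left_invariant_field G X u"
      using u by (simp add: f_def F_def u_def[symmetric])
    then show ?thesis
      using 1 smooth_near_compose[OF charted_vec_manifold charted_vec_manifold c st sk]
      by (simp add: solves_left_invariant_def u_def)
  qed
  moreover have "chart_inv k (y 0) = \<one>\<^bsub>G\<^esub>" using y0 k c by simp
  ultimately show ?thesis using e by (intro exI[of _ \<epsilon>] exI[of _ "\<lambda>t. chart_inv k (y t)"]) simp
qed

text \<open>As functions of \<open>t\<close>, both sides solve the left-invariant equation and agree
  at 0.\<close>

lemma local_one_parameter_subgroup_hom:
  assumes G: "lie_group G" and a0: "a 0 = \<one>\<^bsub>G\<^esub>"
    and a: "\<And>t. \<bar>t\<bar> < \<epsilon> \<Longrightarrow> solves_left_invariant G X a t"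
    and st: "\<bar>s\<bar> < \<epsilon>" "\<bar>t\<bar> < \<epsilon>" "\<bar>s + t\<bar> < \<epsilon>"
  shows "a (s + t) = a s \<otimes>\<^bsub>G\<^esub> a t"
proof -
  interpret group G using lie_groupD(1)[OF G] .
  have cs: "a s \<in> carrier G"
    using a[OF st(1)] smooth_near_codomain[OF lie_groupD(2)[OF G]] lie_groupD(3)[OF G]
    unfolding solves_left_invariant_def by metis
  \<comment> \<open>On this interval both the time and its shift by \<open>s\<close> remain within
    \<open>\<epsilon>\<close> of 0.\<close>
  let ?I = "{max (-\<epsilon>) (-\<epsilon> - s)<..<min \<epsilon> (\<epsilon> - s)}"
  show ?thesis
  proof (rule solves_left_invariant_unique[OF G, of ?I 0 t X "\<lambda>t. a (s + t)" "\<lambda>t. a s \<otimes>\<^bsub>G\<^esub> a t"])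
    show "0 \<in> ?I" "t \<in> ?I" using st by auto
    fix r assume "r \<in> ?I"
    then have r: "\<bar>s + r\<bar> < \<epsilon>" "\<bar>r\<bar> < \<epsilon>" by auto
    show "solves_left_invariant G X (\<lambda>t. a (s + t)) r"
      by (rule solves_left_invariant_shift[OF G a[OF r(1)]])
    show "solves_left_invariant G X (\<lambda>t. a s \<otimes>\<^bsub>G\<^esub> a t) r"
      by (rule solves_left_invariant_left_mult[OF G a[OF r(2)] cs])
  qed (use a0 cs in auto)
qed

text \<open>Each step doubles the interval on which a local one-parameter subgroup is defined.\<close>

primrec doubled_curve :: "('g, 'e) lie_group_data \<Rightarrow> (real \<Rightarrow> 'g) \<Rightarrow> nat \<Rightarrow> real \<Rightarrow> 'g" where
  "doubled_curve G a 0 t = a t"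
| "doubled_curve G a (Suc n) t = doubled_curve G a n (t / 2) \<otimes>\<^bsub>G\<^esub> doubled_curve G a n (t / 2)"

lemma one_parameter_subgroup_exists:
  assumes G: "lie_group G"
  shows "\<exists>a. one_parameter_subgroup G a \<and> velocity (mfd G) a 0 = X"
proof -
  interpret group G using lie_groupD(1)[OF G] .
  note c = lie_groupD(2)[OF G] and p = lie_groupD(3)[OF G]
  obtain \<epsilon> a where e: "\<epsilon> > 0" and a0: "a 0 = \<one>\<^bsub>G\<^esub>"
    and a': "\<forall>t. \<bar>t\<bar> < \<epsilon> \<longrightarrow> solves_left_invariant G X a t"
    using local_one_parameter_subgroup[OF G] by blast
  have a: "solves_left_invariant G X a t" if "\<bar>t\<bar> < \<epsilon>" for t using a' that by blast
  define D where "D = doubled_curve G a"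
  have half: "smooth_near vec_manifold vec_manifold (\<lambda>t::real. t / 2) t" for t
    by (rule smooth_near_smooth_on[OF open_UNIV UNIV_I smooth_on_bounded_linear[OF bounded_linear_divide]])
  have smooth: "smooth_near vec_manifold (mfd G) (D n) t" if "\<bar>t\<bar> < 2 ^ n * \<epsilon>" for n t
    using that
  proof (induction n arbitrary: t)
    case 0
    have "D 0 = a" by (simp add: D_def fun_eq_iff)
    then show ?case using a[of t] 0 by (simp add: solves_left_invariant_def)
  next
    case (Suc n)
    have "smooth_near vec_manifold (mfd G) (D n) (t / 2)" using Suc by simp
    then have "smooth_near vec_manifold (mfd G) (\<lambda>t. D n (t / 2)) t"
      by (rule smooth_near_compose[OF charted_vec_manifold charted_vec_manifold c half])
    then have "smooth_near vec_manifold (mfd G) (\<lambda>t. D n (t / 2) \<otimes>\<^bsub>G\<^esub> D n (t / 2)) t"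
      by (intro smooth_near_mult[OF G charted_vec_manifold])
    moreover have "D (Suc n) = (\<lambda>t. D n (t / 2) \<otimes>\<^bsub>G\<^esub> D n (t / 2))" by (simp add: D_def fun_eq_iff)
    ultimately show ?case by simp
  qed
  have cl: "D n t \<in> carrier G" if "\<bar>t\<bar> < 2 ^ n * \<epsilon>" for n t
    using smooth_near_codomain[OF c smooth[OF that]] p by simp
  have hom: "D n (s + t) = D n s \<otimes>\<^bsub>G\<^esub> D n t"
    if "\<bar>s\<bar> < 2 ^ n * \<epsilon>" "\<bar>t\<bar> < 2 ^ n * \<epsilon>" "\<bar>s + t\<bar> < 2 ^ n * \<epsilon>" for n s t
    using that
  proof (induction n arbitrary: s t)
    case 0
    then show ?case using local_one_parameter_subgroup_hom[OF G a0 a, of \<epsilon> s t] by (simp add: D_def)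
  next
    case (Suc n)
    define x where "x = D n (s / 2)"
    define y where "y = D n (t / 2)"
    have b: "\<bar>s / 2\<bar> < 2 ^ n * \<epsilon>" "\<bar>t / 2\<bar> < 2 ^ n * \<epsilon>" "\<bar>s / 2 + t / 2\<bar> < 2 ^ n * \<epsilon>"
      using Suc.prems by (auto simp: abs_less_iff field_simps)
    have x: "x \<in> carrier G" and y: "y \<in> carrier G" using cl b by (auto simp: x_def y_def)
    have xy: "D n (s / 2 + t / 2) = x \<otimes>\<^bsub>G\<^esub> y" using Suc.IH[OF b] by (simp add: x_def y_def)
    \<comment> \<open>The law survives doubling because the values at \<open>s / 2\<close> and
      \<open>t / 2\<close> commute: either product is the value at the same sum. Commuting allows
      the four factors to be regrouped.\<close>
    have "D n (t / 2 + s / 2) = y \<otimes>\<^bsub>G\<^esub> x" using Suc.IH[of "t / 2" "s / 2"] b by (simp add: x_def y_def add.commute)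
    then have comm: "x \<otimes>\<^bsub>G\<^esub> y = y \<otimes>\<^bsub>G\<^esub> x" using xy by (simp add: add.commute)
    have "D (Suc n) (s + t) = (x \<otimes>\<^bsub>G\<^esub> y) \<otimes>\<^bsub>G\<^esub> (x \<otimes>\<^bsub>G\<^esub> y)"
      using xy by (simp add: D_def add_divide_distrib)
    also have "\<dots> = x \<otimes>\<^bsub>G\<^esub> (y \<otimes>\<^bsub>G\<^esub> x) \<otimes>\<^bsub>G\<^esub> y" using x y by (simp add: m_assoc)
    also have "\<dots> = (x \<otimes>\<^bsub>G\<^esub> x) \<otimes>\<^bsub>G\<^esub> (y \<otimes>\<^bsub>G\<^esub> y)" unfolding comm[symmetric] using x y by (simp add: m_assoc)
    finally show ?case by (simp add: D_def x_def y_def)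
  qed
  \<comment> \<open>Each doubled curve extends the previous one, since that one is already
    multiplicative at \<open>t / 2 + t / 2\<close>.\<close>
  have step: "D (Suc n) t = D n t" if "\<bar>t\<bar> < 2 ^ n * \<epsilon>" for n t
  proof -
    have "\<bar>t / 2\<bar> < 2 ^ n * \<epsilon>" using that by (auto simp: abs_less_iff)
    from hom[OF this this] that show ?thesis by (simp add: D_def)
  qed
  have stable: "D (n + m) t = D n t" if "\<bar>t\<bar> < 2 ^ n * \<epsilon>" for n m t
  proof (induction m)
    case (Suc m)
    have "2 ^ n * \<epsilon> \<le> 2 ^ (n + m) * \<epsilon>" using e by simp
    then have "\<bar>t\<bar> < 2 ^ (n + m) * \<epsilon>" using that by linarith
    then show ?case using step[of t "n + m"] Suc by simp
  qed simp
  have ex: "\<exists>n. \<bar>t\<bar> < 2 ^ n * \<epsilon>" for t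
    using real_arch_pow[of 2 "\<bar>t\<bar> / \<epsilon>"] e by (auto simp: field_simps)
  \<comment> \<open>Every \<open>n\<close> whose interval contains \<open>t\<close> gives the same
    value, by \<open>stable\<close>; \<open>C\<close> is the common extension.\<close>
  define C where "C t = D (SOME n. \<bar>t\<bar> < 2 ^ n * \<epsilon>) t" for t
  have C: "C t = D n t" if "\<bar>t\<bar> < 2 ^ n * \<epsilon>" for t n
  proof -
    define m where "m = (SOME n. \<bar>t\<bar> < 2 ^ n * \<epsilon>)"
    have m: "\<bar>t\<bar> < 2 ^ m * \<epsilon>" unfolding m_def by (rule someI_ex[OF ex])
    have "D m t = D n t" using stable[OF m, of n] stable[OF that, of m] by (simp add: add.commute)
    then show ?thesis by (simp add: C_def m_def)
  qed
  have Ceq: "\<exists>W. openin (mtop (vec_manifold :: (real, real) manifold)) W \<and> t \<in> W \<and> (\<forall>s\<in>W. D n s = C s)"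
    if "\<bar>t\<bar> < 2 ^ n * \<epsilon>" for n t
  proof -
    have "D n s = C s" if "s \<in> {-(2 ^ n * \<epsilon>)<..<2 ^ n * \<epsilon>}" for s
      using C[of s n] that by (auto simp: abs_less_iff)
    moreover have "t \<in> {-(2 ^ n * \<epsilon>)<..<2 ^ n * \<epsilon>}" using that by (auto simp: abs_less_iff)
    ultimately show ?thesis by (intro exI[of _ "{-(2 ^ n * \<epsilon>)<..<2 ^ n * \<epsilon>}"]) simp
  qed
  have Csmooth: "smooth_near vec_manifold (mfd G) C t" for t
  proof -
    obtain n where n: "\<bar>t\<bar> < 2 ^ n * \<epsilon>" using ex by blast
    then obtain W where W: "openin (mtop (vec_manifold :: (real, real) manifold)) W" "t \<in> W" "\<forall>s\<in>W. D n s = C s"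
      using Ceq by blast
    show ?thesis
      by (rule smooth_near_cong[OF charted_vec_manifold smooth[OF n] W(1,2)]) (use W(3) in blast)
  qed
  have "C (s + t) = C s \<otimes>\<^bsub>G\<^esub> C t" for s t
  proof -
    \<comment> \<open>The interval for the sum of the absolute values covers \<open>s\<close>,
      \<open>t\<close> and \<open>s + t\<close> at once.\<close>
    obtain n where n: "\<bar>\<bar>s\<bar> + \<bar>t\<bar>\<bar> < 2 ^ n * \<epsilon>" using ex by blast
    have "\<bar>s\<bar> < 2 ^ n * \<epsilon>" "\<bar>t\<bar> < 2 ^ n * \<epsilon>" "\<bar>s + t\<bar> < 2 ^ n * \<epsilon>" using n by linarith+
    then show ?thesis using hom C by simp
  qed
  then have one: "one_parameter_subgroup G C"
    unfolding one_parameter_subgroup_def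
    using smooth_near_imp_smooth_map[OF charted_vec_manifold c Csmooth] by blast
  have z: "\<bar>0\<bar> < 2 ^ 0 * \<epsilon>" using e by simp
  obtain W where W: "openin (mtop (vec_manifold :: (real, real) manifold)) W" "0 \<in> W" "\<forall>s\<in>W. D 0 s = C s"
    using Ceq[OF z] by blast
  have "tangent_map vec_manifold (mfd G) C 0 1 = tangent_map vec_manifold (mfd G) (D 0) 0 1"
    by (subst tangent_map_cong[OF charted_vec_manifold W(1,2), of "D 0" C]) (use W(3) in auto)
  also have "D 0 = a" by (simp add: D_def fun_eq_iff)
  also have "tangent_map vec_manifold (mfd G) a 0 1 = X"
    using a[of 0] e by (simp add: solves_left_invariant_def a0 left_invariant_field_one[OF G])
  finally have "velocity (mfd G) C 0 = X" by (simp add: velocity_eq_tangent_map[OF c Csmooth])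
  then show ?thesis using one by blast
qed

text \<open>Speeding up \<open>a\<close> by the factor \<open>t\<close> gives the one-parameter
  subgroup of \<open>t *\<^sub>R X\<close>, whose value at 1 is \<open>a t\<close>. Uniqueness
  justifies the definite description in \<open>lie_exp\<close>.\<close>

lemma lie_exp_eq:
  assumes G: "lie_group G" and a: "one_parameter_subgroup G a" and X: "velocity (mfd G) a 0 = X"
  shows "lie_exp G (t *\<^sub>R X) = a t"
proof -
  note c = lie_groupD(2)[OF G]
  note sa = one_parameter_subgroup_smooth[OF G a]
  have lin: "linear (\<lambda>s::real. t * s)" by (simp add: bounded_linear.linear[OF bounded_linear_mult_right])
  note sl = smooth_near_linear[OF lin]
  have s: "smooth_near vec_manifold (mfd G) (\<lambda>s. a (t * s)) r" for r
    by (rule smooth_near_compose[OF charted_vec_manifold charted_vec_manifold c sl sa])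
  have b: "one_parameter_subgroup G (\<lambda>s. a (t * s))"
    using smooth_near_imp_smooth_map[OF charted_vec_manifold c s] a
    by (simp add: one_parameter_subgroup_def distrib_left)
  have "tangent_map vec_manifold (mfd G) (\<lambda>s. a (t * s)) 0 1 = tangent_map vec_manifold (mfd G) a (t * 0) t"
    using tangent_map_compose[OF charted_vec_manifold charted_vec_manifold c sl sa, of 0 1]
    by (simp add: tangent_map_linear[OF lin])
  also have "\<dots> = t *\<^sub>R X"
    using linear_scale[OF linear_tangent_map[OF charted_vec_manifold c sa[of 0]], of t 1] X
    by (simp add: velocity_eq_tangent_map[OF c sa])
  finally have v: "velocity (mfd G) (\<lambda>s. a (t * s)) 0 = t *\<^sub>R X"
    by (simp add: velocity_eq_tangent_map[OF c s])
  show ?thesis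
    unfolding lie_exp_def
  proof (rule the_equality)
    show "\<exists>b. one_parameter_subgroup G b \<and> velocity (mfd G) b 0 = t *\<^sub>R X \<and> a t = b 1"
      using b v by (intro exI[of _ "\<lambda>s. a (t * s)"]) simp
    fix g assume "\<exists>b. one_parameter_subgroup G b \<and> velocity (mfd G) b 0 = t *\<^sub>R X \<and> g = b 1"
    then obtain b' where "one_parameter_subgroup G b'" "velocity (mfd G) b' 0 = t *\<^sub>R X" "g = b' 1" by blast
    then show "g = a t" using one_parameter_subgroup_unique[OF G _ b, of b'] v by simp
  qed
qed

section \<open>Lie subgroups and principal bundles\<close>

lemma lie_subgroupD:
  assumes "lie_subgroup G H"
  shows "lie_group G" "lie_group H" "subgroup (carrier G) H"
    "\<And>x y. x \<in> carrier G \<Longrightarrow> y \<in> carrier G \<Longrightarrow> x \<otimes>\<^bsub>G\<^esub> y = x \<otimes>\<^bsub>H\<^esub> y"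
  using assms by (auto simp: lie_subgroup_def)

lemma lie_subgroup_subset: "lie_subgroup G H \<Longrightarrow> x \<in> carrier G \<Longrightarrow> x \<in> carrier H"
  using lie_subgroupD(3) subgroup.subset by blast

lemma lie_subgroup_one:
  assumes "lie_subgroup G H"
  shows "\<one>\<^bsub>G\<^esub> = \<one>\<^bsub>H\<^esub>"
proof -
  interpret G: group G using lie_groupD(1)[OF lie_subgroupD(1)[OF assms]] .
  interpret H: group H using lie_groupD(1)[OF lie_subgroupD(2)[OF assms]] .
  have "\<one>\<^bsub>G\<^esub> \<otimes>\<^bsub>H\<^esub> \<one>\<^bsub>G\<^esub> = \<one>\<^bsub>G\<^esub>"
    using lie_subgroupD(4)[OF assms G.one_closed G.one_closed] by simp
  then show ?thesis using lie_subgroup_subset[OF assms G.one_closed] by (metis H.r_cancel_one')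
qed

lemma lie_subgroup_inv:
  assumes "lie_subgroup G H" and g: "g \<in> carrier G"
  shows "m_inv G g = m_inv H g"
proof -
  interpret G: group G using lie_groupD(1)[OF lie_subgroupD(1)[OF assms(1)]] .
  interpret H: group H using lie_groupD(1)[OF lie_subgroupD(2)[OF assms(1)]] .
  have "m_inv G g \<otimes>\<^bsub>H\<^esub> g = \<one>\<^bsub>H\<^esub>"
    using lie_subgroupD(4)[OF assms(1) G.inv_closed[OF g] g] g lie_subgroup_one[OF assms(1)] by simp
  then show ?thesis
    using H.inv_equality lie_subgroup_subset[OF assms(1)] g by (metis G.inv_closed)
qed

lemma lie_inclusion_smooth:
  assumes S: "lie_subgroup G H" and g: "g \<in> carrier G"
  shows "smooth_near (mfd G) (mfd H) (\<lambda>x. x) g"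
proof (rule smooth_map_imp_smooth_near)
  show "smooth_map (mfd G) (mfd H) (\<lambda>x. x)" using S by (simp add: lie_subgroup_def)
  show "g \<in> points (mfd G)" using g lie_groupD(3)[OF lie_subgroupD(1)[OF S]] by simp
qed (rule lie_groupD lie_subgroupD[OF S])+

lemma lie_inclusion_linear_inj:
  fixes G :: "('h, 'eg::finite_dim_normed) lie_group_data" and H :: "('h, 'eh::finite_dim_normed) lie_group_data"
  assumes S: "lie_subgroup G H"
  shows "linear (lie_inclusion G H)" "inj (lie_inclusion G H)"
proof -
  interpret G: group G using lie_groupD(1)[OF lie_subgroupD(1)[OF S]] .
  show "linear (lie_inclusion G H)"
    unfolding lie_inclusion_def
    by (rule linear_tangent_map[OF lie_groupD(2)[OF lie_subgroupD(1)[OF S]]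
          lie_groupD(2)[OF lie_subgroupD(2)[OF S]] lie_inclusion_smooth[OF S G.one_closed]])
  show "inj (lie_inclusion G H)"
    using S G.one_closed unfolding lie_inclusion_def lie_subgroup_def by blast
qed

text \<open>The inclusion is a homomorphism, hence intertwines the conjugations in \<open>G\<close>
  and \<open>H\<close>; the claim is the derivative of this at the identity.\<close>

lemma Ad_lie_inclusion:
  assumes S: "lie_subgroup G H" and g: "g \<in> carrier G"
  shows "Ad H g (lie_inclusion G H Y) = lie_inclusion G H (Ad G g Y)"
proof -
  note lG = lie_subgroupD(1)[OF S] and lH = lie_subgroupD(2)[OF S]
  note cG = lie_groupD(2)[OF lG] and cH = lie_groupD(2)[OF lH]
  interpret G: group G using lie_groupD(1)[OF lG] .
  interpret H: group H using lie_groupD(1)[OF lH] .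
  have gH: "g \<in> carrier H" using lie_subgroup_subset[OF S g] .
  have e: "g \<otimes>\<^bsub>G\<^esub> \<one>\<^bsub>G\<^esub> \<otimes>\<^bsub>G\<^esub> m_inv G g = \<one>\<^bsub>G\<^esub>" using g by simp
  have o: "openin (mtop (mfd G)) (carrier G)" using lie_groupD(3)[OF lG] openin_topspace by metis
  have i1: "smooth_near (mfd G) (mfd H) (\<lambda>x. x) (g \<otimes>\<^bsub>G\<^esub> \<one>\<^bsub>G\<^esub> \<otimes>\<^bsub>G\<^esub> m_inv G g)"
    unfolding e by (rule lie_inclusion_smooth[OF S G.one_closed])
  have cH1: "smooth_near (mfd H) (mfd H) (\<lambda>x. g \<otimes>\<^bsub>H\<^esub> x \<otimes>\<^bsub>H\<^esub> m_inv H g) \<one>\<^bsub>G\<^esub>"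
    by (rule smooth_near_conj[OF lH gH]) (simp add: lie_subgroup_one[OF S])
  have "Ad H g (lie_inclusion G H Y) =
      tangent_map (mfd G) (mfd H) (\<lambda>x. g \<otimes>\<^bsub>H\<^esub> x \<otimes>\<^bsub>H\<^esub> m_inv H g) \<one>\<^bsub>G\<^esub> Y"
    using tangent_map_compose[OF cG cH cH lie_inclusion_smooth[OF S G.one_closed] cH1, of Y]
    by (simp add: Ad_def lie_inclusion_def lie_subgroup_one[OF S])
  also have "tangent_map (mfd G) (mfd H) (\<lambda>x. g \<otimes>\<^bsub>H\<^esub> x \<otimes>\<^bsub>H\<^esub> m_inv H g) \<one>\<^bsub>G\<^esub> =
      tangent_map (mfd G) (mfd H) (\<lambda>x. g \<otimes>\<^bsub>G\<^esub> x \<otimes>\<^bsub>G\<^esub> m_inv G g) \<one>\<^bsub>G\<^esub>"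
  proof (rule tangent_map_cong[OF cG o G.one_closed])
    fix x assume x: "x \<in> carrier G"
    show "g \<otimes>\<^bsub>H\<^esub> x \<otimes>\<^bsub>H\<^esub> m_inv H g = g \<otimes>\<^bsub>G\<^esub> x \<otimes>\<^bsub>G\<^esub> m_inv G g"
      using lie_subgroupD(4)[OF S g x] lie_subgroupD(4)[OF S G.m_closed[OF g x] G.inv_closed[OF g]]
      by (simp add: lie_subgroup_inv[OF S g, symmetric])
  qed
  also have "\<dots> Y = tangent_map (mfd G) (mfd H) (\<lambda>x. x) (g \<otimes>\<^bsub>G\<^esub> \<one>\<^bsub>G\<^esub> \<otimes>\<^bsub>G\<^esub> m_inv G g) (Ad G g Y)"
    unfolding Ad_def by (rule tangent_map_compose[OF cG cG cH smooth_near_conj[OF lG g G.one_closed] i1])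
  also have "\<dots> = lie_inclusion G H (Ad G g Y)" unfolding e lie_inclusion_def ..
  finally show ?thesis .
qed

lemma smooth_near_Ad_subgroup:
  assumes S: "lie_subgroup G H" and g: "g \<in> carrier G"
  shows "smooth_near (mfd G) vec_manifold (\<lambda>g. Ad H g X) g"
    and "smooth_near (mfd G) vec_manifold (\<lambda>g. Ad H (m_inv H g) X) g"
proof -
  note lG = lie_subgroupD(1)[OF S] and lH = lie_subgroupD(2)[OF S]
  note cG = lie_groupD(2)[OF lG] and cH = lie_groupD(2)[OF lH]
  note gH = lie_subgroup_subset[OF S g]
  show "smooth_near (mfd G) vec_manifold (\<lambda>g. Ad H g X) g"
    by (rule smooth_near_compose[OF cG cH charted_vec_manifold lie_inclusion_smooth[OF S g] smooth_near_Ad[OF lH gH]])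
  show "smooth_near (mfd G) vec_manifold (\<lambda>g. Ad H (m_inv H g) X) g"
    by (rule smooth_near_compose[OF cG cH charted_vec_manifold lie_inclusion_smooth[OF S g] smooth_near_Ad_inv[OF lH gH]])
qed

text \<open>The chain rule for the inclusion transfers the computation in \<open>H\<close> to
  directions along \<open>G\<close>, whose topology may be finer than the induced one.\<close>

lemma lie_algebra_bracket_eq_derivative_Ad_subgroup:
  assumes S: "lie_subgroup G H"
  shows "tangent_map (mfd G) vec_manifold (\<lambda>g. Ad H (m_inv H g) X) \<one>\<^bsub>G\<^esub> Y =
    lie_algebra_bracket H X (lie_inclusion G H Y)"
proof -
  note lG = lie_subgroupD(1)[OF S] and lH = lie_subgroupD(2)[OF S]
  note cG = lie_groupD(2)[OF lG] and cH = lie_groupD(2)[OF lH]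
  interpret G: group G using lie_groupD(1)[OF lG] .
  note one = lie_subgroup_subset[OF S G.one_closed]
  show ?thesis
    unfolding lie_algebra_bracket_eq_derivative_Ad[OF lH] lie_inclusion_def lie_subgroup_one[OF S, symmetric]
    by (rule tangent_map_compose[OF cG cH charted_vec_manifold lie_inclusion_smooth[OF S G.one_closed]
          smooth_near_Ad_inv[OF lH one]])
qed

section \<open>Principal bundles: fundamental fields and vertical spaces\<close>

lemma principal_bundleD:
  assumes "principal_bundle G B"
  shows "lie_group G" "charted (total B)" "charted (base B)"
    "smooth_map (total B) (base B) (proj B)"
    "smooth_map (prod_manifold (total B) (mfd G)) (total B) (\<lambda>(u, g). act B u g)"
    "\<And>u. u \<in> points (total B) \<Longrightarrow> act B u \<one>\<^bsub>G\<^esub> = u"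
  using assms by (auto simp: principal_bundle_def smooth_manifold_charted)

lemma principal_bundle_act_smooth:
  assumes B: "principal_bundle G B" and u: "u \<in> points (total B)" and g: "g \<in> carrier G"
  shows "smooth_near (prod_manifold (total B) (mfd G)) (total B) (\<lambda>p. act B (fst p) (snd p)) (u, g)"
proof (rule smooth_map_imp_smooth_near)
  note lG = principal_bundleD(1)[OF B]
  show "charted (prod_manifold (total B) (mfd G))"
    by (rule charted_prod_manifold[OF principal_bundleD(2)[OF B] lie_groupD(2)[OF lG]])
  show "smooth_map (prod_manifold (total B) (mfd G)) (total B) (\<lambda>p. act B (fst p) (snd p))"
    using principal_bundleD(5)[OF B] by (simp add: case_prod_unfold)
  show "(u, g) \<in> points (prod_manifold (total B) (mfd G))"
    using u g lie_groupD(3)[OF lG] by simp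
qed (rule principal_bundleD(2)[OF B])

lemma fundamental_field_eq_tangent_map:
  assumes B: "principal_bundle G B" and u: "u \<in> points (total B)"
  shows "fundamental_field G B X u = tangent_map (mfd G) (total B) (act B u) \<one>\<^bsub>G\<^esub> X"
proof -
  note lG = principal_bundleD(1)[OF B] and P = principal_bundleD(2)[OF B]
  note c = lie_groupD(2)[OF lG]
  interpret group G using lie_groupD(1)[OF lG] .
  obtain a where a: "one_parameter_subgroup G a" "velocity (mfd G) a 0 = X"
    using one_parameter_subgroup_exists[OF lG] by blast
  note sa = one_parameter_subgroup_smooth[OF lG a(1), of 0]
  note a0 = one_parameter_subgroup_zero[OF lG a(1)]
  have su: "smooth_near (mfd G) (total B) (act B u) (a 0)"
    using smooth_near_section2[OF P c P principal_bundle_act_smooth[OF B u one_closed]] by (simp add: a0)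
  have "(\<lambda>t. act B u (lie_exp G (t *\<^sub>R X))) = (\<lambda>t. act B u (a t))"
    using lie_exp_eq[OF lG a] by simp
  then have "fundamental_field G B X u = velocity (total B) (\<lambda>t. act B u (a t)) 0"
    by (simp add: fundamental_field_def)
  also have "\<dots> = tangent_map vec_manifold (total B) (\<lambda>t. act B u (a t)) 0 1"
    by (rule velocity_eq_tangent_map[OF P smooth_near_compose[OF charted_vec_manifold c P sa su]])
  also have "\<dots> = tangent_map (mfd G) (total B) (act B u) (a 0) (tangent_map vec_manifold (mfd G) a 0 1)"
    by (rule tangent_map_compose[OF charted_vec_manifold c P sa su])
  also have "tangent_map vec_manifold (mfd G) a 0 1 = X"
    using a(2) velocity_eq_tangent_map[OF c sa] by simp
  finally show ?thesis by (simp add: a0)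
qed

lemma linear_fundamental_field:
  assumes B: "principal_bundle G B" and u: "u \<in> points (total B)"
  shows "linear (\<lambda>X. fundamental_field G B X u)"
proof -
  note lG = principal_bundleD(1)[OF B] and P = principal_bundleD(2)[OF B]
  note c = lie_groupD(2)[OF lG]
  interpret group G using lie_groupD(1)[OF lG] .
  have su: "smooth_near (mfd G) (total B) (act B u) \<one>\<^bsub>G\<^esub>"
    using smooth_near_section2[OF P c P principal_bundle_act_smooth[OF B u one_closed]] by simp
  show ?thesis
    unfolding fundamental_field_eq_tangent_map[OF B u] using linear_tangent_map[OF c P su] by simp
qed

text \<open>\<open>s\<close> is the fibre component of a local trivialization over \<open>U\<close>, and \<open>\<phi>\<close> its inverse. That the
  action preserves fibres is only claimed where it stays in \<open>E\<close>.\<close>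

definition trivialization ::
    "('g, 'eg::finite_dim_normed) lie_group_data
      \<Rightarrow> ('p, 'ep::finite_dim_normed, 'm, 'em::finite_dim_normed, 'g) bundle_data
      \<Rightarrow> 'p set \<Rightarrow> 'm set \<Rightarrow> ('p \<Rightarrow> 'g) \<Rightarrow> ('m \<times> 'g \<Rightarrow> 'p) \<Rightarrow> bool" where
  "trivialization G B E U s \<phi> \<longleftrightarrow>
     openin (mtop (total B)) E \<and> openin (mtop (base B)) U \<and>
     (\<forall>w\<in>E. proj B w \<in> U \<and> smooth_near (total B) (mfd G) s w \<and> \<phi> (proj B w, s w) = w) \<and>
     (\<forall>w\<in>E. \<forall>g\<in>carrier G. s (act B w g) = s w \<otimes>\<^bsub>G\<^esub> g \<and>
        (act B w g \<in> E \<longrightarrow> proj B (act B w g) = proj B w)) \<and>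
     (\<forall>x\<in>U. \<forall>g\<in>carrier G. smooth_near (prod_manifold (base B) (mfd G)) (total B) \<phi> (x, g) \<and>
        proj B (\<phi> (x, g)) = x)"

lemma trivializationD:
  assumes "trivialization G B E U s \<phi>"
  shows "openin (mtop (total B)) E" "openin (mtop (base B)) U"
    "\<And>w. w \<in> E \<Longrightarrow> proj B w \<in> U" "\<And>w. w \<in> E \<Longrightarrow> smooth_near (total B) (mfd G) s w"
    "\<And>w g. w \<in> E \<Longrightarrow> g \<in> carrier G \<Longrightarrow> s (act B w g) = s w \<otimes>\<^bsub>G\<^esub> g"
    "\<And>w g. w \<in> E \<Longrightarrow> g \<in> carrier G \<Longrightarrow> act B w g \<in> E \<Longrightarrow> proj B (act B w g) = proj B w"
    "\<And>w. w \<in> E \<Longrightarrow> \<phi> (proj B w, s w) = w"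
    "\<And>x g. x \<in> U \<Longrightarrow> g \<in> carrier G \<Longrightarrow> smooth_near (prod_manifold (base B) (mfd G)) (total B) \<phi> (x, g)"
    "\<And>x g. x \<in> U \<Longrightarrow> g \<in> carrier G \<Longrightarrow> proj B (\<phi> (x, g)) = x"
  using assms by (simp_all add: trivialization_def)

text \<open>The diffeomorphism in the definition lives on open submanifolds, whose preferred charts
  are unrelated to those of the total space and the base. Composing with germs of the identity moves
  it to the ambient manifolds once and for all.\<close>

lemma principal_bundle_trivialization:
  assumes B: "principal_bundle G B" and u: "u \<in> points (total B)"
  shows "\<exists>E U s \<phi>. u \<in> E \<and> trivialization G B E U s \<phi>"
proof -
  note lG = principal_bundleD(1)[OF B] and P = principal_bundleD(2)[OF B] and M = principal_bundleD(3)[OF B]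
  note c = lie_groupD(2)[OF lG] and pG = lie_groupD(3)[OF lG]
  have "proj B u \<in> points (base B)"
    using principal_bundleD(4)[OF B] u by (auto simp: smooth_map_def continuous_map_def)
  then have ex: "\<exists>U \<psi>. openin (mtop (base B)) U \<and> proj B u \<in> U \<and>
        (let E = {u \<in> points (total B). proj B u \<in> U} in
          diffeomorphism (open_submanifold (total B) E)
            (prod_manifold (open_submanifold (base B) U) (mfd G)) \<psi> \<and>
          (\<forall>u\<in>E. fst (\<psi> u) = proj B u) \<and>
          (\<forall>u\<in>E. \<forall>g\<in>carrier G. \<psi> (act B u g) = (fst (\<psi> u), snd (\<psi> u) \<otimes>\<^bsub>G\<^esub> g)))"
    using B unfolding principal_bundle_def by blast
  obtain U \<psi> where U: "openin (mtop (base B)) U" "proj B u \<in> U" and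
    triv: "let E = {u \<in> points (total B). proj B u \<in> U} in
          diffeomorphism (open_submanifold (total B) E)
            (prod_manifold (open_submanifold (base B) U) (mfd G)) \<psi> \<and>
          (\<forall>u\<in>E. fst (\<psi> u) = proj B u) \<and>
          (\<forall>u\<in>E. \<forall>g\<in>carrier G. \<psi> (act B u g) = (fst (\<psi> u), snd (\<psi> u) \<otimes>\<^bsub>G\<^esub> g))"
    using ex by (elim exE conjE)
  define E where "E = {u \<in> points (total B). proj B u \<in> U}"
  have E: "diffeomorphism (open_submanifold (total B) E) (prod_manifold (open_submanifold (base B) U) (mfd G)) \<psi>"
    "\<And>u. u \<in> E \<Longrightarrow> fst (\<psi> u) = proj B u"
    "\<And>u g. u \<in> E \<Longrightarrow> g \<in> carrier G \<Longrightarrow> \<psi> (act B u g) = (fst (\<psi> u), snd (\<psi> u) \<otimes>\<^bsub>G\<^esub> g)"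
    using triv unfolding Let_def E_def[symmetric] by blast+
  have Eo: "openin (mtop (total B)) E"
  proof -
    have "continuous_map (mtop (total B)) (mtop (base B)) (proj B)"
      using principal_bundleD(4)[OF B] by (simp add: smooth_map_def)
    from openin_continuous_map_preimage[OF this U(1)] show ?thesis by (simp add: E_def)
  qed
  have Up: "U \<subseteq> points (base B)" using openin_subset[OF U(1)] .
  have Ep: "E \<subseteq> points (total B)" using openin_subset[OF Eo] .
  define PE where "PE = open_submanifold (total B) E"
  define MU where "MU = open_submanifold (base B) U"
  define \<phi> where "\<phi> = inv_into E \<psi>"
  have cPE: "charted PE" and cMU: "charted MU"
    unfolding PE_def MU_def using charted_open_submanifold[OF P Eo] charted_open_submanifold[OF M U(1)] by auto
  have pPE: "points PE = E" and pMU: "points MU = U"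
    unfolding PE_def MU_def using Ep Up by (auto simp: topspace_subtopology)
  have \<psi>: "smooth_map PE (prod_manifold MU (mfd G)) \<psi>" "bij_betw \<psi> E (U \<times> carrier G)"
    "smooth_map (prod_manifold MU (mfd G)) PE \<phi>"
    using E(1) pPE pMU pG unfolding diffeomorphism_def PE_def[symmetric] MU_def[symmetric] \<phi>_def by auto
  note cMUG = charted_prod_manifold[OF cMU c]
  define s where "s w = snd (\<psi> w)" for w
  have \<psi>w: "\<psi> w = (proj B w, s w)" if "w \<in> E" for w using E(2)[OF that] by (simp add: s_def prod_eq_iff)
  have sw: "s w \<in> carrier G" if "w \<in> E" for w
    using bij_betw_apply[OF \<psi>(2) that] by (auto simp: \<psi>w[OF that])
  have smooth_s: "smooth_near (total B) (mfd G) s w" if w: "w \<in> E" for w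
  proof -
    have 1: "smooth_near (total B) PE (\<lambda>x. x) w"
      unfolding PE_def by (rule smooth_near_open_submanifold(2)[OF P Eo w])
    have 2: "smooth_near PE (prod_manifold MU (mfd G)) \<psi> w"
      by (rule smooth_map_imp_smooth_near[OF cPE cMUG \<psi>(1)]) (simp add: pPE w)
    have "smooth_near (prod_manifold MU (mfd G)) (mfd G) snd (proj B w, s w)"
      by (rule smooth_near_snd[OF cMU c]) (use w sw pMU pG in \<open>auto simp: E_def\<close>)
    then have 3: "smooth_near (prod_manifold MU (mfd G)) (mfd G) snd (\<psi> w)" using \<psi>w[OF w] by simp
    show ?thesis
      unfolding s_def
      by (rule smooth_near_compose[OF P cPE c 1 smooth_near_compose[OF cPE cMUG c 2 3]])
  qed
  have smooth_\<phi>: "smooth_near (prod_manifold (base B) (mfd G)) (total B) \<phi> (x, g)"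
    if x: "x \<in> U" and g: "g \<in> carrier G" for x g
  proof -
    note cMG = charted_prod_manifold[OF M c]
    have xp: "x \<in> points (base B)" "g \<in> points (mfd G)" using x g Up pG by auto
    have i: "smooth_near (base B) MU (\<lambda>x. x) (fst (x, g))"
      unfolding MU_def using smooth_near_open_submanifold(2)[OF M U(1) x] by simp
    \<comment> \<open>The pair of projections is the identity, regarded as a map into the product
      over \<open>U\<close>.\<close>
    have "smooth_near (prod_manifold (base B) (mfd G)) (prod_manifold MU (mfd G)) (\<lambda>p. (fst p, snd p)) (x, g)"
      by (rule smooth_near_Pair[OF cMG cMU c smooth_near_compose[OF cMG M cMU smooth_near_fst[OF M c xp] i]
            smooth_near_snd[OF M c xp]])
    then have 1: "smooth_near (prod_manifold (base B) (mfd G)) (prod_manifold MU (mfd G)) (\<lambda>p. p) (x, g)"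
      by simp
    have 2: "smooth_near (prod_manifold MU (mfd G)) PE \<phi> (x, g)"
      by (rule smooth_map_imp_smooth_near[OF cMUG cPE \<psi>(3)]) (use x g pMU pG in simp)
    have "\<phi> (x, g) \<in> E" using smooth_near_codomain[OF cPE 2] pPE by simp
    then have 3: "smooth_near PE (total B) (\<lambda>x. x) (\<phi> (x, g))"
      unfolding PE_def by (rule smooth_near_open_submanifold(1)[OF P Eo])
    show ?thesis
      by (rule smooth_near_compose[OF cMG cMUG P 1 smooth_near_compose[OF cMUG cPE P 2 3]])
  qed
  have "trivialization G B E U s \<phi>"
    unfolding trivialization_def
  proof (intro conjI ballI impI Eo U(1))
    show "proj B w \<in> U" if "w \<in> E" for w using that by (simp add: E_def)
    show "smooth_near (total B) (mfd G) s w" if "w \<in> E" for w using smooth_s[OF that] .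
    show "s (act B w g) = s w \<otimes>\<^bsub>G\<^esub> g" if "w \<in> E" "g \<in> carrier G" for w g
      using E(3)[OF that] by (simp add: s_def)
    show "proj B (act B w g) = proj B w" if "w \<in> E" "g \<in> carrier G" "act B w g \<in> E" for w g
      using E(3)[OF that(1,2)] E(2)[OF that(1)] E(2)[OF that(3)] by simp
    show "\<phi> (proj B w, s w) = w" if "w \<in> E" for w
      using inv_into_f_f[OF bij_betw_imp_inj_on[OF \<psi>(2)] that] \<psi>w[OF that] by (simp add: \<phi>_def)
    show "smooth_near (prod_manifold (base B) (mfd G)) (total B) \<phi> (x, g)" if "x \<in> U" "g \<in> carrier G" for x g
      using smooth_\<phi>[OF that] .
    show "proj B (\<phi> (x, g)) = x" if "x \<in> U" "g \<in> carrier G" for x g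
    proof -
      have m: "(x, g) \<in> \<psi> ` E" using \<psi>(2) that by (simp add: bij_betw_def)
      have "\<phi> (x, g) \<in> E" unfolding \<phi>_def by (rule inv_into_into[OF m])
      moreover have "\<psi> (\<phi> (x, g)) = (x, g)" unfolding \<phi>_def by (rule f_inv_into_f[OF m])
      ultimately show ?thesis using E(2)[of "\<phi> (x, g)"] by simp
    qed
  qed
  moreover have "u \<in> E" using u U by (simp add: E_def)
  ultimately show ?thesis by blast
qed

lemma smooth_near_proj:
  assumes B: "principal_bundle G B" and u: "u \<in> points (total B)"
  shows "smooth_near (total B) (base B) (proj B) u"
  by (rule smooth_map_imp_smooth_near[OF principal_bundleD(2,3,4)[OF B] u])

text \<open>The local section through \<open>u\<close> with constant fibre component
  \<open>s u\<close> is a right inverse of the projection.\<close>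

lemma surj_tangent_map_proj:
  assumes B: "principal_bundle G B" and u: "u \<in> points (total B)"
  shows "surj (tangent_map (total B) (base B) (proj B) u)"
proof -
  note lG = principal_bundleD(1)[OF B] and P = principal_bundleD(2)[OF B] and M = principal_bundleD(3)[OF B]
  note c = lie_groupD(2)[OF lG] and pG = lie_groupD(3)[OF lG]
  obtain E U s \<phi> where uE: "u \<in> E" and T: "trivialization G B E U s \<phi>"
    using principal_bundle_trivialization[OF B u] by blast
  note D = trivializationD[OF T]
  note E = D(1) uE D(2) D(3) D(4) D(5) D(6) D(7) D(8) D(9)
  have su: "s u \<in> carrier G" using smooth_near_codomain[OF c E(5)[OF E(2)]] pG by simp
  have sec: "smooth_near (base B) (total B) (\<lambda>x. \<phi> (x, s u)) (proj B u)"
    by (rule smooth_near_section1[OF M c P E(9)[OF E(4)[OF E(2)] su]])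
  have "smooth_near (total B) (base B) (proj B) (\<phi> (proj B u, s u))"
    using smooth_near_proj[OF B u] E(8)[OF E(2)] by simp
  from tangent_map_left_inverse[OF M P sec this E(3) E(4)[OF E(2)] E(10)[OF _ su]]
  have "tangent_map (total B) (base B) (proj B) u
      (tangent_map (base B) (total B) (\<lambda>x. \<phi> (x, s u)) (proj B u) v) = v" for v
    using E(8)[OF E(2)] by simp
  then show ?thesis by (rule surjI)
qed

text \<open>Along the orbit of \<open>u\<close> the fibre component is a left translation, so a
  fundamental vector is determined by its image under the derivative of \<open>s\<close>. A vertical
  vector, corrected by the fundamental one with the same image, is annihilated by the derivatives of
  both components of the trivialization and thus vanishes.\<close>

lemma vertical_space_eq_fundamental_fields:
  assumes B: "principal_bundle G B" and u: "u \<in> points (total B)"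
  shows "inj (\<lambda>X. fundamental_field G B X u)"
    and "vertical_space B u = range (\<lambda>X. fundamental_field G B X u)"
proof -
  note lG = principal_bundleD(1)[OF B] and P = principal_bundleD(2)[OF B] and M = principal_bundleD(3)[OF B]
  note c = lie_groupD(2)[OF lG] and pG = lie_groupD(3)[OF lG]
  interpret group G using lie_groupD(1)[OF lG] .
  obtain E U s \<phi> where uE: "u \<in> E" and T: "trivialization G B E U s \<phi>"
    using principal_bundle_trivialization[OF B u] by blast
  note D = trivializationD[OF T]
  note E = D(1) uE D(2) D(3) D(4) D(5) D(6) D(7) D(8) D(9)
  note ss = E(5)[OF E(2)] and sp = smooth_near_proj[OF B u]
  have su: "s u \<in> carrier G" using smooth_near_codomain[OF c ss] pG by simp
  have isu: "m_inv G (s u) \<in> carrier G" using su by simp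
  have o: "openin (mtop (mfd G)) (carrier G)" using pG openin_topspace by metis
  have sa: "smooth_near (mfd G) (total B) (act B u) \<one>\<^bsub>G\<^esub>"
    using smooth_near_section2[OF P c P principal_bundle_act_smooth[OF B u one_closed]] by simp
  have u1: "act B u \<one>\<^bsub>G\<^esub> = u" by (rule principal_bundleD(6)[OF B u])
  define L where "L = tangent_map (mfd G) (mfd G) (\<lambda>g. s u \<otimes>\<^bsub>G\<^esub> g) \<one>\<^bsub>G\<^esub>"
  define L' where "L' = tangent_map (mfd G) (mfd G) (\<lambda>g. m_inv G (s u) \<otimes>\<^bsub>G\<^esub> g) (s u)"
  note l1 = smooth_near_left_mult[OF lG su one_closed] and l2 = smooth_near_left_mult[OF lG isu su]
  have l2': "smooth_near (mfd G) (mfd G) (\<lambda>g. m_inv G (s u) \<otimes>\<^bsub>G\<^esub> g) (s u \<otimes>\<^bsub>G\<^esub> \<one>\<^bsub>G\<^esub>)" using l2 su by simp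
  have l1': "smooth_near (mfd G) (mfd G) (\<lambda>g. s u \<otimes>\<^bsub>G\<^esub> g) (m_inv G (s u) \<otimes>\<^bsub>G\<^esub> s u)" using l1 su by simp
  have L'L: "L' (L X) = X" for X
    using tangent_map_left_inverse[OF c c l1 l2' o one_closed, of X] su
    by (simp add: L_def L'_def m_assoc[symmetric])
  have LL': "L (L' X) = X" for X
    using tangent_map_left_inverse[OF c c l2 l1' o su, of X] su
    by (simp add: L_def L'_def m_assoc[symmetric])
  have Ts: "tangent_map (total B) (mfd G) s u (fundamental_field G B X u) = L X" for X
  proof -
    have "tangent_map (mfd G) (mfd G) (\<lambda>g. s (act B u g)) \<one>\<^bsub>G\<^esub> =
        tangent_map (mfd G) (mfd G) (\<lambda>g. s u \<otimes>\<^bsub>G\<^esub> g) \<one>\<^bsub>G\<^esub>"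
      by (rule tangent_map_cong[OF c o one_closed E(6)[OF E(2)]])
    moreover have "smooth_near (total B) (mfd G) s (act B u \<one>\<^bsub>G\<^esub>)" using ss u1 by simp
    ultimately show ?thesis
      using tangent_map_compose[OF c P c sa, of s X]
      by (simp add: u1 L_def fundamental_field_eq_tangent_map[OF B u])
  qed
  show "inj (\<lambda>X. fundamental_field G B X u)"
    using Ts L'L by (intro injI) metis
  have vert: "tangent_map (total B) (base B) (proj B) u (fundamental_field G B X u) = 0" for X
  proof -
    have "act B u \<one>\<^bsub>G\<^esub> \<in> E" using u1 E(2) by simp
    \<comment> \<open>\<open>W\<close> keeps the orbit inside \<open>E\<close>, where the
      trivialization controls the projection.\<close>
    then obtain W where W: "openin (mtop (mfd G)) W" "\<one>\<^bsub>G\<^esub> \<in> W" "\<forall>g\<in>W. act B u g \<in> E"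
      using smooth_near_continuous[OF c P sa E(1)] by blast
    have "W \<subseteq> carrier G" using openin_subset[OF W(1)] pG by simp
    then have "tangent_map (mfd G) (base B) (\<lambda>g. proj B (act B u g)) \<one>\<^bsub>G\<^esub> =
        tangent_map (mfd G) (base B) (\<lambda>g. proj B u) \<one>\<^bsub>G\<^esub>"
      using W(3) E(2,7) by (intro tangent_map_cong[OF c W(1,2)]) blast
    moreover have "tangent_map (mfd G) (base B) (\<lambda>g. proj B u) \<one>\<^bsub>G\<^esub> X = 0"
      by (rule tangent_map_const[OF c M]) (use pG smooth_near_codomain[OF M sp] in auto)
    moreover have "smooth_near (total B) (base B) (proj B) (act B u \<one>\<^bsub>G\<^esub>)" using sp u1 by simp
    ultimately show ?thesis
      using tangent_map_compose[OF c P M sa, of "proj B" X]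
      by (simp add: u1 fundamental_field_eq_tangent_map[OF B u])
  qed
  have "\<xi> \<in> range (\<lambda>X. fundamental_field G B X u)"
    if \<xi>: "tangent_map (total B) (base B) (proj B) u \<xi> = 0" for \<xi>
  proof -
    define X where "X = L' (tangent_map (total B) (mfd G) s u \<xi>)"
    define \<eta> where "\<eta> = \<xi> - fundamental_field G B X u"
    have p0: "tangent_map (total B) (base B) (proj B) u \<eta> = 0"
      using \<xi> vert linear_diff[OF linear_tangent_map[OF P M sp]] by (simp add: \<eta>_def)
    have s0: "tangent_map (total B) (mfd G) s u \<eta> = 0"
      using Ts linear_diff[OF linear_tangent_map[OF P c ss]] by (simp add: \<eta>_def X_def LL')
    note sx = E(9)[OF E(4)[OF E(2)] su]
    have "\<eta> = tangent_map (total B) (total B) (\<lambda>w. w) u \<eta>"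
      using tangent_map_ident[OF P u] by simp
    also have "tangent_map (total B) (total B) (\<lambda>w. w) u =
        tangent_map (total B) (total B) (\<lambda>w. \<phi> (proj B w, s w)) u"
      by (rule tangent_map_cong[OF P E(1,2)]) (simp add: E(8))
    also have "tangent_map (total B) (total B) (\<lambda>w. \<phi> (proj B w, s w)) u \<eta> = 0"
      using tangent_map_compose2[OF P M c P sp ss sx, of \<eta>]
        linear_0[OF linear_tangent_map[OF M P smooth_near_section1[OF M c P sx]]]
        linear_0[OF linear_tangent_map[OF c P smooth_near_section2[OF M c P sx]]]
      by (simp add: p0 s0)
    finally have "\<xi> = fundamental_field G B X u" by (simp add: \<eta>_def)
    then show ?thesis by blast
  qed
  then show "vertical_space B u = range (\<lambda>X. fundamental_field G B X u)"
    unfolding vertical_space_def using vert by auto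
qed

lemma vertical_parallelism_fundamental_field:
  assumes B: "principal_bundle G B" and u: "u \<in> points (total B)"
  shows "vertical_parallelism G B u (fundamental_field G B X u) = X"
  unfolding vertical_parallelism_def
  using vertical_space_eq_fundamental_fields(1)[OF B u]
  by (intro the_equality) (auto dest: injD)

section \<open>Cartan connections\<close>

lemma proj_along_eqI:
  assumes A: "subspace A" and B: "subspace B" and AB: "A \<inter> B = {0}" and a: "a \<in> A" "x - a \<in> B"
  shows "proj_along A B x = a"
  unfolding proj_along_def
proof (rule the_equality)
  fix a' assume a': "a' \<in> A \<and> x - a' \<in> B"
  have "a - a' \<in> A" using A a a' subspace_diff by blast
  moreover have "(x - a') - (x - a) \<in> B" using B a a' subspace_diff by blast
  ultimately have "a - a' \<in> A \<inter> B" by simp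
  then show "a' = a" using AB by simp
qed (use a in simp)

lemma proj_along:
  assumes A: "subspace A" and B: "subspace B" and AB: "A \<inter> B = {0}" and sum: "{a + b | a b. a \<in> A \<and> b \<in> B} = UNIV"
  shows "proj_along A B x \<in> A" "x - proj_along A B x \<in> B"
proof -
  have "x \<in> {a + b | a b. a \<in> A \<and> b \<in> B}" using sum by simp
  then obtain a b where ab: "x = a + b" "a \<in> A" "b \<in> B" by blast
  have "proj_along A B x = a" by (rule proj_along_eqI[OF A B AB]) (use ab in auto)
  then show "proj_along A B x \<in> A" "x - proj_along A B x \<in> B" using ab by auto
qed

lemma linear_proj_along:
  assumes A: "subspace A" and B: "subspace B" and AB: "A \<inter> B = {0}" and sum: "{a + b | a b. a \<in> A \<and> b \<in> B} = UNIV"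
  shows "linear (proj_along A B)"
proof (rule linearI)
  note p = proj_along[OF assms]
  show "proj_along A B (x + y) = proj_along A B x + proj_along A B y" for x y
    by (rule proj_along_eqI[OF A B AB])
      (use subspace_add[OF A p(1) p(1), of x y] subspace_add[OF B p(2) p(2), of x y] in \<open>simp_all add: algebra_simps\<close>)
  show "proj_along A B (c *\<^sub>R x) = c *\<^sub>R proj_along A B x" for c x
    by (rule proj_along_eqI[OF A B AB])
      (use subspace_scale[OF A p(1), of c x] subspace_scale[OF B p(2), of c x] in \<open>simp_all add: algebra_simps\<close>)
qed

text \<open>A map preserving both summands carries decompositions to decompositions. With
  \<open>f\<close> an adjoint map, this moves equivariance from a form to its components.\<close>

lemma proj_along_commute:
  assumes A: "subspace A" and B: "subspace B" and AB: "A \<inter> B = {0}" and sum: "{a + b | a b. a \<in> A \<and> b \<in> B} = UNIV"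
    and f: "linear f" "f ` A \<subseteq> A" "f ` B \<subseteq> B"
  shows "proj_along A B (f x) = f (proj_along A B x)"
proof (rule proj_along_eqI[OF A B AB])
  note p = proj_along[OF A B AB sum, of x]
  show "f (proj_along A B x) \<in> A" using p f by blast
  have "f (x - proj_along A B x) \<in> B" using p f by blast
  then show "f x - f (proj_along A B x) \<in> B" by (simp add: linear_diff[OF f(1)])
qed

section \<open>Vector-valued one-forms and the fields they define\<close>

lemma smooth_one_form_linear:
  fixes \<alpha> :: "'a \<Rightarrow> 'e::finite_dim_normed \<Rightarrow> 'w::finite_dim_normed" and L :: "'w \<Rightarrow> 'v::finite_dim_normed"
    and M :: "('a, 'e) manifold"
  assumes M: "charted M" and \<alpha>: "smooth_one_form M \<alpha>" and L: "linear L"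
  shows "smooth_one_form M (\<lambda>u \<xi>. L (\<alpha> u \<xi>))"
  unfolding smooth_one_form_def
proof (intro conjI ballI allI)
  show "linear (\<lambda>\<xi>. L (\<alpha> u \<xi>))" if "u \<in> points M" for u
    using linear_compose[OF _ L, of "\<alpha> u"] \<alpha> that by (simp add: smooth_one_form_def comp_def)
  fix c v assume c: "c \<in> atlas M"
  show "smooth_on (snd c ` fst c) (\<lambda>y. L (\<alpha> (chart_inv c y) (tangent_map vec_manifold M (chart_inv c) y v)))"
    by (rule smooth_on_bounded_linear_compose[OF charted_open_image[OF M c charted_chart_open[OF M c] order_refl]
          linear_imp_bounded_linear[OF L]])
      (use \<alpha> c in \<open>simp add: smooth_one_form_def\<close>)
qed

lemma smooth_one_form_add:
  fixes \<alpha> \<beta> :: "'a \<Rightarrow> 'e::finite_dim_normed \<Rightarrow> 'w::finite_dim_normed" and M :: "('a, 'e) manifold"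
  assumes M: "charted M" and \<alpha>: "smooth_one_form M \<alpha>" and \<beta>: "smooth_one_form M \<beta>"
  shows "smooth_one_form M (\<lambda>u \<xi>. \<alpha> u \<xi> + \<beta> u \<xi>)"
  unfolding smooth_one_form_def
proof (intro conjI ballI allI)
  show "linear (\<lambda>\<xi>. \<alpha> u \<xi> + \<beta> u \<xi>)" if "u \<in> points M" for u
    using linear_compose_add[of "\<alpha> u" "\<beta> u"] \<alpha> \<beta> that by (simp add: smooth_one_form_def)
  fix c v assume c: "c \<in> atlas M"
  show "smooth_on (snd c ` fst c) (\<lambda>y. \<alpha> (chart_inv c y) (tangent_map vec_manifold M (chart_inv c) y v)
      + \<beta> (chart_inv c y) (tangent_map vec_manifold M (chart_inv c) y v))"
    by (rule smooth_on_add[OF charted_open_image[OF M c charted_chart_open[OF M c] order_refl]])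
      (use \<alpha> \<beta> c in \<open>simp_all add: smooth_one_form_def\<close>)
qed

text \<open>In the chart, \<open>\<kappa>\<close> is a smooth family \<open>K\<close> of linear
  isomorphisms and the field of \<open>w\<close> solves \<open>K y v = w\<close>, so the inversion
  of a linear family applies.\<close>

lemma smooth_near_cartan_field:
  fixes \<kappa> :: "'a \<Rightarrow> 'e::finite_dim_normed \<Rightarrow> 'w::finite_dim_normed" and M :: "('a, 'e) manifold"
  assumes M: "charted M" and \<kappa>: "smooth_one_form M \<kappa>" and bij: "\<And>u. u \<in> points M \<Longrightarrow> bij (\<kappa> u)"
    and c: "c \<in> atlas M" "x \<in> fst c"
  shows "smooth_near M vec_manifold (\<lambda>u. tangent_map M vec_manifold (snd c) u (cartan_field \<kappa> w u)) x"
proof -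
  define S where "S = snd c ` fst c"
  have S: "open S" unfolding S_def by (rule charted_open_image[OF M c(1) charted_chart_open[OF M c(1)] order_refl])
  define T where "T u = tangent_map M vec_manifold (snd c) u" for u
  define T' where "T' y = tangent_map vec_manifold M (chart_inv c) y" for y
  define K where "K y v = \<kappa> (chart_inv c y) (T' y v)" for y v
  have inv: "chart_inv c (snd c u) = u" if "u \<in> fst c" for u by (rule charted_inv[OF M c(1) that])
  \<comment> \<open>\<open>T\<close> and \<open>T'\<close> convert between the preferred components
    at \<open>u\<close> and components in \<open>c\<close>; being mutually inverse, they transfer
    bijectivity from \<open>\<kappa> u\<close> to \<open>K y\<close>.\<close>
  have T'T: "T' (snd c u) (T u v) = v" if u: "u \<in> fst c" for u v
  proof -
    have "smooth_near vec_manifold M (chart_inv c) (snd c u)"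
      by (rule smooth_near_chart_inv[OF M c(1)]) (use u in blast)
    from tangent_map_left_inverse[OF M charted_vec_manifold smooth_near_chart[OF M c(1) u] this
        charted_chart_open[OF M c(1)] u inv]
    show ?thesis by (simp add: T_def T'_def)
  qed
  have TT': "T u (T' (snd c u) v) = v" if u: "u \<in> fst c" for u v
  proof -
    have s: "snd c u \<in> snd c ` fst c" using u by blast
    have s': "smooth_near M vec_manifold (snd c) (chart_inv c (snd c u))"
      unfolding inv[OF u] by (rule smooth_near_chart[OF M c(1) u])
    have o: "openin (mtop vec_manifold) (snd c ` fst c)" using S by (simp add: S_def)
    from tangent_map_left_inverse[OF charted_vec_manifold M smooth_near_chart_inv[OF M c(1) s] s' o s, of v]
    show ?thesis using inv[OF u] by (simp add: T_def T'_def f_inv_into_f)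
  qed
  have K: "linear (K y) \<and> bij (K y) \<and> (\<forall>w. inv_into UNIV (K y) w = T (chart_inv c y) (cartan_field \<kappa> w (chart_inv c y)))"
    if yS: "y \<in> S" for y
  proof -
    obtain u where u: "u \<in> fst c" "y = snd c u" using yS by (auto simp: S_def)
    have up: "u \<in> points M" by (rule charted_points[OF M c(1) u(1)])
    have Ku: "K y v = \<kappa> u (T' (snd c u) v)" for v by (simp add: K_def u inv)
    have lT: "linear (T' (snd c u))"
      unfolding T'_def
      by (rule linear_tangent_map[OF charted_vec_manifold M smooth_near_chart_inv[OF M c(1)]]) (use u in blast)
    have l\<kappa>: "linear (\<kappa> u)" using \<kappa> up by (simp add: smooth_one_form_def)
    have "linear (K y)" using linear_compose[OF lT l\<kappa>] unfolding Ku[abs_def] comp_def by (simp add: Ku)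
    moreover have inj: "inj (K y)"
      using bij_is_inj[OF bij[OF up]] TT'[OF u(1)] unfolding inj_def Ku by metis
    moreover have KT: "K y (T u (cartan_field \<kappa> w u)) = w" for w
      using bij_is_surj[OF bij[OF up]] by (simp add: Ku T'T[OF u(1)] cartan_field_def surj_f_inv_f)
    moreover have "surj (K y)" using KT by (rule surjI)
    moreover have "inv_into UNIV (K y) w = T u (cartan_field \<kappa> w u)" for w
      by (rule inv_f_eq[OF inj KT])
    ultimately show ?thesis by (simp add: u inv bij_def)
  qed
  have sm: "smooth_on S (\<lambda>y. inv_into UNIV (K y) w)"
  proof (rule smooth_on_linear_inverse[OF S])
    show "linear (K y) \<and> bij (K y)" if "y \<in> S" for y using K[OF that] by blast
    show "smooth_on S (\<lambda>y. K y v)" for v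
      using \<kappa> c(1) by (simp add: smooth_one_form_def S_def K_def T'_def)
  qed
  have "smooth_on S (\<lambda>y. T (chart_inv c y) (cartan_field \<kappa> w (chart_inv c y)))"
    by (rule iffD1[OF smooth_on_cong[OF S] sm]) (use K in blast)
  then show ?thesis
    unfolding S_def T_def
    by (rule smooth_near_vecI[OF c(1) charted_chart_open[OF M c(1)] c(2) order_refl])
qed

text \<open>Used with \<open>p = T proj\<close> and a displacement form \<open>\<theta>\<close>: strict horizontality only says that the
  kernels agree, and surjectivity onto \<open>V\<close> comes from \<open>dim M = dim V\<close>.\<close>

lemma linear_surj_onto_subspace:
  fixes p :: "'a::finite_dim_normed \<Rightarrow> 'b::finite_dim_normed" and \<theta> :: "'a \<Rightarrow> 'c::finite_dim_normed"
  assumes p: "linear p" "surj p" and \<theta>: "linear \<theta>" "range \<theta> \<subseteq> V" "\<And>x. \<theta> x = 0 \<Longrightarrow> p x = 0"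
    and dim: "dim (UNIV :: 'b set) = dim V"
  shows "V \<subseteq> range \<theta>"
proof -
  obtain \<sigma> where \<sigma>: "linear \<sigma>" "p \<circ> \<sigma> = id"
    using linear_surjective_right_inverse[OF p] by blast
  have lin: "linear (\<lambda>x. \<theta> (\<sigma> x))" using linear_compose[OF \<sigma>(1) \<theta>(1)] by (simp add: comp_def)
  \<comment> \<open>If \<open>\<theta> (\<sigma> x) = 0\<close>, then
    \<open>p (\<sigma> x) = 0\<close>, and \<open>p (\<sigma> x)\<close> is \<open>x\<close>. So a
    basis of the target of \<open>p\<close> yields \<open>dim V\<close> independent vectors in the
    range of \<open>\<theta>\<close>.\<close>
  have inj: "inj (\<lambda>x. \<theta> (\<sigma> x))"
    unfolding linear_injective_0[OF lin]
    using \<theta>(3) \<sigma>(2) by (metis comp_apply id_apply)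
  define B where "B = (\<lambda>x. \<theta> (\<sigma> x)) ` fin_basis"
  have ind: "independent B"
    unfolding B_def by (rule linear_independent_injective_image[OF lin fin_basis(2) inj_on_subset[OF inj]]) simp
  have BV: "B \<subseteq> V" unfolding B_def using \<theta>(2) by blast
  have "card B = card (fin_basis :: 'b set)"
    unfolding B_def by (rule card_image[OF inj_on_subset[OF inj]]) simp
  also have "\<dots> = dim (UNIV :: 'b set)"
    by (metis dim_eq_card_independent[OF fin_basis(2)] dim_span fin_basis(3))
  finally have card: "dim V \<le> card B" by (simp add: dim)
  interpret fd: finite_dimensional_vector_space "scaleR :: real \<Rightarrow> 'c \<Rightarrow> 'c" fin_basis
    by (rule finite_dimensional_vector_space_fin_basis)
  have "V \<subseteq> span B"
    using fd.card_ge_dim_independent[folded span_raw_def dependent_raw_def dim_raw_def, OF BV ind card] .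
  also have "span B \<subseteq> range \<theta>"
    by (rule span_minimal) (auto simp: B_def intro: linear_subspace_image[OF \<theta>(1) subspace_UNIV])
  finally show ?thesis .
qed

section \<open>The correspondence for a reductive pair\<close>

locale reductive_bundle =
  fixes H :: "('h, 'eh::finite_dim_normed) lie_group_data"
    and G :: "('h, 'eg::finite_dim_normed) lie_group_data"
    and V :: "'eh set"
    and B :: "('p, 'ep::finite_dim_normed, 'm, 'em::finite_dim_normed, 'h) bundle_data"
  assumes S: "lie_subgroup G H"
    and R: "reductive_decomposition H G V"
    and faithful: "inj_on (\<lambda>g. restrict (Ad H g) V) (carrier G)"
    and P: "principal_bundle G B"
    and dimV: "dim (UNIV :: 'em set) = dim V"
begin

abbreviation "\<iota> \<equiv> lie_inclusion G H"
abbreviation "\<gg> \<equiv> range (lie_inclusion G H)"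

lemmas lG = lie_subgroupD(1)[OF S]
lemmas lH = lie_subgroupD(2)[OF S]
lemmas cB = principal_bundleD(2)[OF P]
lemmas linear_\<iota> = lie_inclusion_linear_inj(1)[OF S]
lemmas inj_\<iota> = lie_inclusion_linear_inj(2)[OF S]

lemma subspace_V: "subspace V"
  and V_g: "V \<inter> \<gg> = {0}" "{v + Y | v Y. v \<in> V \<and> Y \<in> \<gg>} = UNIV"
  and Ad_V: "g \<in> carrier G \<Longrightarrow> Ad H g ` V \<subseteq> V"
  using R by (auto simp: reductive_decomposition_def Let_def)

lemma subspace_g: "subspace \<gg>"
  by (rule linear_subspace_image[OF linear_\<iota> subspace_UNIV])

lemma g_V: "\<gg> \<inter> V = {0}" "{Y + v | Y v. Y \<in> \<gg> \<and> v \<in> V} = UNIV"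
proof -
  show "\<gg> \<inter> V = {0}" using V_g(1) by blast
  have "x \<in> {Y + v | Y v. Y \<in> \<gg> \<and> v \<in> V}" for x
  proof -
    have "x \<in> {v + Y | v Y. v \<in> V \<and> Y \<in> \<gg>}" using V_g(2) by simp
    then obtain v Y where x: "x = v + Y" and vY: "v \<in> V" "Y \<in> \<gg>" by blast
    have "x = Y + v" using x by (simp add: add.commute)
    then show ?thesis using vY by blast
  qed
  then show "{Y + v | Y v. Y \<in> \<gg> \<and> v \<in> V} = UNIV" by blast
qed

lemma Ad_g: "g \<in> carrier G \<Longrightarrow> Ad H g ` \<gg> \<subseteq> \<gg>"
  using Ad_lie_inclusion[OF S] by auto

lemma inv_carrier: "g \<in> carrier G \<Longrightarrow> m_inv G g \<in> carrier G" "g \<in> carrier G \<Longrightarrow> m_inv H g = m_inv G g"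
  using group.inv_closed[OF lie_groupD(1)[OF lG]] lie_subgroup_inv[OF S] by auto

lemma linear_Ad_H: "g \<in> carrier G \<Longrightarrow> linear (Ad H g)"
  by (rule linear_Ad[OF lH lie_subgroup_subset[OF S]])

text \<open>The projection onto the subalgebra still takes values in the Lie algebra of
  \<open>H\<close>; a connection form needs them in the model space of \<open>G\<close>, hence the
  pullback along the injective inclusion.\<close>

definition pr_g :: "'eh \<Rightarrow> 'eg" where
  "pr_g x = inv_into UNIV \<iota> (proj_along \<gg> V x)"

lemma \<iota>_pr_g: "\<iota> (pr_g x) = proj_along \<gg> V x"
  unfolding pr_g_def by (rule f_inv_into_f[OF proj_along(1)[OF subspace_g subspace_V g_V]])

lemma pr_g_eqI: "\<iota> Y = proj_along \<gg> V x \<Longrightarrow> pr_g x = Y"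
  unfolding pr_g_def by (rule inv_f_eq[OF inj_\<iota>])

lemma linear_pr_g: "linear pr_g"
  by (rule linearI; rule pr_g_eqI)
    (simp_all add: linear_add[OF linear_\<iota>] linear_scale[OF linear_\<iota>] \<iota>_pr_g
      linear_add[OF linear_proj_along[OF subspace_g subspace_V g_V]]
      linear_scale[OF linear_proj_along[OF subspace_g subspace_V g_V]])

lemma pr_g_Ad: "g \<in> carrier G \<Longrightarrow> pr_g (Ad H g x) = Ad G g (pr_g x)"
  by (rule pr_g_eqI)
    (simp add: Ad_lie_inclusion[OF S, symmetric] \<iota>_pr_g
      proj_along_commute[OF subspace_g subspace_V g_V linear_Ad_H Ad_g Ad_V])

lemma pr_g_\<iota>: "pr_g (\<iota> Y) = Y"
  by (rule pr_g_eqI, rule proj_along_eqI[OF subspace_g subspace_V g_V(1), symmetric])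
    (simp_all add: subspace_0[OF subspace_V])

text \<open>Faithfulness enters here, as injectivity into the general linear group of
  \<open>V\<close>. The product law passes from \<open>H\<close> to \<open>G\<close> because the two
  multiplications agree on \<open>carrier G\<close>.\<close>

lemma linear_lie_group_Ad: "linear_lie_group G V (Ad H)"
  unfolding linear_lie_group_def
proof (intro conjI ballI allI)
  interpret G: group G by (rule lie_groupD(1)[OF lG])
  show "lie_group G" "subspace V" by (rule lG subspace_V)+
  show "inj_on (\<lambda>g. restrict (Ad H g) V) (carrier G)" by (rule faithful)
  show "Ad H \<one>\<^bsub>G\<^esub> v = v" for v unfolding lie_subgroup_one[OF S] by (rule Ad_one[OF lH])
  fix g assume g: "g \<in> carrier G"
  show "Ad H g ` V \<subseteq> V" by (rule Ad_V[OF g])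
  show "Ad H g (a *\<^sub>R v + b *\<^sub>R w) = a *\<^sub>R Ad H g v + b *\<^sub>R Ad H g w" for a b v w
    using linear_Ad_H[OF g] by (simp add: linear_add linear_scale)
  show "Ad H (g \<otimes>\<^bsub>G\<^esub> h) v = Ad H g (Ad H h v)" if "h \<in> carrier G" for h v
    using Ad_mult[OF lH lie_subgroup_subset[OF S g] lie_subgroup_subset[OF S that]] lie_subgroupD(4)[OF S g that]
    by simp
next
  show "smooth_map (mfd G) vec_manifold (\<lambda>g. Ad H g v)" for v
    by (rule smooth_near_imp_smooth_map[OF lie_groupD(2)[OF lG] charted_vec_manifold smooth_near_Ad_subgroup(1)[OF S]])
      (simp add: lie_groupD(3)[OF lG])
qed

lemma fundamental_field_vertical:
  assumes "u \<in> points (total B)"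
  shows "fundamental_field G B X u \<in> vertical_space B u"
  using vertical_space_eq_fundamental_fields(2)[OF P assms] by blast

lemma cartan_connection_components:
  assumes \<kappa>: "principal_cartan_connection H G B \<kappa>"
  shows "displacement_form G V (Ad H) B (\<lambda>u \<xi>. proj_along V \<gg> (\<kappa> u \<xi>))"
    and "principal_connection_form G B (\<lambda>u \<xi>. pr_g (\<kappa> u \<xi>))"
proof -
  note prV = proj_along[OF subspace_V subspace_g V_g]
  have form: "smooth_one_form (total B) \<kappa>"
    and bij: "\<And>u. u \<in> points (total B) \<Longrightarrow> bij (\<kappa> u)"
    and vert: "\<And>u \<xi>. u \<in> points (total B) \<Longrightarrow> \<xi> \<in> vertical_space B u \<Longrightarrow>
      \<kappa> u \<xi> = \<iota> (vertical_parallelism G B u \<xi>)"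
    and equiv: "\<And>u g \<xi>. u \<in> points (total B) \<Longrightarrow> g \<in> carrier G \<Longrightarrow>
      \<kappa> (act B u g) (tangent_act B g u \<xi>) = Ad H (m_inv H g) (\<kappa> u \<xi>)"
    using \<kappa> by (auto simp: principal_cartan_connection_def)
  \<comment> \<open>The condition on vertical vectors is used in this form: the Cartan form returns
    the generator of a fundamental field.\<close>
  have \<kappa>_fund: "\<kappa> u (fundamental_field G B X u) = \<iota> X" if "u \<in> points (total B)" for u X
    using vert[OF that fundamental_field_vertical[OF that]] vertical_parallelism_fundamental_field[OF P that]
    by simp
  show "principal_connection_form G B (\<lambda>u \<xi>. pr_g (\<kappa> u \<xi>))"
    unfolding principal_connection_form_def
  proof (intro conjI ballI allI)
    show "smooth_one_form (total B) (\<lambda>u \<xi>. pr_g (\<kappa> u \<xi>))"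
      by (rule smooth_one_form_linear[OF cB form linear_pr_g])
    show "pr_g (\<kappa> (act B u g) (tangent_act B g u \<xi>)) = Ad G (m_inv G g) (pr_g (\<kappa> u \<xi>))"
      if "u \<in> points (total B)" "g \<in> carrier G" for u g \<xi>
      using equiv[OF that] pr_g_Ad[OF inv_carrier(1)[OF that(2)]] inv_carrier(2)[OF that(2)] by simp
    show "pr_g (\<kappa> u (fundamental_field G B X u)) = X" if "u \<in> points (total B)" for u X
      by (simp add: \<kappa>_fund[OF that] pr_g_\<iota>)
  qed
  show "displacement_form G V (Ad H) B (\<lambda>u \<xi>. proj_along V \<gg> (\<kappa> u \<xi>))"
    unfolding displacement_form_def
  proof (intro conjI ballI allI)
    show "smooth_one_form (total B) (\<lambda>u \<xi>. proj_along V \<gg> (\<kappa> u \<xi>))"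
      by (rule smooth_one_form_linear[OF cB form linear_proj_along[OF subspace_V subspace_g V_g]])
    show "range (\<lambda>\<xi>. proj_along V \<gg> (\<kappa> u \<xi>)) \<subseteq> V" for u using prV(1) by blast
    show "proj_along V \<gg> (\<kappa> (act B u g) (tangent_act B g u \<xi>)) = Ad H (m_inv G g) (proj_along V \<gg> (\<kappa> u \<xi>))"
      if "u \<in> points (total B)" "g \<in> carrier G" for u g \<xi>
      using equiv[OF that] inv_carrier(2)[OF that(2)]
        proj_along_commute[OF subspace_V subspace_g V_g linear_Ad_H[OF inv_carrier(1)[OF that(2)]]
          Ad_V[OF inv_carrier(1)[OF that(2)]] Ad_g[OF inv_carrier(1)[OF that(2)]]]
      by simp
    fix u assume u: "u \<in> points (total B)"
    show "{\<xi>. proj_along V \<gg> (\<kappa> u \<xi>) = 0} = vertical_space B u"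
    proof (intro subset_antisym subsetI)
      fix \<xi> assume "\<xi> \<in> {\<xi>. proj_along V \<gg> (\<kappa> u \<xi>) = 0}"
      then have "\<kappa> u \<xi> \<in> \<gg>" using prV(2)[of "\<kappa> u \<xi>"] by simp
      \<comment> \<open>A value in the subalgebra is already attained at a fundamental vector;
        injectivity leaves no other preimage.\<close>
      then obtain X where "\<kappa> u \<xi> = \<kappa> u (fundamental_field G B X u)" using \<kappa>_fund[OF u] by auto
      then have "\<xi> = fundamental_field G B X u" using bij_is_inj[OF bij[OF u]] by (simp add: inj_eq)
      then show "\<xi> \<in> vertical_space B u" using fundamental_field_vertical[OF u] by simp
    next
      fix \<xi> assume "\<xi> \<in> vertical_space B u"
      then have "\<kappa> u \<xi> \<in> \<gg>" using vert[OF u] by simp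
      then have "proj_along V \<gg> (\<kappa> u \<xi>) = 0"
        by (intro proj_along_eqI[OF subspace_V subspace_g V_g(1)]) (simp_all add: subspace_0[OF subspace_V])
      then show "\<xi> \<in> {\<xi>. proj_along V \<gg> (\<kappa> u \<xi>) = 0}" by simp
    qed
  qed
qed

lemma cartan_connection_of_components:
  assumes \<theta>: "displacement_form G V (Ad H) B \<theta>" and \<omega>: "principal_connection_form G B \<omega>"
  shows "principal_cartan_connection H G B (\<lambda>u \<xi>. \<theta> u \<xi> + \<iota> (\<omega> u \<xi>))"
proof -
  interpret G: group G by (rule lie_groupD(1)[OF lG])
  have \<theta>_form: "smooth_one_form (total B) \<theta>"
    and \<theta>_V: "\<And>u \<xi>. u \<in> points (total B) \<Longrightarrow> \<theta> u \<xi> \<in> V"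
    and \<theta>_equiv: "\<And>u g \<xi>. u \<in> points (total B) \<Longrightarrow> g \<in> carrier G \<Longrightarrow>
      \<theta> (act B u g) (tangent_act B g u \<xi>) = Ad H (m_inv G g) (\<theta> u \<xi>)"
    and \<theta>_ker: "\<And>u. u \<in> points (total B) \<Longrightarrow> {\<xi>. \<theta> u \<xi> = 0} = vertical_space B u"
    using \<theta> by (auto simp: displacement_form_def)
  have \<omega>_form: "smooth_one_form (total B) \<omega>"
    and \<omega>_equiv: "\<And>u g \<xi>. u \<in> points (total B) \<Longrightarrow> g \<in> carrier G \<Longrightarrow>
      \<omega> (act B u g) (tangent_act B g u \<xi>) = Ad G (m_inv G g) (\<omega> u \<xi>)"
    and \<omega>_fund: "\<And>u X. u \<in> points (total B) \<Longrightarrow> \<omega> u (fundamental_field G B X u) = X"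
    using \<omega> by (auto simp: principal_connection_form_def)
  define \<kappa> where "\<kappa> = (\<lambda>u \<xi>. \<theta> u \<xi> + \<iota> (\<omega> u \<xi>))"
  have form: "smooth_one_form (total B) \<kappa>"
    unfolding \<kappa>_def
    by (rule smooth_one_form_add[OF cB \<theta>_form smooth_one_form_linear[OF cB \<omega>_form linear_\<iota>]])
  have linear: "linear (\<kappa> u)" "linear (\<theta> u)" "linear (\<omega> u)" if "u \<in> points (total B)" for u
    using form \<theta>_form \<omega>_form that by (auto simp: smooth_one_form_def)
  have \<theta>_fund: "\<theta> u (fundamental_field G B X u) = 0" if "u \<in> points (total B)" for u X
    using \<theta>_ker[OF that] fundamental_field_vertical[OF that] by blast
  have \<kappa>_fund: "\<kappa> u (fundamental_field G B X u) = \<iota> X" if "u \<in> points (total B)" for u X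
    by (simp add: \<kappa>_def \<theta>_fund[OF that] \<omega>_fund[OF that])
  have bij: "bij (\<kappa> u)" if u: "u \<in> points (total B)" for u
  proof (rule bijI)
    have "\<xi> = 0" if "\<kappa> u \<xi> = 0" for \<xi>
    proof -
      \<comment> \<open>\<open>V\<close> and the subalgebra meet only in 0, so both components
        vanish: the first makes \<open>\<xi>\<close> fundamental, the second makes its generator
        0.\<close>
      have "\<theta> u \<xi> = - \<iota> (\<omega> u \<xi>)" using that by (simp add: \<kappa>_def eq_neg_iff_add_eq_0)
      then have "\<theta> u \<xi> \<in> \<gg>" using linear_neg[OF linear_\<iota>] by (metis rangeI)
      then have \<theta>0: "\<theta> u \<xi> = 0" using \<theta>_V[OF u] V_g(1) by blast
      then obtain X where X: "\<xi> = fundamental_field G B X u"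
        using \<theta>_ker[OF u] vertical_space_eq_fundamental_fields(2)[OF P u] by blast
      have "\<iota> X = \<iota> 0" using that \<kappa>_fund[OF u] X linear_0[OF linear_\<iota>] by simp
      then have "X = 0" using inj_\<iota> by (simp add: inj_eq)
      then show ?thesis using X linear_0[OF linear_fundamental_field[OF P u]] by simp
    qed
    then show "inj (\<kappa> u)" by (simp add: linear_injective_0[OF linear(1)[OF u]])
    \<comment> \<open>\<open>\<theta> u\<close> and the tangent map of the projection have the same
      kernel; as the latter is onto a space of dimension \<open>dim V\<close>, the former fills
      \<open>V\<close>.\<close>
    have V_range: "V \<subseteq> range (\<theta> u)"
    proof (rule linear_surj_onto_subspace[OF _ surj_tangent_map_proj[OF P u] linear(2)[OF u] _ _ dimV])
      show "linear (tangent_map (total B) (base B) (proj B) u)"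
        by (rule linear_tangent_map[OF cB principal_bundleD(3)[OF P] smooth_near_proj[OF P u]])
      show "range (\<theta> u) \<subseteq> V" using \<theta>_V[OF u] by blast
      show "tangent_map (total B) (base B) (proj B) u \<xi> = 0" if "\<theta> u \<xi> = 0" for \<xi>
        using \<theta>_ker[OF u] that by (auto simp: vertical_space_def)
    qed
    have "y \<in> range (\<kappa> u)" for y
    proof -
      have "y \<in> {v + Y | v Y. v \<in> V \<and> Y \<in> \<gg>}" using V_g(2) by simp
      then obtain v X where y: "y = v + \<iota> X" "v \<in> V" by blast
      then obtain \<xi> where \<xi>: "v = \<theta> u \<xi>" using V_range by blast
      \<comment> \<open>A fundamental vector is invisible to \<open>\<theta>\<close>, so it adjusts
        the second component without disturbing \<open>v\<close>.\<close>
      have "\<kappa> u (\<xi> + fundamental_field G B (X - \<omega> u \<xi>) u) = y"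
        using \<kappa>_fund[OF u] y \<xi>
        by (simp add: linear_add[OF linear(1)[OF u]] linear_diff[OF linear_\<iota>]) (simp add: \<kappa>_def)
      then show ?thesis by (metis rangeI)
    qed
    then show "surj (\<kappa> u)" by blast
  qed
  have equiv: "\<kappa> (act B u g) (tangent_act B g u \<xi>) = Ad H (m_inv H g) (\<kappa> u \<xi>)"
    if u: "u \<in> points (total B)" and g: "g \<in> carrier G" for u g \<xi>
    using \<theta>_equiv[OF u g] \<omega>_equiv[OF u g] Ad_lie_inclusion[OF S inv_carrier(1)[OF g]] inv_carrier(2)[OF g]
    by (simp add: \<kappa>_def linear_add[OF linear_Ad_H[OF inv_carrier(1)[OF g]]])
  have act_pt: "act B u g \<in> points (total B)" if "u \<in> points (total B)" "g \<in> carrier G" for u g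
    using smooth_near_codomain[OF cB principal_bundle_act_smooth[OF P that]] by simp
  have cartanI: "cartan_field \<kappa> w u = \<xi>" if "u \<in> points (total B)" "\<kappa> u \<xi> = w" for u \<xi> w
    unfolding cartan_field_def by (rule inv_f_eq[OF bij_is_inj[OF bij[OF that(1)]] that(2)])
  have \<kappa>_cartan: "\<kappa> u (cartan_field \<kappa> w u) = w" if "u \<in> points (total B)" for u w
    unfolding cartan_field_def by (rule surj_f_inv_f[OF bij_is_surj[OF bij[OF that]]])
  have bracket: "vf_bracket (total B) (cartan_field \<kappa> X) (cartan_field \<kappa> (\<iota> Y)) x =
      cartan_field \<kappa> (lie_algebra_bracket H X (\<iota> Y)) x" if x: "x \<in> points (total B)" for X Y x
  proof -
    interpret H: group H by (rule lie_groupD(1)[OF lH])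
    define \<beta> where "\<beta> g = Ad H (m_inv H g) X" for g
    have \<beta>1: "\<beta> \<one>\<^bsub>G\<^esub> = X" by (simp add: \<beta>_def lie_subgroup_one[OF S] Ad_one[OF lH])
    have "vf_bracket (total B) (cartan_field \<kappa> (\<beta> \<one>\<^bsub>G\<^esub>)) (cartan_field \<kappa> (\<iota> Y)) x =
        cartan_field \<kappa> (tangent_map (mfd G) vec_manifold \<beta> \<one>\<^bsub>G\<^esub> Y) x"
    proof (rule bracket_of_equivariant_fields[OF cB lie_groupD(2)[OF lG] principal_bundle_act_smooth[OF P x G.one_closed]])
      show "act B u \<one>\<^bsub>G\<^esub> = u" if "u \<in> points (total B)" for u by (rule principal_bundleD(6)[OF P that])
      show "linear (\<lambda>w. cartan_field \<kappa> w u)" if "u \<in> points (total B)" for u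
        using linear_inv[OF linear(1)[OF that] bij[OF that]] unfolding cartan_field_def .
      show "smooth_near (total B) vec_manifold
          (\<lambda>u. tangent_map (total B) vec_manifold (snd (chart_at (total B) x)) u (cartan_field \<kappa> w u)) x" for w
        by (rule smooth_near_cartan_field[OF cB form bij chart_at[OF cB x]])
      \<comment> \<open>For indices in the subalgebra the Cartan field is the fundamental field,
        which generates the action.\<close>
      show "cartan_field \<kappa> (\<iota> Y) u = tangent_map (mfd G) (total B) (act B u) \<one>\<^bsub>G\<^esub> Y"
        if "u \<in> points (total B)" for u
        using cartanI[OF that \<kappa>_fund[OF that]] fundamental_field_eq_tangent_map[OF P that] by simp
      show "smooth_near (mfd G) vec_manifold \<beta> \<one>\<^bsub>G\<^esub>"
        unfolding \<beta>_def by (rule smooth_near_Ad_subgroup(2)[OF S G.one_closed])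
      fix g assume "g \<in> points (mfd G)"
      then have g: "g \<in> carrier G" using lie_groupD(3)[OF lG] by simp
      \<comment> \<open>Equivariance of \<open>\<kappa>\<close>, read for its inverse at
        \<open>act B x g\<close>.\<close>
      show "tangent_map (total B) (total B) (\<lambda>u. act B u g) x (cartan_field \<kappa> (\<beta> \<one>\<^bsub>G\<^esub>) x) =
          cartan_field \<kappa> (\<beta> g) (act B x g)"
        using cartanI[OF act_pt[OF x g] equiv[OF x g], of "cartan_field \<kappa> X x"]
        by (simp add: \<beta>1 \<kappa>_cartan[OF x]) (simp add: \<beta>_def tangent_act_def)
    qed
    then show ?thesis
      unfolding \<beta>1
      using lie_algebra_bracket_eq_derivative_Ad_subgroup[OF S, of X Y] by (simp add: \<beta>_def[abs_def])
  qed
  have vert: "\<kappa> u \<xi> = \<iota> (vertical_parallelism G B u \<xi>)"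
    if u: "u \<in> points (total B)" and \<xi>: "\<xi> \<in> vertical_space B u" for u \<xi>
  proof -
    obtain X where "\<xi> = fundamental_field G B X u"
      using \<xi> vertical_space_eq_fundamental_fields(2)[OF P u] by blast
    then show ?thesis using \<kappa>_fund[OF u] vertical_parallelism_fundamental_field[OF P u] by simp
  qed
  show ?thesis
    unfolding principal_cartan_connection_def \<kappa>_def[symmetric]
    using form linear(1) bij bracket vert equiv by blast
qed

end

theorem proposition2p4:
  fixes H :: "('h, 'eh::finite_dim_normed) lie_group_data"
    and G :: "('h, 'eg::finite_dim_normed) lie_group_data"
    and V :: "'eh set"
    and B :: "('p, 'ep::finite_dim_normed, 'm, 'em::finite_dim_normed, 'h) bundle_data"
  assumes "lie_group H"
    and "lie_subgroup G H"
    and "reductive_decomposition H G V"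
    and "inj_on (\<lambda>g. restrict (Ad H g) V) (carrier G)"
    and "principal_bundle G B"
    and "dim (UNIV :: 'em set) = dim V"
  shows
    "(\<forall>\<kappa>. principal_cartan_connection H G B \<kappa> \<longrightarrow>
        (let \<gg> = range (lie_inclusion G H);
             \<theta> = (\<lambda>u \<xi>. proj_along V \<gg> (\<kappa> u \<xi>));
             \<omega> = (\<lambda>u \<xi>. inv_into UNIV (lie_inclusion G H) (proj_along \<gg> V (\<kappa> u \<xi>)))
         in displacement_form G V (Ad H) B \<theta> \<and> principal_connection_form G B \<omega> \<and>
            G_structure G V (Ad H) B \<theta>)) \<and>
     (\<forall>\<theta> \<omega>. G_structure G V (Ad H) B \<theta> \<and> principal_connection_form G B \<omega> \<longrightarrow>
        principal_cartan_connection H G B (\<lambda>u \<xi>. \<theta> u \<xi> + lie_inclusion G H (\<omega> u \<xi>)))"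
proof -
  interpret reductive_bundle H G V B
    using assms(2-6) by (rule reductive_bundle.intro)
  show ?thesis
    using cartan_connection_components cartan_connection_of_components linear_lie_group_Ad assms(5,6)
    by (simp add: Let_def G_structure_def pr_g_def)
qed

end
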